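(* Let $\beta\in(1/3,1/2)$, $0<\gamma<\gamma_1$ and $0<d<d_1$, where $\gamma_1,d_1$ are the constants defined in the context. Let $u_0\in\mathcal A$ satisfy $J(u_0)=\inf_{\mathcal A}J$ and let $v_0=\mathcal N u_0$ (so that the even extension of $(u_0,v_0)$ is the standing pulse solution of $d u_{xx}+f(u)-v=0$, $v_{xx}-\gamma v-v^3+u=0$ constructed in the paper). Then: (i) There is a pair of unique points $0<x_1<x_2<\infty$ such that $u_0(x_1)=\beta$ and $u_0(x_2)=0$, respectively. Moreover $u_0'(x_1)<0$ and $u_0'(x_2)<0$. (ii) $u_0>\beta$ on $[0,x_1)$, $0<u_0<\beta$ on $(x_1,x_2)$ and $u_0<0$ on $(x_2,\infty)$. (iii) $u_0'<0$ on $[x_1,x_2]$. (iv) $u_0$ possesses one global negative minimum on $(x_2,\infty)$; this is also the unique local minimum point of $u_0$ on $[x_1,\infty)$. (v) $v_0>0$ on $[0,\infty)$.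
   Context: $f(\xi)=\xi(1-\xi)(\xi-\beta)$ and $F(\xi)=-\int_0^\xi f(\eta)\,d\eta=\frac{\xi^4}{4}-\frac{(1+\beta)\xi^3}{3}+\frac{\beta\xi^2}{2}$. For $w\in H^1(0,\infty)$, $\mathcal N w$ denotes the unique $v\in H^1(0,\infty)$ with $\int_0^\infty\{v'\varphi'+\gamma v\varphi+v^3\varphi-w\varphi\}\,dx=0$ for all $\varphi\in H^1(0,\infty)$; it lies in $H^3(0,\infty)$, satisfies $v''-\gamma v-v^3+w=0$ and $v'(0)=0$. $M=M(\gamma)$ is a fixed constant such that $f(\xi)\ge 1+1/\gamma$ for all $\xi\le -M$. The admissible class $\mathcal A$ is the set of $w\in H^1(0,\infty)$ with $\beta\le w(0)\le1$ for which there exist $0\le x_1<x_2\le\infty$ such that $\beta\le w\le1$ on $[0,x_1]$, $0\le w\le\beta$ on $(x_1,x_2]$ and $-(M+1)\le w\le0$ on $(x_2,\infty)$ (the condition $\beta\le w(0)\le1$ is considered vacuous if $x_1=0$). For $w\in\mathcal A$, $J(w)=\int_0^\infty\{\frac d2 w'^2+\frac12 w\,\mathcal N w+F(w)+\frac14(\mathcal N w)^4\}\,dx$. Constants: $\gamma_0=\frac{3\beta^2}{1-2\beta}-1$; $\gamma_1=\min\{\gamma_0,\,2(\beta+F(\beta))-\tfrac12\}$. $d_0=d_0(\gamma)>0$ is a fixed constant with the property (such a constant exists) that there is $M_0=M_0(\gamma)>0$, independent of $d$, such that for every $0<d\le d_0$ some $q_0\in\mathcal A$ satisfies $J(q_0)\le-M_0$.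 Finally $d_1=\min\{d_0,\frac{\beta^2}{4(1+\beta\gamma)}\}$. *)

theory Defs
  imports "HOL-Analysis.Analysis"
begin

text \<open>
  Functions on the half-line $(0,\infty)$ are represented by functions of type \<open>real \<Rightarrow> real\<close>;
  their values at negative arguments are never inspected.
\<close>

definition L2 :: "(real \<Rightarrow> real) set" where
  "L2 = {w. set_borel_measurable lborel {0<..} w \<and> set_integrable lborel {0<..} (\<lambda>x. (w x)\<^sup>2)}"

definition test_functions :: "(real \<Rightarrow> real) set" where
  "test_functions = {\<phi>. \<phi> C1_differentiable_on UNIV \<and>
     compact (closure {x. \<phi> x \<noteq> 0}) \<and> closure {x. \<phi> x \<noteq> 0} \<subseteq> {0<..}}"

definition has_weak_deriv :: "(real \<Rightarrow> real) \<Rightarrow> (real \<Rightarrow> real) \<Rightarrow> bool" where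
  "has_weak_deriv w g \<longleftrightarrow> (\<forall>\<phi>\<in>test_functions.
     (LBINT x:{0<..}. w x * deriv \<phi> x) = - (LBINT x:{0<..}. g x * \<phi> x))"

text \<open>
  A class in $H^1(0,\infty)$ is identified with its unique representative that is continuous on
  $[0,\infty)$, so that pointwise statements such as $\beta \le w(0)$ make sense.
\<close>

definition H1 :: "(real \<Rightarrow> real) set" where
  "H1 = {w. continuous_on {0..} w \<and> w \<in> L2 \<and> (\<exists>g\<in>L2. has_weak_deriv w g)}"

text \<open>The weak derivative is determined only almost everywhere; it is used under integrals only.\<close>

definition wderiv :: "(real \<Rightarrow> real) \<Rightarrow> real \<Rightarrow> real" where
  "wderiv w = (SOME g. g \<in> L2 \<and> has_weak_deriv w g)"

definition f :: "real \<Rightarrow> real \<Rightarrow> real" where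
  "f \<beta> \<xi> = \<xi> * (1 - \<xi>) * (\<xi> - \<beta>)"

definition F :: "real \<Rightarrow> real \<Rightarrow> real" where
  "F \<beta> \<xi> = - (LBINT \<eta>=0..\<xi>. f \<beta> \<eta>)"

lemma F_eq: "F \<beta> \<xi> = \<xi>^4 / 4 - (1 + \<beta>) * \<xi>^3 / 3 + \<beta> * \<xi>\<^sup>2 / 2"
proof -
  define G where "G \<eta> = - (\<eta>^4 / 4 - (1 + \<beta>) * \<eta>^3 / 3 + \<beta> * \<eta>\<^sup>2 / 2)" for \<eta> :: real
  have "(G has_real_derivative f \<beta> \<eta>) (at \<eta> within S)" for \<eta> S
    unfolding G_def f_def
    by (rule derivative_eq_intros refl | simp)+
      (simp add: field_simps power2_eq_square power3_eq_cube)
  moreover have "continuous_on {min 0 \<xi>..max 0 \<xi>} (f \<beta>)"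
    unfolding f_def by (intro continuous_intros)
  ultimately have "(LBINT \<eta>=ereal 0..ereal \<xi>. f \<beta> \<eta>) = G \<xi> - G 0"
    by (intro interval_integral_FTC_finite)
      (auto simp: has_real_derivative_iff_has_vector_derivative)
  then show ?thesis
    by (simp add: F_def G_def zero_ereal_def)
qed

definition weak_solution :: "real \<Rightarrow> (real \<Rightarrow> real) \<Rightarrow> (real \<Rightarrow> real) \<Rightarrow> bool" where
  "weak_solution \<gamma> w v \<longleftrightarrow> v \<in> H1 \<and>
     (\<forall>\<phi>\<in>H1. (LBINT x:{0<..}.
        wderiv v x * wderiv \<phi> x + \<gamma> * v x * \<phi> x + v x ^ 3 * \<phi> x - w x * \<phi> x) = 0)"

text \<open>
  The operator $\mathcal N$. Prescribing the value $0$ at negative arguments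
  makes the representing function unique.
\<close>

definition N :: "real \<Rightarrow> (real \<Rightarrow> real) \<Rightarrow> real \<Rightarrow> real" where
  "N \<gamma> w = (THE v. weak_solution \<gamma> w v \<and> (\<forall>x<0. v x = 0))"

text \<open>
  The class $\mathcal A$. The constraint on $w(0)$ is part of the constraint on $[0,x_1]$,
  and is dropped when $x_1 = 0$.
\<close>

definition admissible :: "real \<Rightarrow> real \<Rightarrow> (real \<Rightarrow> real) set" where
  "admissible \<beta> M = {w \<in> H1. \<exists>(x1::real) (x2::ereal). 0 \<le> x1 \<and> ereal x1 < x2 \<and>
     (0 < x1 \<longrightarrow> (\<forall>x. 0 \<le> x \<and> x \<le> x1 \<longrightarrow> \<beta> \<le> w x \<and> w x \<le> 1)) \<and>
     (\<forall>x. x1 < x \<and> ereal x \<le> x2 \<longrightarrow> 0 \<le> w x \<and> w x \<le> \<beta>) \<and>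
     (\<forall>x. x2 < ereal x \<longrightarrow> - (M + 1) \<le> w x \<and> w x \<le> 0)}"

definition J :: "real \<Rightarrow> real \<Rightarrow> real \<Rightarrow> (real \<Rightarrow> real) \<Rightarrow> real" where
  "J \<beta> \<gamma> d w = (LBINT x:{0<..}.
     d / 2 * (wderiv w x)\<^sup>2 + 1 / 2 * w x * N \<gamma> w x + F \<beta> (w x) + 1 / 4 * (N \<gamma> w x) ^ 4)"

definition \<gamma>0 :: "real \<Rightarrow> real" where
  "\<gamma>0 \<beta> = 3 * \<beta>\<^sup>2 / (1 - 2 * \<beta>) - 1"

definition \<gamma>1 :: "real \<Rightarrow> real" where
  "\<gamma>1 \<beta> = min (\<gamma>0 \<beta>) (2 * (\<beta> + F \<beta> \<beta>) - 1 / 2)"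

text \<open>The defining properties of the constants $M(\gamma)$ and $d_0(\gamma)$.\<close>

definition M_const :: "real \<Rightarrow> real \<Rightarrow> real \<Rightarrow> bool" where
  "M_const \<beta> \<gamma> M \<longleftrightarrow> (\<forall>\<xi>\<le>-M. f \<beta> \<xi> \<ge> 1 + 1 / \<gamma>)"

definition d0_const :: "real \<Rightarrow> real \<Rightarrow> real \<Rightarrow> real \<Rightarrow> bool" where
  "d0_const \<beta> \<gamma> M d0 \<longleftrightarrow> 0 < d0 \<and>
     (\<exists>M0>0. \<forall>d. 0 < d \<and> d \<le> d0 \<longrightarrow> (\<exists>q0\<in>admissible \<beta> M. J \<beta> \<gamma> d q0 \<le> - M0))"

definition d1 :: "real \<Rightarrow> real \<Rightarrow> real \<Rightarrow> real" where
  "d1 \<beta> \<gamma> d0 = min d0 (\<beta>\<^sup>2 / (4 * (1 + \<beta> * \<gamma>)))"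

definition local_min_point_on :: "(real \<Rightarrow> real) \<Rightarrow> real set \<Rightarrow> real \<Rightarrow> bool" where
  "local_min_point_on u S y \<longleftrightarrow> y \<in> S \<and> (\<forall>\<^sub>F x in at y within S. u y \<le> u x)"

definition global_min_point_on :: "(real \<Rightarrow> real) \<Rightarrow> real set \<Rightarrow> real \<Rightarrow> bool" where
  "global_min_point_on u S y \<longleftrightarrow> y \<in> S \<and> (\<forall>x\<in>S. u y \<le> u x)"

end

theory Submission
  imports Defs
begin

text \<open>
  Write \<open>u\<close> for the minimizer, \<open>v\<close> for \<open>N u\<close> and \<open>E w\<close> for the part
  \<open>1/2 \<integral> w N w + 1/4 \<integral> (N w)^4\<close> of the energy.
  
  \<^bold>\<open>Why the Euler-Lagrange equation holds.\<close> \<open>E w\<close> is the maximum over \<open>\<phi>\<close> of the functional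
  \<open>\<integral> w \<phi> - 1/2 \<phi>'^2 - \<gamma>/2 \<phi>^2 - 1/4 \<phi>^4\<close>, which is affine in \<open>w\<close>, and \<open>N w\<close> is the maximizer. So \<open>E\<close> is convex, and
  \<open>E (w + h) - E w \<le> \<integral> N (w + h) h\<close>. Together with the Lipschitz bound for the monotone map \<open>N\<close> this
  shows that \<open>J\<close> has at \<open>u\<close> the derivative \<open>\<integral> d u' h' + (v - f u) h\<close>, which is nonnegative for every \<open>h\<close> in
  whose direction a small move stays admissible (\<open>first_variation_nonneg\<close>). Piecewise linear
  hats are enough as directions. If \<open>d U'' = v - f u\<close>, then the derivative in the direction of a hat is \<open>d\<close> times
  the difference between the kinks of \<open>U\<close> and of \<open>u\<close> at its nodes, where the kink is the jump of the
  secant slope (\<open>kink_variation\<close>). Hats of both signs force \<open>u - U\<close> to be affine, so \<open>u\<close> is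
  a classical solution there; hats of one sign compare \<open>u\<close> with an obstacle.
  
  \<^bold>\<open>Why \<open>v > 0\<close>.\<close> The smallness of \<open>d\<close> makes the eigenvalues of the linearization at \<open>0\<close> real. An
  eigenvector yields \<open>a > 0\<close> such that \<open>z = u + a v\<close> satisfies
  \<open>d z'' = (\<beta> - d a) z + d a v^3 - u^2 (1 + \<beta> - u)\<close>, and the right-hand side is negative where \<open>z < 0\<close> and \<open>u < 0\<close>.
  This excludes negative minima of \<open>z\<close> (\<open>u_lower_bound\<close>); then \<open>v'' \<le> K v\<close>, and the strong maximum
  principle gives \<open>v > 0\<close> (\<open>v_pos\<close>).
  
  \<^bold>\<open>Why no constraint is active.\<close> Since \<open>v > 0\<close> and \<open>f\<close> vanishes at \<open>0\<close>, \<open>\<beta>\<close> and \<open>1\<close>, pushing \<open>u\<close> down at a point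
  where it touches one of these levels from below lowers the energy (\<open>contact_direction\<close>). Where \<open>0 < u < \<beta>\<close>
  the equation makes \<open>u\<close> convex, so \<open>u\<close> cannot touch \<open>0\<close> from above. The levels are then genuinely crossed.
  Near a crossing \<open>u\<close> is convex on both sides, hence \<open>u\<close> plus or minus a small hat still crosses only once and is
  admissible, and the equation continues across (\<open>EL_crossing\<close>).
  If \<open>u\<close> touched \<open>\<beta>\<close> from above, then to the right of the last such point the system would have the first integral
  \<open>d/2 u'^2 = F u + u v - \<gamma>/2 v^2 - 1/4 v^4 + 1/2 v'^2\<close>. For \<open>u = \<beta>\<close> and \<open>0 < v \<le> 1\<close> its right-hand side is positive, because
  \<open>\<gamma> < 2 (\<beta> + F \<beta>) - 1/2\<close>; so \<open>u\<close> would leave the level with positive slope, a convex corner that a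
  hat can cut off (\<open>above_beta\<close>). Finally \<open>u\<close> does reach \<open>0\<close>, since otherwise \<open>u / v\<close> would decrease at a definite
  rate and become negative (\<open>x2_finite\<close>).
  
  \<^bold>\<open>Why the profile is as claimed.\<close> On \<open>[x1, x2]\<close> the derivative \<open>u'\<close> increases and \<open>u' x2 < 0\<close>. Beyond \<open>x2\<close> the function \<open>v\<close>
  decreases, and \<open>f\<close> decreases on the negative axis; so a maximum of \<open>u\<close> (where \<open>v \<le> f u\<close>) cannot be followed by a
  lower minimum (where \<open>v \<ge> f u\<close>), which leaves room for one minimum only (\<open>no_two_local_minima\<close>).
\<close>

section \<open>Square integrable functions on the half-line\<close>

text \<open>
  Lebesgue measure on the open half-line, as a measure space of its own: measurability, linearity
  and almost-everywhere statements then need no indicator functions.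
\<close>
abbreviation hl :: "real measure" where "hl \<equiv> restrict_space lborel {0<..}"

lemma hl_integral_eq: "(LBINT x:{0<..}. h x) = (\<integral>x. h x \<partial>hl)" for h :: "real \<Rightarrow> real"
  by (simp add: integral_restrict_space set_lebesgue_integral_def)

lemma hl_integrable_iff: "set_integrable lborel {0<..} h \<longleftrightarrow> integrable hl h" for h :: "real \<Rightarrow> real"
  by (simp add: set_integrable_eq)

lemma hl_measurable_iff: "set_borel_measurable lborel {0<..} h \<longleftrightarrow> h \<in> borel_measurable hl"
  for h :: "real \<Rightarrow> real"
  by (simp add: set_borel_measurable_def borel_measurable_restrict_space_iff)

lemma AE_hl_I: "(\<And>x. 0 < x \<Longrightarrow> P x) \<Longrightarrow> AE x in hl. P x"
  by (intro AE_I2) (auto simp: space_restrict_space)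

lemma hl_mono:
  assumes "integrable hl h" "integrable hl k" "\<And>x. 0 < x \<Longrightarrow> h x \<le> (k x :: real)"
  shows "(\<integral>x. h x \<partial>hl) \<le> (\<integral>x. k x \<partial>hl)"
  using assms by (intro integral_mono) (auto simp: space_restrict_space)

lemma hl_cong: "(\<And>x. 0 < x \<Longrightarrow> h x = k x) \<Longrightarrow> (\<integral>x. h x \<partial>hl) = (\<integral>x. k x \<partial>hl)" for h k :: "real \<Rightarrow> real"
  by (intro Bochner_Integration.integral_cong) (auto simp: space_restrict_space)

lemma integrable_hl_cong: "(\<And>x. 0 < x \<Longrightarrow> h x = k x) \<Longrightarrow> integrable hl h = integrable hl k"
  for h k :: "real \<Rightarrow> real"
  by (intro Bochner_Integration.integrable_cong) (auto simp: space_restrict_space)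

lemma measurable_hl_continuous:
  fixes w :: "real \<Rightarrow> real"
  assumes "continuous_on {0..} w" shows "w \<in> borel_measurable hl"
proof -
  have "continuous_on {0<..} w"
    using assms by (rule continuous_on_subset) auto
  then have "w \<in> borel_measurable (restrict_space borel {0<..})"
    by (rule borel_measurable_continuous_on_restrict)
  then show ?thesis
    using measurable_cong_sets[OF sets_restrict_space_cong[OF sets_lborel] refl] by metis
qed

lemma measurable_hl_borel: "w \<in> borel_measurable borel \<Longrightarrow> w \<in> borel_measurable hl" for w :: "real \<Rightarrow> real"
  by (rule measurable_restrict_space1) simp

lemma L2_iff: "w \<in> L2 \<longleftrightarrow> w \<in> borel_measurable hl \<and> integrable hl (\<lambda>x. (w x)\<^sup>2)"
  by (simp add: L2_def hl_measurable_iff hl_integrable_iff)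

lemma L2_measurable [measurable_dest]: "w \<in> L2 \<Longrightarrow> w \<in> borel_measurable hl"
  by (simp add: L2_iff)

lemma L2_square_integrable: "w \<in> L2 \<Longrightarrow> integrable hl (\<lambda>x. (w x)\<^sup>2)"
  by (simp add: L2_iff)

lemma L2_mult_integrable:
  assumes "w \<in> L2" "h \<in> L2" shows "integrable hl (\<lambda>x. w x * h x)"
proof (rule Bochner_Integration.integrable_bound)
  show "integrable hl (\<lambda>x. (w x)\<^sup>2 + (h x)\<^sup>2)"
    using assms by (intro Bochner_Integration.integrable_add L2_square_integrable)
  show "(\<lambda>x. w x * h x) \<in> borel_measurable hl"
    using assms by (auto dest!: L2_measurable)
  have "\<bar>a * b\<bar> \<le> a\<^sup>2 + b\<^sup>2" for a b :: real
  proof -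
    have "0 \<le> \<bar>a\<bar> * \<bar>b\<bar>" "2 * \<bar>a\<bar> * \<bar>b\<bar> \<le> a\<^sup>2 + b\<^sup>2"
      using sum_squares_bound[of "\<bar>a\<bar>" "\<bar>b\<bar>"] by auto
    then show ?thesis unfolding abs_mult by linarith
  qed
  then show "AE x in hl. norm (w x * h x) \<le> norm ((w x)\<^sup>2 + (h x)\<^sup>2)"
    by (intro AE_I2) (simp add: abs_of_nonneg)
qed

lemma L2_bounded_mult:
  assumes "w \<in> L2" "b \<in> borel_measurable hl" "\<And>x. 0 < x \<Longrightarrow> \<bar>b x\<bar> \<le> C"
  shows "(\<lambda>x. b x * w x) \<in> L2"
  unfolding L2_iff
proof
  have [measurable]: "w \<in> borel_measurable hl" "b \<in> borel_measurable hl" using assms by (auto dest: L2_measurable)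
  show "(\<lambda>x. b x * w x) \<in> borel_measurable hl" by measurable
  show "integrable hl (\<lambda>x. (b x * w x)\<^sup>2)"
  proof (rule Bochner_Integration.integrable_bound)
    show "integrable hl (\<lambda>x. C\<^sup>2 * (w x)\<^sup>2)"
      using assms by (intro Bochner_Integration.integrable_mult_right L2_square_integrable)
    show "(\<lambda>x. (b x * w x)\<^sup>2) \<in> borel_measurable hl" by measurable
    show "AE x in hl. norm ((b x * w x)\<^sup>2) \<le> norm (C\<^sup>2 * (w x)\<^sup>2)"
    proof (rule AE_hl_I)
      fix x :: real assume "0 < x"
      then have "(b x)\<^sup>2 \<le> C\<^sup>2" using assms(3)[of x] by (simp add: abs_le_square_iff[symmetric])
      then show "norm ((b x * w x)\<^sup>2) \<le> norm (C\<^sup>2 * (w x)\<^sup>2)"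
        by (simp add: power_mult_distrib mult_right_mono)
    qed
  qed
qed

lemma L2_scale: "w \<in> L2 \<Longrightarrow> (\<lambda>x. c * w x) \<in> L2"
  by (rule L2_bounded_mult[where C="\<bar>c\<bar>"]) auto

lemma L2_add:
  assumes "w \<in> L2" "h \<in> L2" shows "(\<lambda>x. w x + h x) \<in> L2"
proof -
  have [measurable]: "w \<in> borel_measurable hl" "h \<in> borel_measurable hl" using assms by (auto dest: L2_measurable)
  have "integrable hl (\<lambda>x. (w x)\<^sup>2 + 2 * (w x * h x) + (h x)\<^sup>2)"
    using assms by (intro Bochner_Integration.integrable_add Bochner_Integration.integrable_mult_right
        L2_mult_integrable L2_square_integrable)
  then show ?thesis by (simp add: L2_iff power2_sum algebra_simps)
qed

lemma L2_diff: "w \<in> L2 \<Longrightarrow> h \<in> L2 \<Longrightarrow> (\<lambda>x. w x - h x) \<in> L2"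
  using L2_add[of w "\<lambda>x. -1 * h x"] L2_scale[of h "-1"] by simp

lemma L2_cong: "(\<And>x. 0 < x \<Longrightarrow> w x = h x) \<Longrightarrow> w \<in> L2 \<longleftrightarrow> h \<in> L2"
  unfolding L2_iff using integrable_hl_cong[of "\<lambda>x. (w x)\<^sup>2" "\<lambda>x. (h x)\<^sup>2"] measurable_cong[of hl w h borel]
  by (auto simp: space_restrict_space)

lemma L2_bounded_support:
  assumes [measurable]: "w \<in> borel_measurable hl" and "\<And>x. 0 < x \<Longrightarrow> \<bar>w x\<bar> \<le> C"
    and "\<And>x. b < x \<Longrightarrow> w x = 0"
  shows "w \<in> L2"
proof -
  have *: "integrable lborel (\<lambda>x. indicator {0<..} x *\<^sub>R (C\<^sup>2 * indicator {0..b} x))"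
  proof (rule Bochner_Integration.integrable_bound)
    show "integrable lborel (\<lambda>x. indicator {0..b} x *\<^sub>R C\<^sup>2)"
      using borel_integrable_atLeastAtMost'[of 0 b "\<lambda>_. C\<^sup>2"] by (simp add: set_integrable_def)
  qed (auto simp: indicator_def)
  have "integrable hl (\<lambda>x. (w x)\<^sup>2)"
  proof (rule Bochner_Integration.integrable_bound)
    show "integrable hl (\<lambda>x. C\<^sup>2 * indicator {0..b} x)"
      using * unfolding hl_integrable_iff[symmetric] set_integrable_def .
    show "AE x in hl. norm ((w x)\<^sup>2) \<le> norm (C\<^sup>2 * indicator {0..b} x)"
    proof (rule AE_hl_I)
      fix x :: real assume "0 < x"
      then have "(w x)\<^sup>2 \<le> C\<^sup>2" using assms(2)[of x] by (simp add: abs_le_square_iff[symmetric])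
      with \<open>0 < x\<close> assms(3)[of x] show "norm ((w x)\<^sup>2) \<le> norm (C\<^sup>2 * indicator {0..b} x)"
        by (auto simp: indicator_def)
    qed
  qed auto
  then show ?thesis by (simp add: L2_iff)
qed

section \<open>Integration by parts for weak derivatives\<close>

text \<open>
  Second differences of this function form the simplest continuously differentiable step, whose derivative is a
  continuous tent; only the derivative of the single piece has to be computed.
\<close>
definition pos_part_sq :: "real \<Rightarrow> real" where "pos_part_sq t = (max 0 t)\<^sup>2"

lemma pos_part_sq_deriv: "(pos_part_sq has_real_derivative 2 * max 0 t) (at t)"
proof -
  consider "t > 0" | "t < 0" | "t = 0" by linarith
  then show ?thesis
  proof cases
    case 1
    have "((\<lambda>t. t\<^sup>2) has_real_derivative 2 * max 0 t) (at t)"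
      using 1 by (auto intro!: derivative_eq_intros)
    then show ?thesis
      by (rule has_field_derivative_transform_within_open[where S="{0<..}"]) (use 1 in \<open>auto simp: pos_part_sq_def\<close>)
  next
    case 2
    have "((\<lambda>t. 0) has_real_derivative 2 * max 0 t) (at t)"
      using 2 by (auto intro!: derivative_eq_intros)
    then show ?thesis
      by (rule has_field_derivative_transform_within_open[where S="{..<0}"]) (use 2 in \<open>auto simp: pos_part_sq_def\<close>)
  next
    case 3
    have "((\<lambda>h. max 0 h :: real) \<longlongrightarrow> max 0 0) (at 0)"
      by (intro tendsto_intros)
    moreover have "\<forall>\<^sub>F h in at (0::real). max 0 h = (pos_part_sq (0 + h) - pos_part_sq 0) / h"
      by (auto simp: eventually_at_filter pos_part_sq_def power2_eq_square max_def)
    ultimately have "((\<lambda>h. (pos_part_sq (0 + h) - pos_part_sq 0) / h) \<longlongrightarrow> 0) (at 0)"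
      by (simp add: filterlim_cong[OF refl refl])
    then show ?thesis using 3 by (simp add: DERIV_def)
  qed
qed

definition step :: "real \<Rightarrow> real" where
  "step t = 2 * pos_part_sq t - 4 * pos_part_sq (t - 1/2) + 2 * pos_part_sq (t - 1)"

definition bump :: "real \<Rightarrow> real" where
  "bump t = 4 * max 0 t - 8 * max 0 (t - 1/2) + 4 * max 0 (t - 1)"

lemma step_deriv: "(step has_real_derivative bump t) (at t)"
proof -
  have "((\<lambda>t. 2 * pos_part_sq t - 4 * pos_part_sq (t - 1/2) + 2 * pos_part_sq (t - 1)) has_real_derivative
      2 * (2 * max 0 t) - 4 * (2 * max 0 (t - 1/2) * 1) + 2 * (2 * max 0 (t - 1) * 1)) (at t)"
    by (intro DERIV_add DERIV_diff DERIV_cmult pos_part_sq_deriv DERIV_chain2[OF pos_part_sq_deriv])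
      (auto intro!: derivative_eq_intros)
  then show ?thesis by (simp add: step_def[abs_def] bump_def)
qed

lemma step_0: "t \<le> 0 \<Longrightarrow> step t = 0"
  by (simp add: step_def pos_part_sq_def max_absorb1)

lemma step_1: "1 \<le> t \<Longrightarrow> step t = 1"
  by (simp add: step_def pos_part_sq_def max_absorb2 power2_eq_square) algebra

lemma bump_bounds: "0 \<le> bump t" "bump t \<le> 2" and bump_outside: "t \<notin> {0..1} \<Longrightarrow> bump t = 0"
  by (auto simp: bump_def max_def)

lemma continuous_bump: "continuous_on A bump"
  unfolding bump_def by (intro continuous_intros)

lemma step_bounds: "0 \<le> step t" "step t \<le> 1"
proof -
  have m: "step x \<le> step y" if "x \<le> y" for x y
    using that step_deriv bump_bounds by (meson DERIV_nonneg_imp_nondecreasing)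
  show "0 \<le> step t" using m[of "min t 0" t] by (simp add: step_0)
  show "step t \<le> 1" using m[of t "max t 1"] by (simp add: step_1)
qed

lemma bump_integral: "integrable lborel bump" "(\<integral>t. bump t \<partial>lborel) = 1"
proof -
  have e: "bump t = indicator {0..1} t *\<^sub>R bump t" for t using bump_outside[of t] by (auto simp: indicator_def)
  have "integral\<^sup>L lborel (\<lambda>x. indicator {0..1} x *\<^sub>R bump x) = step 1 - step 0"
    by (rule integral_FTC_atLeastAtMost)
      (auto intro!: continuous_bump has_field_derivative_at_within[OF step_deriv]
        simp: has_real_derivative_iff_has_vector_derivative[symmetric])
  moreover have *: "(\<lambda>t. indicator {0..1} t *\<^sub>R bump t) = bump" using e by (intro ext) simp
  ultimately show "(\<integral>t. bump t \<partial>lborel) = 1" by (simp add: step_0 step_1)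
  show "integrable lborel bump"
    using borel_integrable_atLeastAtMost'[OF continuous_bump, of 0 1] unfolding set_integrable_def * .
qed

lemma continuous_on_Icc_bounded:
  fixes k :: "real \<Rightarrow> real"
  assumes "continuous_on {a..b} k" obtains C where "\<And>x. x \<in> {a..b} \<Longrightarrow> \<bar>k x\<bar> \<le> C"
proof -
  have "bounded (k ` {a..b})"
    by (intro compact_imp_bounded compact_continuous_image assms compact_Icc)
  then obtain C where "\<forall>x\<in>{a..b}. \<bar>k x\<bar> \<le> C" by (auto simp: bounded_iff)
  then show ?thesis using that by blast
qed

lemma integrable_hl_continuous_support:
  fixes k :: "real \<Rightarrow> real"
  assumes "continuous_on {0..} k" "\<And>x. b < x \<Longrightarrow> k x = 0"
  shows "integrable hl k"
proof -
  have "continuous_on {0..b} k" using assms(1) by (rule continuous_on_subset) auto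
  then obtain C where C: "\<And>x. x \<in> {0..b} \<Longrightarrow> \<bar>k x\<bar> \<le> C"
    by (rule continuous_on_Icc_bounded) blast
  have k: "k \<in> L2"
  proof (rule L2_bounded_support[where C="max C 0" and b=b])
    show "k \<in> borel_measurable hl" using assms(1) by (rule measurable_hl_continuous)
    show "\<bar>k x\<bar> \<le> max C 0" if "0 < x" for x
      using C[of x] assms(2)[of x] that by (cases "x \<le> b") auto
  qed (use assms in auto)
  have "(\<lambda>x. indicator {0..b} x) \<in> L2"
    by (rule L2_bounded_support[where C=1 and b=b]) (auto simp: indicator_def intro!: measurable_hl_borel)
  with k have "integrable hl (\<lambda>x. k x * indicator {0..b} x)" by (rule L2_mult_integrable)
  then show ?thesis
    using assms(2) by (subst integrable_hl_cong) (auto simp: indicator_def)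
qed

definition shrink :: "nat \<Rightarrow> real" where "shrink n = inverse (real (Suc n))"

lemma shrink_pos: "0 < shrink n" and shrink_le_1: "shrink n \<le> 1"
  and shrink_tendsto: "shrink \<longlonglongrightarrow> 0"
  using LIMSEQ_inverse_real_of_nat unfolding shrink_def[abs_def]
  by (auto simp: field_simps)

text \<open>
  The shift by one width keeps the bump inside the open half-line even for \<open>a = 0\<close>, so that boundary values
  at \<open>0\<close> are reached without a separate limit.
\<close>
lemma bump_average:
  assumes W: "continuous_on {0..} W" and a: "0 \<le> a"
  shows "(\<lambda>n. \<integral>x. W x * (bump ((x - a - shrink n) / shrink n) / shrink n) \<partial>hl) \<longlonglongrightarrow> W a"
proof -
  define V where "V x = W (max 0 x)" for x
  have V: "continuous_on UNIV V"
    unfolding V_def by (rule continuous_on_compose2[OF W]) (auto intro!: continuous_intros)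
  then have [measurable]: "V \<in> borel_measurable borel" by (rule borel_measurable_continuous_onI)
  have [measurable]: "bump \<in> borel_measurable borel"
    by (rule borel_measurable_continuous_onI) (rule continuous_bump)
  have eq: "(\<integral>x. W x * (bump ((x - a - shrink n) / shrink n) / shrink n) \<partial>hl)
      = (\<integral>t. V (a + shrink n + shrink n * t) * bump t \<partial>lborel)" for n
  proof -
    let ?h = "shrink n"
    have h: "?h > 0" by (rule shrink_pos)
    have "(\<integral>x. W x * (bump ((x - a - ?h) / ?h) / ?h) \<partial>hl)
        = (\<integral>x. indicator {0<..} x * (W x * (bump ((x - a - ?h) / ?h) / ?h)) \<partial>lborel)"
      by (simp add: integral_restrict_space)
    also have "\<dots> = \<bar>?h\<bar> * (\<integral>t. indicator {0<..} ((a + ?h) + ?h * t) *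
        (W ((a + ?h) + ?h * t) * (bump (((a + ?h) + ?h * t - a - ?h) / ?h) / ?h)) \<partial>lborel)"
      using h by (subst lborel_integral_real_affine[where c="?h" and t="a + ?h"]) auto
    also have "\<dots> = (\<integral>t. ?h * (indicator {0<..} ((a + ?h) + ?h * t) *
        (W ((a + ?h) + ?h * t) * (bump (((a + ?h) + ?h * t - a - ?h) / ?h) / ?h))) \<partial>lborel)"
      using h by simp
    also have "\<dots> = (\<integral>t. V (a + ?h + ?h * t) * bump t \<partial>lborel)"
    proof (intro Bochner_Integration.integral_cong refl)
      fix t :: real
      show "?h * (indicator {0<..} ((a + ?h) + ?h * t) *
        (W ((a + ?h) + ?h * t) * (bump (((a + ?h) + ?h * t - a - ?h) / ?h) / ?h))) = V (a + ?h + ?h * t) * bump t"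
      proof (cases "t \<in> {0..1}")
        case True
        then have "0 \<le> ?h * t" using h by simp
        then have "0 < a + ?h + ?h * t" using h a by linarith
        then show ?thesis using h by (simp add: V_def)
      next
        case False
        then show ?thesis using h by (simp add: bump_outside)
      qed
    qed
    finally show ?thesis .
  qed
  have "continuous_on {0..a+2} V" using V by (rule continuous_on_subset) auto
  then obtain C where C: "\<And>x. x \<in> {0..a+2} \<Longrightarrow> \<bar>V x\<bar> \<le> C"
    by (rule continuous_on_Icc_bounded) blast
  have "(\<lambda>n. \<integral>t. V (a + shrink n + shrink n * t) * bump t \<partial>lborel) \<longlonglongrightarrow> (\<integral>t. V a * bump t \<partial>lborel)"
  proof (rule integral_dominated_convergence[where w="\<lambda>t. C * bump t"])
    show "integrable lborel (\<lambda>t. C * bump t)" using bump_integral by simp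
    show "AE t in lborel. (\<lambda>n. V (a + shrink n + shrink n * t) * bump t) \<longlonglongrightarrow> V a * bump t"
    proof (rule AE_I2)
      fix t :: real
      have "(\<lambda>n. a + shrink n + shrink n * t) \<longlonglongrightarrow> a + 0 + 0 * t"
        by (intro tendsto_intros shrink_tendsto)
      moreover have "isCont V a" using V by (simp add: continuous_on_eq_continuous_at)
      ultimately have "(\<lambda>n. V (a + shrink n + shrink n * t)) \<longlonglongrightarrow> V a"
        using isCont_tendsto_compose[of a V] by simp
      then show "(\<lambda>n. V (a + shrink n + shrink n * t) * bump t) \<longlonglongrightarrow> V a * bump t"
        by (intro tendsto_intros)
    qed
    fix n
    show "AE t in lborel. norm (V (a + shrink n + shrink n * t) * bump t) \<le> C * bump t"
    proof (rule AE_I2)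
      fix t :: real
      show "norm (V (a + shrink n + shrink n * t) * bump t) \<le> C * bump t"
      proof (cases "t \<in> {0..1}")
        case True
        have "shrink n * t \<le> 1 * 1" using True shrink_le_1[of n] shrink_pos[of n] by (intro mult_mono) auto
        then have "a + shrink n + shrink n * t \<in> {0..a+2}"
          using True a shrink_pos[of n] shrink_le_1[of n] by auto
        then show ?thesis using C bump_bounds(1)[of t] by (auto simp: abs_mult intro!: mult_right_mono)
      qed (simp add: bump_outside)
    qed
  qed measurable
  moreover have "(\<integral>t. V a * bump t \<partial>lborel) = W a" using a by (simp add: bump_integral V_def)
  ultimately show ?thesis unfolding eq by simp
qed

text \<open>
  A continuously differentiable approximation of the indicator function of \<open>{a<..b}\<close> with support in the
  open half-line.
\<close>
definition cutoff :: "real \<Rightarrow> real \<Rightarrow> nat \<Rightarrow> real \<Rightarrow> real" where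
  "cutoff a b n x = step ((x - a - shrink n) / shrink n) - step ((x - b - shrink n) / shrink n)"

lemma cutoff_deriv: "(cutoff a b n has_real_derivative
    bump ((x - a - shrink n) / shrink n) / shrink n - bump ((x - b - shrink n) / shrink n) / shrink n) (at x)"
proof -
  have "((\<lambda>x. step ((x - a - shrink n) / shrink n) - step ((x - b - shrink n) / shrink n)) has_real_derivative
      bump ((x - a - shrink n) / shrink n) * (1 / shrink n) - bump ((x - b - shrink n) / shrink n) * (1 / shrink n)) (at x)"
    using shrink_pos[of n] by (intro DERIV_diff DERIV_chain2[OF step_deriv]) (auto intro!: derivative_eq_intros)
  then show ?thesis by (simp add: cutoff_def[abs_def])
qed

lemma continuous_cutoff: "continuous_on A (cutoff a b n)"
  by (rule DERIV_continuous_on, rule has_field_derivative_at_within, rule cutoff_deriv)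

lemma cutoff_bound: "\<bar>cutoff a b n x\<bar> \<le> 1"
  using step_bounds[of "(x - a - shrink n) / shrink n"] step_bounds[of "(x - b - shrink n) / shrink n"]
  unfolding cutoff_def by linarith

lemma cutoff_left: "a \<le> b \<Longrightarrow> x \<le> a + shrink n \<Longrightarrow> cutoff a b n x = 0"
  using shrink_pos[of n] by (simp add: cutoff_def step_0 divide_le_0_iff)

lemma cutoff_right: "a \<le> b \<Longrightarrow> b + 2 * shrink n \<le> x \<Longrightarrow> cutoff a b n x = 0"
  using shrink_pos[of n] by (simp add: cutoff_def step_1)

lemma cutoff_tendsto:
  assumes "a \<le> b" shows "(\<lambda>n. cutoff a b n x) \<longlonglongrightarrow> indicator {a<..b} x"
proof (cases "x \<le> a")
  case True
  then have "cutoff a b n x = 0" for n using shrink_pos[of n] assms by (intro cutoff_left) auto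
  then show ?thesis using True by simp
next
  case False
  have ev: "\<forall>\<^sub>F n in sequentially. 2 * shrink n < \<delta>" if "\<delta> > 0" for \<delta>
    using order_tendstoD(2)[OF tendsto_mult_right_zero[OF shrink_tendsto, of 2] that] by simp
  show ?thesis
  proof (cases "x \<le> b")
    case True
    have "0 < x - a" using False by simp
    from ev[OF this] have "\<forall>\<^sub>F n in sequentially. 1 = cutoff a b n x"
    proof eventually_elim
      case (elim n)
      then show ?case using True False shrink_pos[of n]
        by (simp add: cutoff_def step_0 step_1 divide_le_0_iff)
    qed
    then have "(\<lambda>n. cutoff a b n x) \<longlonglongrightarrow> 1"
      by (rule Lim_transform_eventually[rotated]) auto
    then show ?thesis using True False by simp
  next
    case b: False
    have "0 < x - b" using b by simp
    from ev[OF this] have "\<forall>\<^sub>F n in sequentially. 0 = cutoff a b n x"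
    proof eventually_elim
      case (elim n)
      then show ?case using assms by (simp add: cutoff_right)
    qed
    then have "(\<lambda>n. cutoff a b n x) \<longlonglongrightarrow> 0"
      by (rule Lim_transform_eventually[rotated]) auto
    then show ?thesis using b by simp
  qed
qed

lemma cutoff_integral_tendsto:
  fixes k :: "real \<Rightarrow> real"
  assumes [measurable]: "k \<in> borel_measurable hl" and int: "integrable hl (\<lambda>x. k x * indicator {0..b+2} x)"
    and "0 \<le> a" "a \<le> b"
  shows "(\<lambda>n. \<integral>x. k x * cutoff a b n x \<partial>hl) \<longlonglongrightarrow> (\<integral>x. k x * indicator {a<..b} x \<partial>hl)"
proof (rule integral_dominated_convergence[where w="\<lambda>x. \<bar>k x * indicator {0..b+2} x\<bar>"])
  have [measurable]: "cutoff a b n \<in> borel_measurable hl" for n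
    by (rule measurable_hl_continuous) (rule continuous_cutoff)
  show "(\<lambda>x. k x * cutoff a b n x) \<in> borel_measurable hl" for n by measurable
  have [measurable]: "(indicator {a<..b} :: real \<Rightarrow> real) \<in> borel_measurable hl"
    by (rule measurable_hl_borel) measurable
  show "(\<lambda>x. k x * indicator {a<..b} x) \<in> borel_measurable hl" by measurable
  show "integrable hl (\<lambda>x. \<bar>k x * indicator {0..b+2} x\<bar>)" using int by (rule integrable_abs)
  show "AE x in hl. (\<lambda>n. k x * cutoff a b n x) \<longlonglongrightarrow> k x * indicator {a<..b} x"
    by (intro AE_I2 tendsto_intros cutoff_tendsto assms)
  show "AE x in hl. norm (k x * cutoff a b n x) \<le> \<bar>k x * indicator {0..b+2} x\<bar>" for n
  proof (rule AE_hl_I)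
    fix x :: real assume "0 < x"
    show "norm (k x * cutoff a b n x) \<le> \<bar>k x * indicator {0..b+2} x\<bar>"
    proof (cases "x \<le> b + 2")
      case True
      have "\<bar>k x\<bar> * \<bar>cutoff a b n x\<bar> \<le> \<bar>k x\<bar> * 1" by (intro mult_left_mono cutoff_bound) auto
      then show ?thesis using True \<open>0 < x\<close> by (simp add: abs_mult)
    next
      case False
      then have "cutoff a b n x = 0" using shrink_le_1[of n] assms by (intro cutoff_right) auto
      then show ?thesis by simp
    qed
  qed
qed

text \<open>
  The product of \<open>\<psi>\<close> with a cutoff is a test function. As the cutoffs tend to the indicator of \<open>{a<..b}\<close>, the
  derivatives of the cutoffs become point evaluations at \<open>a\<close> and \<open>b\<close> and produce the boundary terms. With \<open>\<psi> = 1\<close> this is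
  the fundamental theorem of calculus for \<open>w\<close>.
\<close>
lemma weak_deriv_by_parts:
  assumes w: "continuous_on {0..} w" and g: "g \<in> L2" and wd: "has_weak_deriv w g"
    and \<psi>: "\<And>x. (\<psi> has_real_derivative \<psi>' x) (at x)" and \<psi>': "continuous_on UNIV \<psi>'"
    and ab: "0 \<le> a" "a \<le> b"
  shows "(\<integral>x. (w x * \<psi>' x) * indicator {a<..b} x \<partial>hl) + (\<integral>x. (g x * \<psi> x) * indicator {a<..b} x \<partial>hl)
     = w b * \<psi> b - w a * \<psi> a"
proof -
  have c\<psi>: "continuous_on A \<psi>" for A
    by (rule DERIV_continuous_on, rule has_field_derivative_at_within, rule \<psi>)
  have c\<psi>': "continuous_on A \<psi>'" for A
    using \<psi>' continuous_on_subset by blast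
  let ?B = "\<lambda>c n x. bump ((x - c - shrink n) / shrink n) / shrink n"
  have cB: "continuous_on A (?B c n)" for A c n
    unfolding bump_def using shrink_pos[of n] by (intro continuous_intros) auto
  have id: "(\<integral>x. (w x * \<psi> x) * ?B a n x \<partial>hl) - (\<integral>x. (w x * \<psi> x) * ?B b n x \<partial>hl)
      + (\<integral>x. (w x * \<psi>' x) * cutoff a b n x \<partial>hl) = - (\<integral>x. (g x * \<psi> x) * cutoff a b n x \<partial>hl)" for n
  proof -
    let ?\<phi> = "\<lambda>x. cutoff a b n x * \<psi> x"
    let ?\<phi>' = "\<lambda>x. cutoff a b n x * \<psi>' x + (?B a n x - ?B b n x) * \<psi> x"
    have d: "(?\<phi> has_real_derivative ?\<phi>' x) (at x)" for x
      using DERIV_mult[OF cutoff_deriv \<psi>] by (simp add: algebra_simps)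
    then have deriv: "deriv ?\<phi> x = ?\<phi>' x" for x by (rule DERIV_imp_deriv)
    have supp: "closure {x. ?\<phi> x \<noteq> 0} \<subseteq> {a + shrink n .. b + 2 * shrink n}"
    proof (rule closure_minimal)
      show "{x. ?\<phi> x \<noteq> 0} \<subseteq> {a + shrink n..b + 2 * shrink n}"
      proof
        fix x assume "x \<in> {x. ?\<phi> x \<noteq> 0}"
        then have "cutoff a b n x \<noteq> 0" by auto
        then show "x \<in> {a + shrink n..b + 2 * shrink n}"
          using cutoff_left[OF ab(2), of x n] cutoff_right[OF ab(2), of n x] by force
      qed
    qed auto
    have "?\<phi> \<in> test_functions"
      unfolding test_functions_def
    proof (intro CollectI conjI)
      show "?\<phi> C1_differentiable_on UNIV"
        unfolding C1_differentiable_on_def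
        by (rule exI[of _ ?\<phi>'])
          (use d in \<open>auto simp: has_real_derivative_iff_has_vector_derivative[symmetric]
            intro!: continuous_intros continuous_cutoff cB c\<psi> c\<psi>'\<close>)
      show "compact (closure {x. ?\<phi> x \<noteq> 0})"
        using bounded_subset[OF bounded_closed_interval supp] by (simp add: compact_eq_bounded_closed)
      show "closure {x. ?\<phi> x \<noteq> 0} \<subseteq> {0<..}"
      proof (rule order_trans[OF supp])
        show "{a + shrink n..b + 2 * shrink n} \<subseteq> {0<..}" using ab shrink_pos[of n] by auto
      qed
    qed
    then have "(\<integral>x. w x * ?\<phi>' x \<partial>hl) = - (\<integral>x. g x * ?\<phi> x \<partial>hl)"
      using wd unfolding has_weak_deriv_def hl_integral_eq by (auto simp: deriv)
    moreover have "(\<integral>x. w x * ?\<phi>' x \<partial>hl) = (\<integral>x. (w x * \<psi> x) * ?B a n x \<partial>hl) - (\<integral>x. (w x * \<psi> x) * ?B b n x \<partial>hl)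
      + (\<integral>x. (w x * \<psi>' x) * cutoff a b n x \<partial>hl)"
    proof -
      have B: "integrable hl (\<lambda>x. (w x * \<psi> x) * ?B c n x)" for c
      proof (rule integrable_hl_continuous_support[where b="c + 2 * shrink n"])
        show "continuous_on {0..} (\<lambda>x. (w x * \<psi> x) * ?B c n x)"
          by (intro continuous_on_mult w c\<psi> cB)
        show "(w x * \<psi> x) * ?B c n x = 0" if "c + 2 * shrink n < x" for x
          using that shrink_pos[of n] by (simp add: bump_outside field_simps)
      qed
      have C: "integrable hl (\<lambda>x. (w x * \<psi>' x) * cutoff a b n x)"
      proof (rule integrable_hl_continuous_support[where b="b + 2 * shrink n"])
        show "continuous_on {0..} (\<lambda>x. (w x * \<psi>' x) * cutoff a b n x)"
          by (intro continuous_on_mult w c\<psi>' continuous_cutoff)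
      qed (use cutoff_right[OF ab(2)] in auto)
      have "(\<integral>x. w x * ?\<phi>' x \<partial>hl) = (\<integral>x. (w x * \<psi> x) * ?B a n x - (w x * \<psi> x) * ?B b n x + (w x * \<psi>' x) * cutoff a b n x \<partial>hl)"
        by (intro Bochner_Integration.integral_cong) (auto simp: algebra_simps)
      also have "\<dots> = (\<integral>x. (w x * \<psi> x) * ?B a n x \<partial>hl) - (\<integral>x. (w x * \<psi> x) * ?B b n x \<partial>hl)
          + (\<integral>x. (w x * \<psi>' x) * cutoff a b n x \<partial>hl)"
        by (simp only: Bochner_Integration.integral_add[OF Bochner_Integration.integrable_diff[OF B B] C]
            Bochner_Integration.integral_diff[OF B B])
      finally show ?thesis .
    qed
    moreover have "(\<integral>x. g x * ?\<phi> x \<partial>hl) = (\<integral>x. (g x * \<psi> x) * cutoff a b n x \<partial>hl)"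
      by (intro Bochner_Integration.integral_cong) (auto simp: algebra_simps)
    ultimately show ?thesis by simp
  qed
  have 1: "(\<lambda>n. \<integral>x. (w x * \<psi> x) * ?B c n x \<partial>hl) \<longlonglongrightarrow> w c * \<psi> c" if "0 \<le> c" for c
    using that by (intro bump_average continuous_on_mult w c\<psi>)
  have mI: "(indicator {0..b+2} :: real \<Rightarrow> real) \<in> borel_measurable hl"
    by (rule measurable_hl_borel) measurable
  have bd: "(\<lambda>x. k x * indicator {0..b+2} x) \<in> L2" if k: "continuous_on {0..} k" for k :: "real \<Rightarrow> real"
  proof -
    have "continuous_on {0..b+2} k" using k by (rule continuous_on_subset) auto
    then obtain C where C: "\<And>x. x \<in> {0..b+2} \<Longrightarrow> \<bar>k x\<bar> \<le> C"
      by (rule continuous_on_Icc_bounded) blast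
    show ?thesis
    proof (rule L2_bounded_support[where C="max C 0" and b="b+2"])
      show "(\<lambda>x. k x * indicator {0..b+2} x) \<in> borel_measurable hl"
        using measurable_hl_continuous[OF k] mI by measurable
      show "\<bar>k x * indicator {0..b+2} x\<bar> \<le> max C 0" if "0 < x" for x
        using C[of x] that by (auto simp: indicator_def)
    qed auto
  qed
  have 2: "(\<lambda>n. \<integral>x. (w x * \<psi>' x) * cutoff a b n x \<partial>hl) \<longlonglongrightarrow> (\<integral>x. (w x * \<psi>' x) * indicator {a<..b} x \<partial>hl)"
  proof (rule cutoff_integral_tendsto[OF _ _ ab])
    show "(\<lambda>x. w x * \<psi>' x) \<in> borel_measurable hl"
      by (intro measurable_hl_continuous continuous_on_mult w c\<psi>')
    have "integrable hl (\<lambda>x. (w x * \<psi>' x * indicator {0..b+2} x) * (1 * indicator {0..b+2} x))"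
      by (intro L2_mult_integrable bd continuous_on_mult w c\<psi>' continuous_intros)
    then show "integrable hl (\<lambda>x. w x * \<psi>' x * indicator {0..b+2} x)"
      by (rule back_subst[of "integrable hl"]) (auto simp: indicator_def)
  qed
  have 3: "(\<lambda>n. \<integral>x. (g x * \<psi> x) * cutoff a b n x \<partial>hl) \<longlonglongrightarrow> (\<integral>x. (g x * \<psi> x) * indicator {a<..b} x \<partial>hl)"
  proof (rule cutoff_integral_tendsto[OF _ _ ab])
    show "(\<lambda>x. g x * \<psi> x) \<in> borel_measurable hl"
      using L2_measurable[OF g] measurable_hl_continuous[OF c\<psi>] by measurable
    have "integrable hl (\<lambda>x. g x * (\<psi> x * indicator {0..b+2} x))"
      by (intro L2_mult_integrable bd c\<psi> g)
    then show "integrable hl (\<lambda>x. g x * \<psi> x * indicator {0..b+2} x)"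
      by (simp add: mult.assoc)
  qed
  have "(\<lambda>n. (\<integral>x. (w x * \<psi> x) * ?B a n x \<partial>hl) - (\<integral>x. (w x * \<psi> x) * ?B b n x \<partial>hl)
      + (\<integral>x. (w x * \<psi>' x) * cutoff a b n x \<partial>hl)) \<longlonglongrightarrow>
      w a * \<psi> a - w b * \<psi> b + (\<integral>x. (w x * \<psi>' x) * indicator {a<..b} x \<partial>hl)"
    using ab by (intro tendsto_intros 1 2) auto
  moreover have "(\<lambda>n. (\<integral>x. (w x * \<psi> x) * ?B a n x \<partial>hl) - (\<integral>x. (w x * \<psi> x) * ?B b n x \<partial>hl)
      + (\<integral>x. (w x * \<psi>' x) * cutoff a b n x \<partial>hl)) \<longlonglongrightarrow> - (\<integral>x. (g x * \<psi> x) * indicator {a<..b} x \<partial>hl)"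
    unfolding id by (intro tendsto_intros 3)
  ultimately have "w a * \<psi> a - w b * \<psi> b + (\<integral>x. (w x * \<psi>' x) * indicator {a<..b} x \<partial>hl)
      = - (\<integral>x. (g x * \<psi> x) * indicator {a<..b} x \<partial>hl)"
    by (rule LIMSEQ_unique)
  then show ?thesis by linarith
qed

section \<open>The space \<open>H1\<close>\<close>

lemma integral_hl_Ioc:
  assumes "0 \<le> a" "a \<le> b"
  shows "integrable hl (indicator {a<..b} :: real \<Rightarrow> real)" "(\<integral>x. indicator {a<..b} x \<partial>hl) = b - a"
proof -
  have e: "indicator {0<..} x *\<^sub>R indicator {a<..b} x = (indicator {a<..b} x :: real)" for x
    using assms by (auto simp: indicator_def)
  have i: "integrable lborel (indicator {a<..b} :: real \<Rightarrow> real)"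
    using assms by (intro integrable_real_indicator) auto
  show "integrable hl (indicator {a<..b} :: real \<Rightarrow> real)"
    using i unfolding hl_integrable_iff[symmetric] set_integrable_def e .
  show "(\<integral>x. indicator {a<..b} x \<partial>hl) = b - a"
    using assms unfolding hl_integral_eq[symmetric] set_lebesgue_integral_def e by simp
qed

lemma hl_measurable_indicator [measurable]: "A \<in> sets borel \<Longrightarrow> (indicator A :: real \<Rightarrow> real) \<in> borel_measurable hl"
  by (rule measurable_hl_borel) simp

lemma integrable_hl_indicator:
  fixes k :: "real \<Rightarrow> real"
  assumes "integrable hl k" "A \<in> sets borel"
  shows "integrable hl (\<lambda>x. k x * indicator A x)"
proof (rule Bochner_Integration.integrable_bound[OF assms(1)])
  show "(\<lambda>x. k x * indicator A x) \<in> borel_measurable hl"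
    using assms(2) borel_measurable_integrable[OF assms(1)] by measurable
qed (auto simp: indicator_def)

lemma integral_hl_tendsto:
  fixes k :: "real \<Rightarrow> real"
  assumes "integrable hl k"
  shows "(\<lambda>n. \<integral>x. k x * indicator {0<..real n} x \<partial>hl) \<longlonglongrightarrow> (\<integral>x. k x \<partial>hl)"
proof (rule integral_dominated_convergence[where w="\<lambda>x. \<bar>k x\<bar>"])
  have [measurable]: "k \<in> borel_measurable hl" using assms by auto
  show "k \<in> borel_measurable hl" by simp
  show "(\<lambda>x. k x * indicator {0<..real n} x) \<in> borel_measurable hl" for n by measurable
  show "integrable hl (\<lambda>x. \<bar>k x\<bar>)" using assms by (rule integrable_abs)
  show "AE x in hl. (\<lambda>n. k x * indicator {0<..real n} x) \<longlonglongrightarrow> k x"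
  proof (rule AE_hl_I)
    fix x :: real assume "0 < x"
    obtain n where n: "x \<le> real n" using real_arch_simple by blast
    have "\<forall>\<^sub>F m in sequentially. k x = k x * indicator {0<..real m} x"
      using eventually_ge_at_top[of n] by eventually_elim (use n \<open>0 < x\<close> in auto)
    then show "(\<lambda>n. k x * indicator {0<..real n} x) \<longlonglongrightarrow> k x"
      by (rule Lim_transform_eventually[rotated]) auto
  qed
qed (auto simp: indicator_def)

lemma integral_hl_tail:
  fixes k :: "real \<Rightarrow> real"
  assumes k: "integrable hl k" and nn: "\<And>x. 0 < x \<Longrightarrow> 0 \<le> k x" and "\<epsilon> > 0"
  obtains X where "0 \<le> X" "\<And>x t. X \<le> x \<Longrightarrow> (\<integral>y. k y * indicator {x<..t} y \<partial>hl) < \<epsilon>"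
proof -
  have "\<forall>\<^sub>F n in sequentially. (\<integral>x. k x \<partial>hl) - \<epsilon> < (\<integral>x. k x * indicator {0<..real n} x \<partial>hl)"
    using integral_hl_tendsto[OF k] by (rule order_tendstoD) (use \<open>\<epsilon> > 0\<close> in simp)
  then obtain n where n: "(\<integral>x. k x \<partial>hl) - \<epsilon> < (\<integral>x. k x * indicator {0<..real n} x \<partial>hl)"
    unfolding eventually_sequentially by blast
  show ?thesis
  proof
    fix x t :: real assume x: "real n \<le> x"
    have "(\<integral>y. k y * indicator {0<..real n} y \<partial>hl) + (\<integral>y. k y * indicator {x<..t} y \<partial>hl)
        = (\<integral>y. k y * indicator {0<..real n} y + k y * indicator {x<..t} y \<partial>hl)"
      by (rule Bochner_Integration.integral_add[symmetric]) (auto intro!: integrable_hl_indicator k)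
    also have "\<dots> \<le> (\<integral>y. k y \<partial>hl)"
    proof (rule hl_mono)
      fix y :: real assume "0 < y"
      then show "k y * indicator {0<..real n} y + k y * indicator {x<..t} y \<le> k y"
        using nn[of y] x by (auto simp: indicator_def)
    qed (auto intro!: integrable_hl_indicator k Bochner_Integration.integrable_add)
    finally show "(\<integral>y. k y * indicator {x<..t} y \<partial>hl) < \<epsilon>" using n by linarith
  qed simp
qed

lemma weak_deriv_increment:
  assumes "continuous_on {0..} w" "g \<in> L2" "has_weak_deriv w g" "0 \<le> a" "a \<le> b"
  shows "(\<integral>x. g x * indicator {a<..b} x \<partial>hl) = w b - w a"
  using weak_deriv_by_parts[OF assms(1-3), of "\<lambda>_. 1" "\<lambda>_. 0" a b] assms by simp

lemma L2_integrable_Ioc: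
  assumes "g \<in> L2" shows "integrable hl (\<lambda>x. g x * indicator {a<..b} x)"
proof (rule L2_mult_integrable[OF assms])
  show "(indicator {a<..b} :: real \<Rightarrow> real) \<in> L2"
    by (rule L2_bounded_support[where C=1 and b=b]) (simp, auto simp: indicator_def)
qed

text \<open>
  Intervals are stable under intersection and generate the Borel sets, so all integrals of \<open>k\<close> over bounded Borel sets
  vanish, in particular those over the sets where \<open>k\<close> is positive or negative.
\<close>
lemma AE_eq_0_of_interval_integrals:
  assumes k: "k \<in> L2" and 0: "\<And>a b. 0 \<le> a \<Longrightarrow> a \<le> b \<Longrightarrow> (\<integral>x. k x * indicator {a<..b} x \<partial>hl) = 0"
  shows "AE x in hl. k x = 0"
proof -
  have *: "AE x in lborel. indicator {0<..real n} x * k x = 0" for n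
  proof -
    let ?h = "\<lambda>x. indicator {0<..real n} x * k x"
    have tr: "(\<lambda>x. indicator {0<..} x *\<^sub>R (k x * indicator {0<..real n} x)) = ?h"
      by (auto simp: indicator_def)
    have int: "integrable lborel ?h"
      using L2_integrable_Ioc[OF k, of 0 "real n"] unfolding hl_integrable_iff[symmetric] set_integrable_def tr .
    then have [measurable]: "?h \<in> borel_measurable borel" by auto
    have si: "set_integrable lborel A ?h" if "A \<in> sets borel" for A
      unfolding set_integrable_def using int that by (intro integrable_mult_indicator) auto
    have Ioc: "(\<integral>x\<in>{a<..b}. ?h x \<partial>lborel) = 0" for a b
    proof -
      let ?a = "max a 0" and ?b = "max (max a 0) (min b n)"
      have "(\<integral>x\<in>{a<..b}. ?h x \<partial>lborel) = (\<integral>x. k x * indicator {?a<..?b} x \<partial>hl)"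
        unfolding hl_integral_eq[symmetric] set_lebesgue_integral_def
        by (intro Bochner_Integration.integral_cong) (auto simp: indicator_def)
      then show ?thesis using 0[of ?a ?b] by simp
    qed
    have tot: "(\<integral>x. ?h x \<partial>lborel) = 0"
    proof -
      have "(\<integral>x. ?h x \<partial>lborel) = (\<integral>x\<in>{0<..real n}. ?h x \<partial>lborel)"
        unfolding set_lebesgue_integral_def by (intro Bochner_Integration.integral_cong) (auto simp: indicator_def)
      then show ?thesis using Ioc by simp
    qed
    have "(\<integral>x\<in>A. ?h x \<partial>lborel) = 0" if "A \<in> sets borel" for A
    proof -
      let ?G = "range (\<lambda>(a::real, b::real). {a<..b})"
      have "Int_stable ?G"
      proof (rule Int_stableI)
        fix X Y :: "real set" assume "X \<in> ?G" "Y \<in> ?G"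
        then obtain a b c d where "X = {a<..b}" "Y = {c<..d}" by auto
        then have "X \<inter> Y = {max a c<..min b d}" by auto
        then show "X \<inter> Y \<in> ?G" by (auto intro!: image_eqI[of _ _ "(max a c, min b d)"])
      qed
      moreover have "?G \<subseteq> Pow UNIV" by simp
      moreover have "A \<in> sigma_sets UNIV ?G"
        using that by (subst (asm) borel_sigma_sets_Ioc) simp
      ultimately show ?thesis
      proof (induction rule: sigma_sets_induct_disjoint)
        case (basic A)
        then show ?case using Ioc by auto
      next
        case empty
        show ?case by (simp add: set_lebesgue_integral_def)
      next
        case (compl A)
        then have A: "A \<in> sets borel" by (subst borel_sigma_sets_Ioc) simp
        have "(\<integral>x. ?h x \<partial>lborel) = (\<integral>x\<in>A \<union> (UNIV - A). ?h x \<partial>lborel)"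
          by (simp add: set_lebesgue_integral_def)
        also have "\<dots> = (\<integral>x\<in>A. ?h x \<partial>lborel) + (\<integral>x\<in>UNIV - A. ?h x \<partial>lborel)"
          using A by (intro set_integral_Un si) auto
        finally show ?case using compl tot by simp
      next
        case (union A)
        then have A: "range A \<subseteq> sets borel" by (subst borel_sigma_sets_Ioc) auto
        have "(\<integral>x\<in>(\<Union>i. A i). ?h x \<partial>lborel) = (\<Sum>i. (\<integral>x\<in>A i. ?h x \<partial>lborel))"
          using A union(1) by (intro lebesgue_integral_countable_add si) (auto simp: disjoint_family_on_def)
        then show ?case using union by simp
      qed
    qed
    then show ?thesis
      using density_unique_real[of lborel ?h "\<lambda>_. 0"] int by auto
  qed
  have "AE x in lborel. \<forall>n. indicator {0<..real n} x * k x = 0"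
    using * unfolding AE_all_countable by blast
  then have "AE x in lborel. x \<in> {0<..} \<longrightarrow> k x = 0"
  proof eventually_elim
    case (elim x)
    obtain n where "x \<le> real n" using real_arch_simple by blast
    with elim[rule_format, of n] show ?case by (auto simp: indicator_def)
  qed
  then show ?thesis by (subst AE_restrict_space_iff) auto
qed

text \<open>
  Both functions have the same integrals over intervals, namely the increments of \<open>w\<close>. Hence the arbitrary choice made by
  \<^const>\<open>wderiv\<close> does not matter under integrals.
\<close>
lemma weak_deriv_unique:
  assumes "continuous_on {0..} w" "g \<in> L2" "has_weak_deriv w g" "h \<in> L2" "has_weak_deriv w h"
  shows "AE x in hl. g x = h x"
proof -
  have "AE x in hl. g x - h x = 0"
  proof (rule AE_eq_0_of_interval_integrals)
    show "(\<lambda>x. g x - h x) \<in> L2" using assms by (intro L2_diff)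
    fix a b :: real assume ab: "0 \<le> a" "a \<le> b"
    have "(\<integral>x. (g x - h x) * indicator {a<..b} x \<partial>hl)
        = (\<integral>x. g x * indicator {a<..b} x - h x * indicator {a<..b} x \<partial>hl)"
      by (simp add: left_diff_distrib)
    also have "\<dots> = 0"
      using assms ab by (simp add: Bochner_Integration.integral_diff L2_integrable_Ioc weak_deriv_increment)
    finally show "(\<integral>x. (g x - h x) * indicator {a<..b} x \<partial>hl) = 0" .
  qed
  then show ?thesis by simp
qed

lemma H1_wderiv: assumes "w \<in> H1" shows "wderiv w \<in> L2" "has_weak_deriv w (wderiv w)"
proof -
  have "\<exists>g. g \<in> L2 \<and> has_weak_deriv w g" using assms by (auto simp: H1_def)
  then have "wderiv w \<in> L2 \<and> has_weak_deriv w (wderiv w)" unfolding wderiv_def by (rule someI_ex)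
  then show "wderiv w \<in> L2" "has_weak_deriv w (wderiv w)" by auto
qed

lemma H1_continuous: "w \<in> H1 \<Longrightarrow> continuous_on {0..} w" and H1_L2: "w \<in> H1 \<Longrightarrow> w \<in> L2"
  by (auto simp: H1_def)

lemma H1_I: "continuous_on {0..} w \<Longrightarrow> w \<in> L2 \<Longrightarrow> g \<in> L2 \<Longrightarrow> has_weak_deriv w g \<Longrightarrow> w \<in> H1"
  by (auto simp: H1_def)

lemma wderiv_AE_eq:
  assumes "w \<in> H1" "g \<in> L2" "has_weak_deriv w g" shows "AE x in hl. wderiv w x = g x"
  by (rule weak_deriv_unique[OF H1_continuous[OF assms(1)] H1_wderiv[OF assms(1)] assms(2,3)])

lemma test_function_support:
  assumes "\<phi> \<in> test_functions"
  obtains a b where "0 < a" "a < b" "\<And>x. x \<notin> {a<..<b} \<Longrightarrow> \<phi> x = 0" "\<And>x. x \<notin> {a<..<b} \<Longrightarrow> deriv \<phi> x = 0"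
proof -
  let ?K = "closure {x. \<phi> x \<noteq> 0}"
  have K: "compact ?K" "?K \<subseteq> {0<..}" using assms by (auto simp: test_functions_def)
  have "\<exists>a b. 0 < a \<and> a < b \<and> ?K \<subseteq> {a<..<b}"
  proof (cases "?K = {}")
    case True
    then show ?thesis by (intro exI[of _ 1] exI[of _ 2]) auto
  next
    case False
    obtain s where s: "s \<in> ?K" "\<forall>t\<in>?K. s \<le> t" using compact_attains_inf[OF K(1) False] by auto
    obtain t where t: "t \<in> ?K" "\<forall>x\<in>?K. x \<le> t" using compact_attains_sup[OF K(1) False] by auto
    have "0 < s" using s K by auto
    moreover have "s \<le> t" using s t by auto
    ultimately show ?thesis
      using s t by (intro exI[of _ "s/2"] exI[of _ "t + 1"]) force
  qed
  then obtain a b where ab: "0 < a" "a < b" "?K \<subseteq> {a<..<b}" by auto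
  have z: "\<phi> x = 0" if "x \<notin> ?K" for x using that closure_subset[of "{x. \<phi> x \<noteq> 0}"] by auto
  have "deriv \<phi> x = 0" if "x \<notin> ?K" for x
  proof -
    have "(\<phi> has_real_derivative 0) (at x)"
    proof (rule has_field_derivative_transform_within_open[where f="\<lambda>_. 0" and S="- ?K"])
      show "open (- ?K)" by auto
      show "x \<in> - ?K" using that by simp
      show "0 = \<phi> y" if "y \<in> - ?K" for y using z[of y] that by simp
    qed simp
    then show ?thesis by (rule DERIV_imp_deriv)
  qed
  with z ab that show ?thesis by blast
qed

lemma test_function_deriv:
  assumes "\<phi> \<in> test_functions"
  shows "(\<phi> has_real_derivative deriv \<phi> x) (at x)" "continuous_on UNIV (deriv \<phi>)"
proof -
  obtain D where D: "\<And>x. (\<phi> has_vector_derivative D x) (at x)" "continuous_on UNIV D"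
    using assms by (auto simp: test_functions_def C1_differentiable_on_def)
  then have d: "(\<phi> has_real_derivative D x) (at x)" for x by (simp add: has_real_derivative_iff_has_vector_derivative)
  then have "deriv \<phi> = D" by (auto intro: DERIV_imp_deriv)
  with d D show "(\<phi> has_real_derivative deriv \<phi> x) (at x)" "continuous_on UNIV (deriv \<phi>)" by auto
qed

lemma L2_continuous_support:
  fixes k :: "real \<Rightarrow> real"
  assumes "continuous_on {0..} k" "\<And>x. b < x \<Longrightarrow> k x = 0"
  shows "k \<in> L2"
  unfolding L2_iff using assms
  by (auto intro!: measurable_hl_continuous integrable_hl_continuous_support[where b=b] continuous_intros)

lemma test_function_L2:
  assumes "\<phi> \<in> test_functions" shows "\<phi> \<in> L2" "deriv \<phi> \<in> L2"
proof -
  obtain a b where ab: "\<And>x. x \<notin> {a<..<b} \<Longrightarrow> \<phi> x = 0" "\<And>x. x \<notin> {a<..<b} \<Longrightarrow> deriv \<phi> x = 0"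
    using test_function_support[OF assms] by metis
  have "continuous_on {0..} \<phi>"
    by (rule DERIV_continuous_on, rule has_field_derivative_at_within, rule test_function_deriv(1)[OF assms])
  moreover have "continuous_on {0..} (deriv \<phi>)"
    using test_function_deriv(2)[OF assms] by (rule continuous_on_subset) auto
  ultimately show "\<phi> \<in> L2" "deriv \<phi> \<in> L2" using ab by (auto intro!: L2_continuous_support[where b=b])
qed

lemma has_weak_deriv_add_scale:
  assumes "w \<in> L2" "h \<in> L2" "g \<in> L2" "k \<in> L2" "has_weak_deriv w g" "has_weak_deriv h k"
  shows "has_weak_deriv (\<lambda>x. w x + c * h x) (\<lambda>x. g x + c * k x)"
  unfolding has_weak_deriv_def hl_integral_eq
proof
  fix \<phi> assume \<phi>: "\<phi> \<in> test_functions"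
  note L = test_function_L2[OF \<phi>]
  have i: "integrable hl (\<lambda>x. w x * deriv \<phi> x)" "integrable hl (\<lambda>x. h x * deriv \<phi> x)"
    "integrable hl (\<lambda>x. g x * \<phi> x)" "integrable hl (\<lambda>x. k x * \<phi> x)"
    using assms L by (auto intro: L2_mult_integrable)
  have "(\<integral>x. w x * deriv \<phi> x \<partial>hl) = - (\<integral>x. g x * \<phi> x \<partial>hl)" "(\<integral>x. h x * deriv \<phi> x \<partial>hl) = - (\<integral>x. k x * \<phi> x \<partial>hl)"
    using assms \<phi> by (auto simp: has_weak_deriv_def hl_integral_eq)
  moreover have "(\<integral>x. (w x + c * h x) * deriv \<phi> x \<partial>hl) = (\<integral>x. w x * deriv \<phi> x \<partial>hl) + c * (\<integral>x. h x * deriv \<phi> x \<partial>hl)"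
    using i by (simp add: distrib_right mult.assoc)
  moreover have "(\<integral>x. (g x + c * k x) * \<phi> x \<partial>hl) = (\<integral>x. g x * \<phi> x \<partial>hl) + c * (\<integral>x. k x * \<phi> x \<partial>hl)"
    using i by (simp add: distrib_right mult.assoc)
  ultimately show "(\<integral>x. (w x + c * h x) * deriv \<phi> x \<partial>hl) = - (\<integral>x. (g x + c * k x) * \<phi> x \<partial>hl)"
    by simp
qed

lemma H1_add_scale:
  assumes "w \<in> H1" "h \<in> H1"
  shows "(\<lambda>x. w x + c * h x) \<in> H1" "AE x in hl. wderiv (\<lambda>x. w x + c * h x) x = wderiv w x + c * wderiv h x"
proof -
  have wd: "has_weak_deriv (\<lambda>x. w x + c * h x) (\<lambda>x. wderiv w x + c * wderiv h x)"
    using assms by (intro has_weak_deriv_add_scale H1_L2 H1_wderiv)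
  have L: "(\<lambda>x. wderiv w x + c * wderiv h x) \<in> L2"
    using assms by (intro L2_add L2_scale H1_wderiv)
  show H: "(\<lambda>x. w x + c * h x) \<in> H1"
    using assms by (intro H1_I[OF _ _ L wd] continuous_intros H1_continuous L2_add L2_scale H1_L2)
  show "AE x in hl. wderiv (\<lambda>x. w x + c * h x) x = wderiv w x + c * wderiv h x"
    using H L wd by (rule wderiv_AE_eq)
qed

lemma H1_diff:
  assumes "w \<in> H1" "h \<in> H1"
  shows "(\<lambda>x. w x - h x) \<in> H1" "AE x in hl. wderiv (\<lambda>x. w x - h x) x = wderiv w x - wderiv h x"
  using H1_add_scale[OF assms, of "-1"] by simp_all

text \<open>
  Over an interval of length one far out, \<open>w\<close> varies little because the tail of \<open>\<integral> w'^2\<close> is small; if \<open>w\<close> were not small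
  there, then \<open>\<integral> w^2\<close> over that interval would exceed its tail.
\<close>
lemma H1_tendsto_0: assumes "w \<in> H1" shows "(w \<longlongrightarrow> 0) at_top"
proof (rule tendstoI)
  fix e :: real assume e: "e > 0"
  define g where "g = wderiv w"
  have g: "g \<in> L2" and w: "w \<in> L2" using assms by (auto simp: g_def H1_wderiv H1_L2)
  have int: "integrable hl (\<lambda>x. (w x)\<^sup>2 + (g x)\<^sup>2)"
    using g w by (intro Bochner_Integration.integrable_add L2_square_integrable)
  \<comment> \<open>With this tail, \<open>w\<close> varies by at most \<open>e / 4\<close> over a unit interval.\<close>
  obtain X where X: "0 \<le> X" "\<And>x t. X \<le> x \<Longrightarrow> (\<integral>y. ((w y)\<^sup>2 + (g y)\<^sup>2) * indicator {x<..t} y \<partial>hl) < e\<^sup>2 / 16"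
    using integral_hl_tail[OF int, of "e\<^sup>2/16"] e by auto
  have "\<bar>w x\<bar> < e" if x: "X \<le> x" for x
  proof (rule ccontr)
    assume big: "\<not> \<bar>w x\<bar> < e"
    have x0: "0 \<le> x" using X x by simp
    have close: "\<bar>w t - w x\<bar> \<le> e / 4" if t: "x \<le> t" "t \<le> x + 1" for t
    proof -
      have "\<bar>w t - w x\<bar> = \<bar>\<integral>y. g y * indicator {x<..t} y \<partial>hl\<bar>"
        using weak_deriv_increment[of w g x t] t x0 assms H1_wderiv by (simp add: g_def H1_continuous)
      also have "\<dots> \<le> (\<integral>y. \<bar>g y * indicator {x<..t} y\<bar> \<partial>hl)"
        by (rule integral_abs_bound)
      also have "\<dots> \<le> (\<integral>y. (2 / e) * (((w y)\<^sup>2 + (g y)\<^sup>2) * indicator {x<..t} y) + (e / 8) * indicator {x<..t} y \<partial>hl)"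
      proof (rule hl_mono)
        show "integrable hl (\<lambda>y. \<bar>g y * indicator {x<..t} y\<bar>)"
          by (intro integrable_abs L2_integrable_Ioc g)
        show "integrable hl (\<lambda>y. (2 / e) * (((w y)\<^sup>2 + (g y)\<^sup>2) * indicator {x<..t} y) + (e / 8) * indicator {x<..t} y)"
          using t x0 by (intro Bochner_Integration.integrable_add Bochner_Integration.integrable_mult_right
              integrable_hl_indicator int integral_hl_Ioc) auto
        fix y :: real assume "0 < y"
        have "\<bar>g y\<bar> \<le> (2 / e) * ((w y)\<^sup>2 + (g y)\<^sup>2) + e / 8"
        proof -
          \<comment> \<open>Young's inequality, weighted so that both terms integrate to at most \<open>e / 8\<close>.\<close>
          have "0 \<le> (\<bar>g y\<bar> * 4 - e)\<^sup>2" by simp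
          then have "\<bar>g y\<bar> * e * 8 \<le> 16 * (g y)\<^sup>2 + e\<^sup>2" by (simp add: power2_eq_square algebra_simps)
          also have "\<dots> \<le> 16 * ((w y)\<^sup>2 + (g y)\<^sup>2) + e\<^sup>2" by simp
          finally show ?thesis using e by (simp add: field_simps power2_eq_square)
        qed
        then show "\<bar>g y * indicator {x<..t} y\<bar> \<le> (2 / e) * (((w y)\<^sup>2 + (g y)\<^sup>2) * indicator {x<..t} y) + (e / 8) * indicator {x<..t} y"
          by (auto simp: indicator_def)
      qed
      also have "\<dots> = (2 / e) * (\<integral>y. ((w y)\<^sup>2 + (g y)\<^sup>2) * indicator {x<..t} y \<partial>hl) + (e / 8) * (t - x)"
        using integral_hl_Ioc[OF x0 t(1)] integrable_hl_indicator[OF int, of "{x<..t}"] by simp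
      also have "\<dots> \<le> (2 / e) * (e\<^sup>2 / 16) + (e / 8) * 1"
        using X(2)[OF x, of t] t e by (intro add_mono mult_left_mono) auto
      also have "\<dots> = e / 4" using e by (simp add: power2_eq_square)
      finally show ?thesis .
    qed
    have "e\<^sup>2 / 16 < (e * 3 / 4)\<^sup>2" using e by (simp add: power2_eq_square)
    also have "\<dots> = (\<integral>y. (e * 3 / 4)\<^sup>2 * indicator {x<..x+1} y \<partial>hl)"
      using integral_hl_Ioc[of x "x+1"] x0 by simp
    also have "\<dots> \<le> (\<integral>y. ((w y)\<^sup>2 + (g y)\<^sup>2) * indicator {x<..x+1} y \<partial>hl)"
    proof (rule hl_mono)
      show "integrable hl (\<lambda>y. (e * 3 / 4)\<^sup>2 * indicator {x<..x+1} y)"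
        using integral_hl_Ioc[of x "x+1"] x0 by simp
      show "integrable hl (\<lambda>y. ((w y)\<^sup>2 + (g y)\<^sup>2) * indicator {x<..x+1} y)"
        by (intro integrable_hl_indicator int) auto
      fix y :: real
      show "(e * 3 / 4)\<^sup>2 * indicator {x<..x+1} y \<le> ((w y)\<^sup>2 + (g y)\<^sup>2) * indicator {x<..x+1} y"
      proof (cases "y \<in> {x<..x+1}")
        case True
        then have "e * 3 / 4 \<le> \<bar>w y\<bar>" using close[of y] big unfolding greaterThanAtMost_iff by linarith
        then have "(e * 3 / 4)\<^sup>2 \<le> (w y)\<^sup>2" using e by (metis abs_le_square_iff abs_of_pos
              divide_pos_pos mult_pos_pos zero_less_numeral)
        then show ?thesis using True by (simp add: add_increasing2)
      qed simp
    qed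
    finally show False using X(2)[OF x, of "x+1"] by simp
  qed
  then show "\<forall>\<^sub>F x in at_top. dist (w x) 0 < e"
    unfolding eventually_at_top_linorder by auto
qed

lemma H1_bounded:
  assumes "w \<in> H1" obtains C where "0 \<le> C" "\<And>x. 0 \<le> x \<Longrightarrow> \<bar>w x\<bar> \<le> C"
proof -
  have "\<forall>\<^sub>F x in at_top. dist (w x) 0 < 1" using H1_tendsto_0[OF assms] by (rule tendstoD) simp
  then obtain X where X: "\<And>x. X \<le> x \<Longrightarrow> \<bar>w x\<bar> < 1" by (auto simp: eventually_at_top_linorder)
  have "continuous_on {0..X} w" using H1_continuous[OF assms] by (rule continuous_on_subset) auto
  then obtain C where C: "\<And>x. x \<in> {0..X} \<Longrightarrow> \<bar>w x\<bar> \<le> C" by (rule continuous_on_Icc_bounded) blast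
  have "\<bar>w x\<bar> \<le> max 1 C" if "0 \<le> x" for x
    using X[of x] C[of x] that by (cases "x \<le> X") auto
  with that[of "max 1 C"] show ?thesis by auto
qed

text \<open>
  The product with a test function is continuous and differentiable off a finite set, so the fundamental theorem of
  calculus applies to it. This covers the solutions of the differential equations as well as piecewise linear functions.
\<close>
lemma piecewise_C1_weak_deriv:
  assumes w: "continuous_on {0..} w" and S: "finite S"
    and d: "\<And>x. 0 < x \<Longrightarrow> x \<notin> S \<Longrightarrow> (w has_real_derivative g x) (at x)" and g: "g \<in> L2"
  shows "has_weak_deriv w g"
  unfolding has_weak_deriv_def hl_integral_eq
proof
  fix \<phi> assume \<phi>: "\<phi> \<in> test_functions"
  obtain a b where ab: "0 < a" "a < b" "\<And>x. x \<notin> {a<..<b} \<Longrightarrow> \<phi> x = 0" "\<And>x. x \<notin> {a<..<b} \<Longrightarrow> deriv \<phi> x = 0"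
    using test_function_support[OF \<phi>] by metis
  note L = test_function_L2[OF \<phi>]
  have c\<phi>: "continuous_on A \<phi>" for A
    by (rule DERIV_continuous_on, rule has_field_derivative_at_within, rule test_function_deriv(1)[OF \<phi>])
  have c\<phi>': "continuous_on {0..} (deriv \<phi>)"
    using test_function_deriv(2)[OF \<phi>] by (rule continuous_on_subset) auto
  have i1: "integrable hl (\<lambda>x. w x * deriv \<phi> x)"
    using ab by (intro integrable_hl_continuous_support[where b=b] continuous_on_mult w c\<phi>') auto
  have i2: "integrable hl (\<lambda>x. g x * \<phi> x)" using g L by (intro L2_mult_integrable)
  let ?k = "\<lambda>x. w x * deriv \<phi> x + g x * \<phi> x"
  have i: "integrable hl ?k" using i1 i2 by (rule Bochner_Integration.integrable_add)
  then have si: "set_integrable lborel {0<..} ?k" by (simp add: hl_integrable_iff)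
  have sab: "set_integrable lborel {a..b} ?k"
    by (rule set_integrable_subset[OF si]) (use ab in auto)
  have "(?k has_integral (w b * \<phi> b - w a * \<phi> a)) {a..b}"
  proof (rule fundamental_theorem_of_calculus_interior_strong[OF S])
    fix x assume x: "x \<in> {a<..<b} - S"
    then have "((\<lambda>x. w x * \<phi> x) has_real_derivative g x * \<phi> x + deriv \<phi> x * w x) (at x)"
      using ab by (intro DERIV_mult d test_function_deriv(1)[OF \<phi>]) auto
    then show "((\<lambda>x. w x * \<phi> x) has_vector_derivative ?k x) (at x)"
      by (simp add: has_real_derivative_iff_has_vector_derivative algebra_simps)
  next
    show "continuous_on {a..b} (\<lambda>x. w x * \<phi> x)"
      by (intro continuous_on_mult c\<phi> continuous_on_subset[OF w]) (use ab in auto)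
  qed (use ab in auto)
  then have "(?k has_integral 0) {a..b}" using ab by simp
  then have "(LBINT x:{a..b}. ?k x) = 0"
    using set_borel_integral_eq_integral(2)[OF sab] by (simp add: integral_unique)
  also have "(LBINT x:{a..b}. ?k x) = (LBINT x:{0<..}. ?k x)"
    unfolding set_lebesgue_integral_def
  proof (intro Bochner_Integration.integral_cong refl)
    fix x show "indicator {a..b} x *\<^sub>R ?k x = indicator {0<..} x *\<^sub>R ?k x"
      using ab(1,2) ab(3,4)[of x] by (cases "x \<in> {a<..<b}") (auto simp: indicator_def)
  qed
  finally have "(\<integral>x. ?k x \<partial>hl) = 0" by (simp only: hl_integral_eq)
  then show "(\<integral>x. w x * deriv \<phi> x \<partial>hl) = - (\<integral>x. g x * \<phi> x \<partial>hl)"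
    using i1 i2 by simp
qed

text \<open>
  No boundary terms remain: \<open>\<psi>\<close> vanishes at \<open>0\<close>, and at infinity \<open>\<phi>\<close> tends to \<open>0\<close> while \<open>\<psi>\<close> is bounded.
\<close>
lemma half_line_by_parts:
  assumes \<phi>: "\<phi> \<in> H1"
    and \<psi>: "\<And>x. (\<psi> has_real_derivative \<psi>' x) (at x)" and \<psi>': "continuous_on UNIV \<psi>'"
    and "\<psi> 0 = 0" and L: "\<psi> \<in> L2" "\<psi>' \<in> L2" and bd: "\<And>x. 0 \<le> x \<Longrightarrow> \<bar>\<psi> x\<bar> \<le> C"
  shows "(\<integral>x. \<psi> x * wderiv \<phi> x \<partial>hl) = - (\<integral>x. \<psi>' x * \<phi> x \<partial>hl)"
proof -
  have i1: "integrable hl (\<lambda>x. \<phi> x * \<psi>' x)" by (rule L2_mult_integrable[OF H1_L2[OF \<phi>] L(2)])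
  have i2: "integrable hl (\<lambda>x. wderiv \<phi> x * \<psi> x)" by (rule L2_mult_integrable[OF H1_wderiv(1)[OF \<phi>] L(1)])
  have "(\<lambda>n. (\<integral>x. (\<phi> x * \<psi>' x) * indicator {0<..real n} x \<partial>hl) + (\<integral>x. (wderiv \<phi> x * \<psi> x) * indicator {0<..real n} x \<partial>hl))
      \<longlonglongrightarrow> (\<integral>x. \<phi> x * \<psi>' x \<partial>hl) + (\<integral>x. wderiv \<phi> x * \<psi> x \<partial>hl)"
    by (intro tendsto_add integral_hl_tendsto i1 i2)
  moreover have "(\<integral>x. (\<phi> x * \<psi>' x) * indicator {0<..real n} x \<partial>hl) + (\<integral>x. (wderiv \<phi> x * \<psi> x) * indicator {0<..real n} x \<partial>hl)
      = \<phi> (real n) * \<psi> (real n)" for n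
    using weak_deriv_by_parts[OF H1_continuous[OF \<phi>] H1_wderiv[OF \<phi>] \<psi> \<psi>', of 0 "real n"] \<open>\<psi> 0 = 0\<close> by simp
  moreover have "(\<lambda>n. \<phi> (real n) * \<psi> (real n)) \<longlonglongrightarrow> 0"
  proof (rule Lim_null_comparison)
    have "(\<lambda>n. \<phi> (real n)) \<longlonglongrightarrow> 0"
      using H1_tendsto_0[OF \<phi>] filterlim_real_sequentially by (rule filterlim_compose)
    then show "(\<lambda>n. \<bar>\<phi> (real n)\<bar> * C) \<longlonglongrightarrow> 0"
      using tendsto_mult_left_zero tendsto_rabs_zero by blast
    show "\<forall>\<^sub>F n in sequentially. norm (\<phi> (real n) * \<psi> (real n)) \<le> \<bar>\<phi> (real n)\<bar> * C"
      by (auto simp: abs_mult intro!: always_eventually mult_left_mono bd)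
  qed
  ultimately have "(\<integral>x. \<phi> x * \<psi>' x \<partial>hl) + (\<integral>x. wderiv \<phi> x * \<psi> x \<partial>hl) = 0"
    using LIMSEQ_unique by fastforce
  then show ?thesis by (simp add: mult.commute)
qed

section \<open>A Green function and the semilinear problem\<close>

lemma integral_exp_Ioi:
  fixes \<kappa> x :: real
  assumes "\<kappa> > 0"
  shows "set_integrable lborel {x<..} (\<lambda>t. exp (- \<kappa> * t))"
    "(LBINT t:{x<..}. exp (- \<kappa> * t)) = exp (- \<kappa> * x) / \<kappa>"
proof -
  have nn: "(\<integral>\<^sup>+t. ennreal (exp (- \<kappa> * t)) * indicator {x..} t \<partial>lborel) = ennreal (0 - - (exp (- \<kappa> * x) / \<kappa>))"
  proof (rule nn_integral_FTC_atLeast)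
    show "DERIV (\<lambda>t. - (exp (- \<kappa> * t) / \<kappa>)) t :> exp (- \<kappa> * t)" for t
      using assms by (auto intro!: derivative_eq_intros)
    have "((\<lambda>t. exp (- \<kappa> * t)) \<longlongrightarrow> 0) at_top"
      using assms by (intro filterlim_compose[OF exp_at_bot])
        (simp add: filterlim_uminus_at_bot filterlim_tendsto_pos_mult_at_top[OF tendsto_const _ filterlim_ident])
    then show "((\<lambda>t. - (exp (- \<kappa> * t) / \<kappa>)) \<longlongrightarrow> 0) at_top"
      using tendsto_minus[OF tendsto_divide_zero] by fastforce
  qed auto
  have e: "(\<integral>\<^sup>+t. ennreal (indicator {x<..} t *\<^sub>R exp (- \<kappa> * t)) \<partial>lborel) = ennreal (exp (- \<kappa> * x) / \<kappa>)"
  proof -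
    have "(\<integral>\<^sup>+t. ennreal (indicator {x<..} t *\<^sub>R exp (- \<kappa> * t)) \<partial>lborel)
        = (\<integral>\<^sup>+t. ennreal (exp (- \<kappa> * t)) * indicator {x..} t \<partial>lborel)"
      by (rule nn_integral_cong_AE, use AE_lborel_singleton[of x] in eventually_elim) (auto simp: indicator_def)
    then show ?thesis using nn by simp
  qed
  have hb: "has_bochner_integral lborel (\<lambda>t. indicator {x<..} t *\<^sub>R exp (- \<kappa> * t)) (exp (- \<kappa> * x) / \<kappa>)"
    by (rule has_bochner_integral_nn_integral) (use e assms in auto)
  then show "set_integrable lborel {x<..} (\<lambda>t. exp (- \<kappa> * t))"
    "(LBINT t:{x<..}. exp (- \<kappa> * t)) = exp (- \<kappa> * x) / \<kappa>"
    by (auto simp: set_integrable_def set_lebesgue_integral_def has_bochner_integral_iff)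
qed

text \<open>
  The bounded solution of \<open>B' = \<kappa> B - g\<close>.
\<close>
definition exp_tail :: "real \<Rightarrow> (real \<Rightarrow> real) \<Rightarrow> real \<Rightarrow> real" where
  "exp_tail \<kappa> g x = exp (\<kappa> * x) * (LBINT t:{x<..}. exp (- \<kappa> * t) * g t)"

lemma exp_tail_integrable:
  fixes g :: "real \<Rightarrow> real"
  assumes "\<kappa> > 0" "continuous_on UNIV g" "\<And>t. \<bar>g t\<bar> \<le> C"
  shows "set_integrable lborel {x<..} (\<lambda>t. exp (- \<kappa> * t) * g t)"
proof (rule set_integrable_bound)
  show "set_integrable lborel {x<..} (\<lambda>t. C * exp (- \<kappa> * t))"
    by (rule set_integrable_mult_right) (rule integral_exp_Ioi(1)[OF assms(1)])
  have "continuous_on {x<..} (\<lambda>t. exp (- \<kappa> * t) * g t)"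
    by (intro continuous_intros continuous_on_subset[OF assms(2)]) auto
  then have "set_borel_measurable borel {x<..} (\<lambda>t. exp (- \<kappa> * t) * g t)"
    by (intro set_measurable_continuous_on) auto
  then show "set_borel_measurable lborel {x<..} (\<lambda>t. exp (- \<kappa> * t) * g t)"
    by (simp add: set_borel_measurable_def)
  have "0 \<le> C" using assms(3)[of 0] by linarith
  then show "AE t in lborel. t \<in> {x<..} \<longrightarrow> norm (exp (- \<kappa> * t) * g t) \<le> norm (C * exp (- \<kappa> * t))"
    using assms(3) by (auto simp: abs_mult mult.commute[of C] intro!: mult_left_mono AE_I2)
qed

lemma exp_tail_bound:
  assumes "\<kappa> > 0" "continuous_on UNIV g" "\<And>t. \<bar>g t\<bar> \<le> C"
  shows "\<bar>exp_tail \<kappa> g x\<bar> \<le> C / \<kappa>"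
proof -
  have "\<bar>LBINT t:{x<..}. exp (- \<kappa> * t) * g t\<bar> \<le> (LBINT t:{x<..}. C * exp (- \<kappa> * t))"
  proof -
    have i: "set_integrable lborel {x<..} (\<lambda>t. exp (- \<kappa> * t) * g t)" using assms by (rule exp_tail_integrable)
    have "\<bar>LBINT t:{x<..}. exp (- \<kappa> * t) * g t\<bar> \<le> (LBINT t:{x<..}. \<bar>exp (- \<kappa> * t) * g t\<bar>)"
      unfolding set_lebesgue_integral_def
      by (rule order_trans[OF integral_abs_bound]) (simp add: abs_mult)
    also have "\<dots> \<le> (LBINT t:{x<..}. C * exp (- \<kappa> * t))"
      using assms(3) by (intro set_integral_mono set_integrable_abs i set_integrable_mult_right integral_exp_Ioi assms)
        (auto simp: abs_mult mult.commute[of C] intro!: mult_left_mono)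
    finally show ?thesis .
  qed
  also have "\<dots> = C * (exp (- \<kappa> * x) / \<kappa>)" using integral_exp_Ioi[OF assms(1)] by simp
  finally have "exp (\<kappa> * x) * \<bar>LBINT t:{x<..}. exp (- \<kappa> * t) * g t\<bar> \<le> exp (\<kappa> * x) * (C * (exp (- \<kappa> * x) / \<kappa>))"
    by (intro mult_left_mono) auto
  also have "\<dots> = C / \<kappa>" by (simp add: exp_minus field_simps)
  finally show ?thesis by (simp add: exp_tail_def abs_mult)
qed

lemma exp_tail_diff:
  assumes "\<kappa> > 0" "continuous_on UNIV g" "\<And>t. \<bar>g t\<bar> \<le> C" "continuous_on UNIV h" "\<And>t. \<bar>h t\<bar> \<le> D"
  shows "exp_tail \<kappa> g x - exp_tail \<kappa> h x = exp_tail \<kappa> (\<lambda>t. g t - h t) x"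
  unfolding exp_tail_def right_diff_distrib
  by (subst set_integral_diff(2)[OF exp_tail_integrable[OF assms(1-3)] exp_tail_integrable[OF assms(1,4,5)]])
    (simp add: right_diff_distrib)

lemma exp_tail_deriv:
  assumes "\<kappa> > 0" "continuous_on UNIV g" "\<And>t. \<bar>g t\<bar> \<le> C"
  shows "(exp_tail \<kappa> g has_real_derivative \<kappa> * exp_tail \<kappa> g x - g x) (at x)"
proof -
  let ?e = "\<lambda>t. exp (- \<kappa> * t) * g t"
  let ?D = "\<lambda>y. (LBINT t:{y<..}. ?e t)"
  have c: "continuous_on A ?e" for A
    by (intro continuous_intros continuous_on_subset[OF assms(2)]) auto
  note i = exp_tail_integrable[OF assms]
  have D: "?D y = ?D (x - 1) - integral {x - 1..y} ?e" if "x - 1 \<le> y" for y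
  proof -
    have s: "set_integrable lborel {x - 1..y} ?e" by (rule borel_integrable_atLeastAtMost') (rule c)
    have s': "set_integrable lborel {x - 1<..y} ?e" by (rule set_integrable_subset[OF s]) auto
    have "{x - 1<..} = {x - 1<..y} \<union> {y<..}" using that by auto
    then have "?D (x - 1) = (LBINT t:{x - 1<..y}. ?e t) + ?D y"
      using set_integral_Un[OF _ s' i[of y]] by (simp add: Int_def)
    also have "(LBINT t:{x - 1<..y}. ?e t) = (LBINT t:{x - 1..y}. ?e t)"
    proof (rule set_integral_cong_set)
      show "AE t in lborel. (t \<in> {x - 1..y}) = (t \<in> {x - 1<..y})"
        using AE_lborel_singleton[of "x - 1"] by eventually_elim auto
    qed (use s s' in \<open>auto simp: set_integrable_def set_borel_measurable_def\<close>)
    also have "\<dots> = integral {x - 1..y} ?e" by (rule set_borel_integral_eq_integral(2)[OF s])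
    finally show ?thesis by simp
  qed
  have "((\<lambda>y. integral {x - 1..y} ?e) has_real_derivative ?e x) (at x within {x - 1..x + 1})"
    by (rule integral_has_real_derivative[OF c]) auto
  then have "((\<lambda>y. integral {x - 1..y} ?e) has_real_derivative ?e x) (at x)"
    by (simp add: at_within_Icc_at)
  then have "((\<lambda>y. exp (\<kappa> * y) * (?D (x - 1) - integral {x - 1..y} ?e)) has_real_derivative
      \<kappa> * exp (\<kappa> * x) * (?D (x - 1) - integral {x - 1..x} ?e) + (0 - ?e x) * exp (\<kappa> * x)) (at x)"
    by (intro DERIV_mult DERIV_diff DERIV_const) (auto intro!: derivative_eq_intros)
  then have "((\<lambda>y. exp (\<kappa> * y) * (?D (x - 1) - integral {x - 1..y} ?e)) has_real_derivative
      \<kappa> * exp_tail \<kappa> g x - g x) (at x)"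
  proof (rule DERIV_cong)
    have e: "?e x * exp (\<kappa> * x) = g x" by (simp add: exp_minus)
    have Dx: "?D (x - 1) - integral {x - 1..x} ?e = ?D x" using D[of x] by linarith
    have "\<kappa> * exp (\<kappa> * x) * ?D x + (0 - ?e x) * exp (\<kappa> * x) = \<kappa> * (exp (\<kappa> * x) * ?D x) - ?e x * exp (\<kappa> * x)"
      by (simp only: left_diff_distrib mult.assoc mult_zero_left)
    then show "\<kappa> * exp (\<kappa> * x) * (?D (x - 1) - integral {x - 1..x} ?e) + (0 - ?e x) * exp (\<kappa> * x)
        = \<kappa> * exp_tail \<kappa> g x - g x"
      unfolding Dx e exp_tail_def .
  qed
  then show ?thesis
  proof (rule has_field_derivative_transform_within_open[where S="{x - 1<..}"])
    fix y assume "y \<in> {x - 1<..}"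
    then have "?D (x - 1) - integral {x - 1..y} ?e = ?D y" using D[of y] by simp
    then show "exp (\<kappa> * y) * (?D (x - 1) - integral {x - 1..y} ?e) = exp_tail \<kappa> g y"
      unfolding exp_tail_def by simp
  qed auto
qed

text \<open>
  For even \<open>g\<close> this is the bounded solution of \<open>V'' = \<kappa>\<^sup>2 V - g\<close>, the convolution of \<open>g\<close> with \<open>exp (- \<kappa> \<bar>x\<bar>) / (2 \<kappa>)\<close>. In this
  form it is visibly even, so that its derivative vanishes at \<open>0\<close>.
\<close>
definition green :: "real \<Rightarrow> (real \<Rightarrow> real) \<Rightarrow> real \<Rightarrow> real" where
  "green \<kappa> g x = (exp_tail \<kappa> g x + exp_tail \<kappa> g (- x)) / (2 * \<kappa>)"

lemma green_props:
  assumes "\<kappa> > 0" "continuous_on UNIV g" "\<And>t. \<bar>g t\<bar> \<le> C"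
  shows "\<bar>green \<kappa> g x\<bar> \<le> C / \<kappa>\<^sup>2" "continuous_on UNIV (green \<kappa> g)"
  "\<lbrakk>\<And>t. g (- t) = g t\<rbrakk> \<Longrightarrow> (green \<kappa> g has_real_derivative (exp_tail \<kappa> g x - exp_tail \<kappa> g (- x)) / 2) (at x)"
  "\<lbrakk>\<And>t. g (- t) = g t\<rbrakk> \<Longrightarrow> ((\<lambda>x. (exp_tail \<kappa> g x - exp_tail \<kappa> g (- x)) / 2) has_real_derivative \<kappa>\<^sup>2 * green \<kappa> g x - g x) (at x)"
proof -
  note d = exp_tail_deriv[OF assms]
  have d': "((\<lambda>x. exp_tail \<kappa> g (- x)) has_real_derivative - (\<kappa> * exp_tail \<kappa> g (- x) - g (- x))) (at x)" for x
  proof -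
    have "(uminus has_real_derivative - 1) (at x)" by (auto intro!: derivative_eq_intros)
    from DERIV_chain2[OF d this] show ?thesis by (simp add: algebra_simps)
  qed
  have "\<bar>exp_tail \<kappa> g x + exp_tail \<kappa> g (- x)\<bar> \<le> C / \<kappa> + C / \<kappa>"
    using exp_tail_bound[OF assms, of x] exp_tail_bound[OF assms, of "-x"] by linarith
  then have "\<bar>exp_tail \<kappa> g x + exp_tail \<kappa> g (- x)\<bar> / (2 * \<kappa>) \<le> (C / \<kappa> + C / \<kappa>) / (2 * \<kappa>)"
    using assms by (intro divide_right_mono) auto
  also have "\<dots> = C / \<kappa>\<^sup>2" using assms by (simp add: field_simps power2_eq_square)
  finally show "\<bar>green \<kappa> g x\<bar> \<le> C / \<kappa>\<^sup>2" using assms by (simp add: green_def)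
  have g1: "(green \<kappa> g has_real_derivative
      ((\<kappa> * exp_tail \<kappa> g x - g x) + - (\<kappa> * exp_tail \<kappa> g (- x) - g (- x))) / (2 * \<kappa>)) (at x)" for x
    unfolding green_def[abs_def] by (intro DERIV_cdivide DERIV_add d d')
  show "continuous_on UNIV (green \<kappa> g)"
    by (rule DERIV_continuous_on, rule has_field_derivative_at_within, rule g1)
  assume ev: "\<And>t. g (- t) = g t"
  show "(green \<kappa> g has_real_derivative (exp_tail \<kappa> g x - exp_tail \<kappa> g (- x)) / 2) (at x)"
  proof -
    have "((\<kappa> * exp_tail \<kappa> g x - g x) + - (\<kappa> * exp_tail \<kappa> g (- x) - g (- x))) / (2 * \<kappa>)
        = (exp_tail \<kappa> g x - exp_tail \<kappa> g (- x)) / 2"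
      using assms(1) ev by (simp add: field_simps)
    with g1[of x] show ?thesis by (rule DERIV_cong)
  qed
  have "((\<lambda>x. (exp_tail \<kappa> g x - exp_tail \<kappa> g (- x)) / 2) has_real_derivative
      ((\<kappa> * exp_tail \<kappa> g x - g x) - - (\<kappa> * exp_tail \<kappa> g (- x) - g (- x))) / 2) (at x)"
    by (intro DERIV_cdivide DERIV_diff d d')
  then show "((\<lambda>x. (exp_tail \<kappa> g x - exp_tail \<kappa> g (- x)) / 2) has_real_derivative \<kappa>\<^sup>2 * green \<kappa> g x - g x) (at x)"
  proof (rule DERIV_cong)
    show "((\<kappa> * exp_tail \<kappa> g x - g x) - - (\<kappa> * exp_tail \<kappa> g (- x) - g (- x))) / 2 = \<kappa>\<^sup>2 * green \<kappa> g x - g x"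
      using assms(1) ev by (simp add: green_def field_simps power2_eq_square)
  qed
qed

lemma green_diff:
  assumes "\<kappa> > 0" "continuous_on UNIV g" "\<And>t. \<bar>g t\<bar> \<le> C" "continuous_on UNIV h" "\<And>t. \<bar>h t\<bar> \<le> D"
  shows "green \<kappa> g x - green \<kappa> h x = green \<kappa> (\<lambda>t. g t - h t) x"
  using exp_tail_diff[OF assms, of x] exp_tail_diff[OF assms, of "-x"]
  by (simp add: green_def diff_divide_distrib[symmetric] algebra_simps)

text \<open>
  On \<open>[-R, R]\<close> the derivative \<open>k - \<gamma> - 3 c\<^sup>2\<close> of the cubic lies between \<open>0\<close> and \<open>k - \<gamma>\<close>; clamping extends both bounds to
  the whole line.
\<close>
lemma clamped_cubic:
  fixes R k \<gamma> a b :: real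
  defines "cl c \<equiv> max (- R) (min R c)"
  defines "P c \<equiv> (k - \<gamma>) * cl c - cl c ^ 3"
  assumes R: "0 \<le> R" and k: "\<gamma> + 3 * R\<^sup>2 \<le> k"
  shows "\<bar>P a - P b\<bar> \<le> (k - \<gamma>) * \<bar>a - b\<bar>" "\<bar>P a\<bar> \<le> (k - \<gamma>) * R - R ^ 3"
proof -
  have P: "\<bar>((k - \<gamma>) * x - x ^ 3) - ((k - \<gamma>) * y - y ^ 3)\<bar> \<le> (k - \<gamma>) * \<bar>x - y\<bar>"
    "\<bar>(k - \<gamma>) * x - x ^ 3\<bar> \<le> (k - \<gamma>) * R - R ^ 3" if x: "\<bar>x\<bar> \<le> R" and y: "\<bar>y\<bar> \<le> R" for x y
  proof -
    have sq: "x\<^sup>2 \<le> R\<^sup>2" "y\<^sup>2 \<le> R\<^sup>2" using x y by (auto simp: abs_le_square_iff[symmetric])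
    have "0 \<le> (x + y / 2)\<^sup>2 + 3 / 4 * y\<^sup>2" by simp
    then have q0: "0 \<le> x\<^sup>2 + x * y + y\<^sup>2" by (simp add: power2_eq_square algebra_simps)
    have "2 * x * y \<le> x\<^sup>2 + y\<^sup>2" by (rule sum_squares_bound)
    then have q1: "x\<^sup>2 + x * y + y\<^sup>2 \<le> 3 * R\<^sup>2" using sq by linarith
    have "((k - \<gamma>) * x - x ^ 3) - ((k - \<gamma>) * y - y ^ 3) = (x - y) * ((k - \<gamma>) - (x\<^sup>2 + x * y + y\<^sup>2))"
      by (simp add: power2_eq_square power3_eq_cube algebra_simps)
    also have "\<bar>\<dots>\<bar> \<le> \<bar>x - y\<bar> * (k - \<gamma>)"
      unfolding abs_mult using q0 q1 k by (intro mult_left_mono) auto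
    finally show "\<bar>((k - \<gamma>) * x - x ^ 3) - ((k - \<gamma>) * y - y ^ 3)\<bar> \<le> (k - \<gamma>) * \<bar>x - y\<bar>"
      by (simp add: mult.commute)
    have "\<bar>(k - \<gamma>) * x - x ^ 3\<bar> = \<bar>x\<bar> * ((k - \<gamma>) - \<bar>x\<bar>\<^sup>2)"
    proof -
      have "(k - \<gamma>) * x - x ^ 3 = x * ((k - \<gamma>) - x\<^sup>2)" by (simp add: power2_eq_square power3_eq_cube algebra_simps)
      moreover have "0 \<le> (k - \<gamma>) - x\<^sup>2" using sq k zero_le_power2[of R] by linarith
      ultimately show ?thesis by (simp add: abs_mult)
    qed
    moreover have "0 \<le> (R - \<bar>x\<bar>) * ((k - \<gamma>) - (R\<^sup>2 + R * \<bar>x\<bar> + \<bar>x\<bar>\<^sup>2))"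
    proof (rule mult_nonneg_nonneg)
      have "R * \<bar>x\<bar> \<le> R * R" using x R by (intro mult_left_mono) auto
      then show "0 \<le> (k - \<gamma>) - (R\<^sup>2 + R * \<bar>x\<bar> + \<bar>x\<bar>\<^sup>2)" using sq k by (simp add: power2_eq_square)
    qed (use x in auto)
    ultimately show "\<bar>(k - \<gamma>) * x - x ^ 3\<bar> \<le> (k - \<gamma>) * R - R ^ 3"
      by (simp add: power2_eq_square power3_eq_cube algebra_simps)
  qed
  have cl: "\<bar>cl c\<bar> \<le> R" for c using R by (auto simp: cl_def)
  have "\<bar>cl a - cl b\<bar> \<le> \<bar>a - b\<bar>" using R by (auto simp: cl_def max_def min_def)
  moreover have "0 \<le> k - \<gamma>" using k zero_le_power2[of R] by linarith
  ultimately have "(k - \<gamma>) * \<bar>cl a - cl b\<bar> \<le> (k - \<gamma>) * \<bar>a - b\<bar>" by (intro mult_left_mono)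
  with P(1)[OF cl cl, of a b] show "\<bar>P a - P b\<bar> \<le> (k - \<gamma>) * \<bar>a - b\<bar>" unfolding P_def by linarith
  show "\<bar>P a\<bar> \<le> (k - \<gamma>) * R - R ^ 3" unfolding P_def using P(2)[OF cl cl] by simp
qed

text \<open>
  With \<open>k\<close> added on both sides the equation reads \<open>- v'' + k v = (k - \<gamma>) v - v^3 + w\<close>. For large \<open>k\<close> the right-hand side is
  Lipschitz in \<open>v\<close> with constant \<open>k - \<gamma>\<close>, while the inverse of the left-hand side has norm \<open>1 / k\<close> in the supremum norm: a contraction.
  Evaluating the data at \<open>\<bar>x\<bar>\<close> makes the solution even, which is the Neumann condition at \<open>0\<close>.
\<close>
lemma semilinear_solution_exists:
  assumes \<gamma>: "\<gamma> > 0" and w: "continuous_on {0..} w" and C: "\<And>x. 0 \<le> x \<Longrightarrow> \<bar>w x\<bar> \<le> C"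
  obtains v v1 :: "real \<Rightarrow> real" and B where
    "\<And>x. (v has_real_derivative v1 x) (at x)"
    "\<And>x. (v1 has_real_derivative \<gamma> * v x + v x ^ 3 - w \<bar>x\<bar>) (at x)"
    "\<And>x. v (- x) = v x" "v1 0 = 0" "\<And>x. \<bar>v x\<bar> \<le> B" "\<And>x. \<bar>v1 x\<bar> \<le> B"
proof -
  have C0: "0 \<le> C" using C[of 0] by linarith
  \<comment> \<open>A supersolution: \<open>\<gamma> R + R^3 \<ge> C\<close>. The constant \<open>k\<close> makes the clamped cubic monotone.\<close>
  define R where "R = C / \<gamma>"
  define k where "k = \<gamma> + 3 * R\<^sup>2"
  define \<kappa> where "\<kappa> = sqrt k"
  define cl where "cl c = max (- R) (min R c)" for c :: real
  define P where "P c = (k - \<gamma>) * cl c - cl c ^ 3" for c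
  have R0: "0 \<le> R" using C0 \<gamma> by (simp add: R_def)
  have k\<gamma>: "\<gamma> \<le> k" by (simp add: k_def)
  have k0: "0 < k" using k\<gamma> \<gamma> by linarith
  have \<kappa>: "\<kappa> > 0" "\<kappa>\<^sup>2 = k" using k0 by (auto simp: \<kappa>_def)
  have P: "\<bar>P a - P b\<bar> \<le> (k - \<gamma>) * \<bar>a - b\<bar>" "\<bar>P a\<bar> \<le> (k - \<gamma>) * R - R ^ 3" for a b
    using clamped_cubic[OF R0, of \<gamma> k] unfolding P_def cl_def k_def by auto
  have cP: "continuous_on A P" for A
    unfolding P_def cl_def by (intro continuous_intros)
  have cw: "continuous_on UNIV (\<lambda>x. w \<bar>x\<bar>)"
    by (rule continuous_on_compose2[OF w]) (auto intro!: continuous_intros)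
  define G where "G u x = P (u \<bar>x\<bar>) + w \<bar>x\<bar>" for u :: "real \<Rightarrow> real" and x
  have G: "continuous_on UNIV (G u)" "\<bar>G u x\<bar> \<le> k * R" if "continuous_on UNIV u" for u x
  proof -
    have "continuous_on UNIV (\<lambda>x. u \<bar>x\<bar>)"
      by (rule continuous_on_compose2[OF that]) (auto intro!: continuous_intros)
    then show "continuous_on UNIV (G u)"
      unfolding G_def by (intro continuous_intros cw continuous_on_compose2[OF cP]) auto
    have "0 \<le> R ^ 3" "C = \<gamma> * R" using R0 \<gamma> by (auto simp: R_def)
    then show "\<bar>G u x\<bar> \<le> k * R"
      using P(2)[of "u \<bar>x\<bar>"] C[of "\<bar>x\<bar>"] unfolding G_def left_diff_distrib by linarith
  qed
  have bT: "green \<kappa> (G u) \<in> bcontfun" if "continuous_on UNIV u" for u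
    using green_props[OF \<kappa>(1) G[OF that]] by (intro bcontfun_normI) auto
  define T where "T v = Bcontfun (green \<kappa> (G (apply_bcontfun v)))" for v :: "real \<Rightarrow>\<^sub>C real"
  have T: "apply_bcontfun (T v) = green \<kappa> (G (apply_bcontfun v))" for v
    unfolding T_def by (rule Bcontfun_inverse, rule bT) auto
  have "\<exists>!v. T v = v"
  proof (rule banach_fix_type[of "(k - \<gamma>) / k"])
    show "0 \<le> (k - \<gamma>) / k" "(k - \<gamma>) / k < 1" using k\<gamma> k0 \<gamma> by auto
    show "\<forall>x y. dist (T x) (T y) \<le> (k - \<gamma>) / k * dist x y"
    proof (intro allI dist_bound)
      fix u v :: "real \<Rightarrow>\<^sub>C real" and x :: real
      have cu: "continuous_on UNIV (apply_bcontfun u)" "continuous_on UNIV (apply_bcontfun v)" by auto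
      have le: "\<bar>G (apply_bcontfun u) t - G (apply_bcontfun v) t\<bar> \<le> (k - \<gamma>) * dist u v" for t
      proof -
        have "\<bar>G (apply_bcontfun u) t - G (apply_bcontfun v) t\<bar> \<le> (k - \<gamma>) * \<bar>apply_bcontfun u \<bar>t\<bar> - apply_bcontfun v \<bar>t\<bar>\<bar>"
          using P(1) by (simp add: G_def)
        also have "\<dots> \<le> (k - \<gamma>) * dist u v"
          using dist_bounded[of u "\<bar>t\<bar>" v] k\<gamma> by (intro mult_left_mono) (auto simp: dist_real_def)
        finally show ?thesis .
      qed
      have "\<bar>green \<kappa> (\<lambda>t. G (apply_bcontfun u) t - G (apply_bcontfun v) t) x\<bar> \<le> (k - \<gamma>) * dist u v / \<kappa>\<^sup>2"
        by (rule green_props(1)[OF \<kappa>(1) _ le]) (intro continuous_intros G cu)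
      then show "dist (apply_bcontfun (T u) x) (apply_bcontfun (T v) x) \<le> (k - \<gamma>) / k * dist u v"
        unfolding T dist_real_def green_diff[OF \<kappa>(1) G(1,2)[OF cu(1)] G(1,2)[OF cu(2)]] by (simp add: \<kappa>)
    qed
  qed
  then obtain V where V: "T V = V" by auto
  define v where "v = apply_bcontfun V"
  have cv: "continuous_on UNIV v" by (auto simp: v_def)
  have vg: "v = green \<kappa> (G v)" using T[of V] V by (simp add: v_def)
  note gp = green_props[OF \<kappa>(1) G[OF cv]]
  have ev: "G v (- t) = G v t" for t by (simp add: G_def)
  have vR: "\<bar>v x\<bar> \<le> R" for x
    using gp(1)[of x] k0 by (simp add: vg[symmetric] \<kappa>)
  have even: "v (- x) = v x" for x
    by (subst (1 2) vg) (simp add: green_def add.commute)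
  define v1 where "v1 x = (exp_tail \<kappa> (G v) x - exp_tail \<kappa> (G v) (- x)) / 2" for x
  have d1: "(v has_real_derivative v1 x) (at x)" for x
    using gp(3)[OF ev, of x] by (simp add: v1_def vg[symmetric])
  have "(v1 has_real_derivative k * v x - G v x) (at x)" for x
    using gp(4)[OF ev, of x] by (simp add: v1_def[abs_def] vg[symmetric] \<kappa>)
  moreover have "k * v x - G v x = \<gamma> * v x + v x ^ 3 - w \<bar>x\<bar>" for x
  proof -
    have "v \<bar>x\<bar> = v x" using even[of x] by (auto simp: abs_if)
    moreover have "cl (v x) = v x" using vR[of x] by (auto simp: cl_def)
    ultimately show ?thesis by (simp add: G_def P_def algebra_simps)
  qed
  ultimately have d2: "(v1 has_real_derivative \<gamma> * v x + v x ^ 3 - w \<bar>x\<bar>) (at x)" for x by simp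
  have "\<bar>(a - b) / 2\<bar> \<le> K" if ab: "\<bar>a\<bar> \<le> K" "\<bar>b\<bar> \<le> K" for a b K :: real
  proof -
    have "\<bar>a - b\<bar> \<le> K + K" using ab by linarith
    then show ?thesis by simp
  qed
  from this[OF exp_tail_bound[OF \<kappa>(1) G[OF cv]] exp_tail_bound[OF \<kappa>(1) G[OF cv]]]
  have b1: "\<bar>v1 x\<bar> \<le> k * R / \<kappa>" for x unfolding v1_def .
  have z: "v1 0 = 0" by (simp add: v1_def)
  have "\<bar>v x\<bar> \<le> max R (k * R / \<kappa>)" "\<bar>v1 x\<bar> \<le> max R (k * R / \<kappa>)" for x
    using vR[of x] b1[of x] by (auto simp only: le_max_iff_disj)
  with that[OF d1 d2 even z] show ?thesis by blast
qed

section \<open>Existence, uniqueness and monotonicity of \<open>N\<close>\<close>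

lemma hl_FTC:
  assumes G: "\<And>x. (G has_real_derivative g x) (at x)" and g: "continuous_on {a..b} g" and ab: "0 \<le> a" "a \<le> b"
  shows "(\<integral>x. g x * indicator {a<..b} x \<partial>hl) = G b - G a"
proof -
  have "(\<integral>x. g x * indicator {a<..b} x \<partial>hl) = (\<integral>x. indicator {a<..b} x *\<^sub>R g x \<partial>lborel)"
    unfolding hl_integral_eq[symmetric] set_lebesgue_integral_def
    by (intro Bochner_Integration.integral_cong) (use ab in \<open>auto simp: indicator_def\<close>)
  also have "\<dots> = (\<integral>x. indicator {a..b} x *\<^sub>R g x \<partial>lborel)"
  proof -
    have s: "set_integrable lborel {a..b} g" by (rule borel_integrable_atLeastAtMost'[OF g])
    have s': "set_integrable lborel {a<..b} g" by (rule set_integrable_subset[OF s]) auto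
    show ?thesis
      by (rule integral_cong_AE)
        (use s s' AE_lborel_singleton[of a] in \<open>auto simp: set_integrable_def indicator_def elim!: eventually_mono\<close>)
  qed
  also have "\<dots> = G b - G a"
    using G by (intro integral_FTC_atLeastAtMost ab g)
      (auto simp: has_real_derivative_iff_has_vector_derivative intro: has_vector_derivative_at_within)
  finally show ?thesis .
qed

lemma integrable_hl_of_bounded_truncations:
  fixes k :: "real \<Rightarrow> real"
  assumes k: "continuous_on {0..} k" and nn: "\<And>x. 0 < x \<Longrightarrow> 0 \<le> k x"
    and bd: "\<And>n::nat. (\<integral>x. k x * indicator {0<..real n} x \<partial>hl) \<le> K"
  shows "integrable hl k"
proof -
  let ?f = "\<lambda>(n::nat) x. k x * indicator {0<..real n} x"
  have [measurable]: "k \<in> borel_measurable hl" by (rule measurable_hl_continuous[OF k])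
  have i: "integrable hl (?f n)" for n
  proof -
    have "continuous_on {0..real n} k" using k by (rule continuous_on_subset) auto
    then obtain C where C: "\<And>x. x \<in> {0..real n} \<Longrightarrow> \<bar>k x\<bar> \<le> C" by (rule continuous_on_Icc_bounded) blast
    show ?thesis
    proof (rule Bochner_Integration.integrable_bound)
      show "integrable hl (\<lambda>x. C * indicator {0<..real n} x)"
        using integral_hl_Ioc[of 0 "real n"] by simp
      show "?f n \<in> borel_measurable hl" by measurable
      show "AE x in hl. norm (?f n x) \<le> norm (C * indicator {0<..real n} x)"
      proof (rule AE_hl_I)
        fix x :: real assume "0 < x"
        then show "norm (?f n x) \<le> norm (C * indicator {0<..real n} x)"
          using C[of x] by (cases "x \<le> real n") auto
      qed
    qed
  qed
  have mono: "?f n x \<le> ?f m x" if "n \<le> m" "0 < x" for n m x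
    using nn[OF that(2)] that by (auto simp: indicator_def)
  have inc: "incseq (\<lambda>n. integral\<^sup>L hl (?f n))"
    by (intro monoI hl_mono i mono)
  have "\<forall>n. integral\<^sup>L hl (?f n) \<le> K" using bd by blast
  from incseq_convergent[OF inc this] obtain L where L: "(\<lambda>n. integral\<^sup>L hl (?f n)) \<longlonglongrightarrow> L"
    by metis
  show ?thesis
  proof (rule integrable_monotone_convergence[of hl ?f, OF i _ _ L])
    show "AE x in hl. mono (\<lambda>n. ?f n x)"
      by (rule AE_hl_I) (intro monoI mono)
    show "AE x in hl. (\<lambda>n. ?f n x) \<longlonglongrightarrow> k x"
    proof (rule AE_hl_I)
      fix x :: real assume "0 < x"
      obtain n where n: "x \<le> real n" using real_arch_simple by blast
      have "\<forall>\<^sub>F m in sequentially. k x = ?f m x"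
        using eventually_ge_at_top[of n] by eventually_elim (use n \<open>0 < x\<close> in auto)
      then show "(\<lambda>n. ?f n x) \<longlonglongrightarrow> k x"
        by (rule Lim_transform_eventually[rotated]) auto
    qed
  qed simp
qed

text \<open>
  Since \<open>(v v')' = v'^2 + \<gamma> v^2 + v^4 - w v\<close> and \<open>v v'\<close> is bounded, the integrals of \<open>v'^2 + \<gamma>/2 v^2\<close> over \<open>(0, n)\<close> are bounded by the
  energy of \<open>w\<close>.
\<close>
lemma semilinear_solution_L2:
  assumes \<gamma>: "\<gamma> > 0" and w: "continuous_on {0..} w" "w \<in> L2"
    and d: "\<And>x. (v has_real_derivative v1 x) (at x)"
    "\<And>x. (v1 has_real_derivative \<gamma> * v x + v x ^ 3 - w \<bar>x\<bar>) (at x)"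
    and z: "v1 0 = 0" and B: "\<And>x. \<bar>v x\<bar> \<le> B" "\<And>x. \<bar>v1 x\<bar> \<le> B"
  shows "v \<in> L2" "v1 \<in> L2"
proof -
  have c: "continuous_on A v" "continuous_on A v1" for A
    by (rule DERIV_continuous_on, rule has_field_derivative_at_within, rule d)+
  have cw: "continuous_on {0..} (\<lambda>x. w \<bar>x\<bar>)"
    by (rule continuous_on_compose2[OF w(1)]) (auto intro!: continuous_intros)
  have iw: "integrable hl (\<lambda>x. (w x)\<^sup>2)" using w by (intro L2_square_integrable)
  let ?k = "\<lambda>x. (v1 x)\<^sup>2 + \<gamma> / 2 * (v x)\<^sup>2"
  have ck: "continuous_on {0..} ?k" by (intro continuous_intros c)
  have nn: "0 \<le> ?k x" for x using \<gamma> by simp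
  let ?e = "\<lambda>x. v1 x * v1 x + (\<gamma> * v x + v x ^ 3 - w \<bar>x\<bar>) * v x"
  let ?W = "(\<integral>x. (w x)\<^sup>2 \<partial>hl)"
  have "integrable hl ?k"
  proof (rule integrable_hl_of_bounded_truncations[OF ck nn])
    fix n :: nat
    have ce: "continuous_on {0..} ?e" by (intro continuous_intros c cw)
    then have ce': "continuous_on {0..real n} ?e" by (rule continuous_on_subset) auto
    have e: "(\<integral>x. ?e x * indicator {0<..real n} x \<partial>hl) = v (real n) * v1 (real n) - v 0 * v1 0"
      by (rule hl_FTC[OF _ ce']) (auto intro!: DERIV_cong[OF DERIV_mult[OF d(1) d(2)]] simp: algebra_simps)
    have tr: "integrable hl (\<lambda>x. h x * indicator {0<..real n} x)" if "continuous_on {0..} h" for h :: "real \<Rightarrow> real"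
    proof -
      \<comment> \<open>A continuous function of bounded support that agrees with \<open>h\<close> on \<open>[0, n]\<close>.\<close>
      let ?h = "\<lambda>x. h (min x (real n)) - h (min x (real n)) * min 1 (max 0 (x - real n))"
      have ch: "continuous_on {0..} (\<lambda>x. h (min x (real n)))"
        by (rule continuous_on_compose2[OF that]) (auto intro!: continuous_intros)
      have "integrable hl ?h"
        by (rule integrable_hl_continuous_support[where b="real n + 1"]) (auto intro!: continuous_intros ch)
      then have "integrable hl (\<lambda>x. ?h x * indicator {0<..real n} x)" by (rule integrable_hl_indicator) auto
      then show ?thesis by (rule back_subst[of "integrable hl"]) (auto simp: indicator_def)
    qed
    have "(\<integral>x. ?k x * indicator {0<..real n} x \<partial>hl) \<le>
        (\<integral>x. ?e x * indicator {0<..real n} x + (1 / (2 * \<gamma>)) * (w x)\<^sup>2 \<partial>hl)"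
    proof (rule hl_mono)
      fix x :: real assume x: "0 < x"
      have "0 \<le> (\<gamma> * v x - w x)\<^sup>2" by simp
      then have "w x * v x * (2 * \<gamma>) \<le> \<gamma> * (\<gamma> * (v x)\<^sup>2) + (w x)\<^sup>2"
        by (simp add: power2_eq_square algebra_simps)
      then have young: "w x * v x \<le> \<gamma> / 2 * (v x)\<^sup>2 + (1 / (2 * \<gamma>)) * (w x)\<^sup>2"
        using \<gamma> by (simp add: field_simps)
      have "v x ^ 3 * v x = (v x * v x)\<^sup>2" by (simp add: power2_eq_square power3_eq_cube)
      then have "0 \<le> v x ^ 3 * v x" by simp
      then have "?k x \<le> ?e x + (1 / (2 * \<gamma>)) * (w x)\<^sup>2"
        using young x by (simp add: power2_eq_square algebra_simps)
      moreover have "0 \<le> (1 / (2 * \<gamma>)) * (w x)\<^sup>2" using \<gamma> by simp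
      ultimately show "?k x * indicator {0<..real n} x \<le> ?e x * indicator {0<..real n} x + (1 / (2 * \<gamma>)) * (w x)\<^sup>2"
        by (auto simp: indicator_def)
    qed (intro tr ck ce Bochner_Integration.integrable_add Bochner_Integration.integrable_mult_right iw)+
    also have "\<dots> = v (real n) * v1 (real n) + (1 / (2 * \<gamma>)) * ?W"
      using tr[OF ce] iw e z by simp
    also have "v (real n) * v1 (real n) \<le> B * B"
      using mult_mono[OF B(1) B(2)] B(1)[of 0] by (metis abs_ge_self abs_ge_zero abs_mult order_trans)
    finally show "(\<integral>x. ?k x * indicator {0<..real n} x \<partial>hl) \<le> B * B + (1 / (2 * \<gamma>)) * ?W" by simp
  qed
  note ik = this
  have [measurable]: "v \<in> borel_measurable hl" "v1 \<in> borel_measurable hl"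
    by (intro measurable_hl_continuous c)+
  have "integrable hl (\<lambda>x. (v1 x)\<^sup>2)"
    by (rule Bochner_Integration.integrable_bound[OF ik]) (use \<gamma> in \<open>auto intro!: AE_I2\<close>)
  then show "v1 \<in> L2" by (simp add: L2_iff)
  have "integrable hl (\<lambda>x. \<gamma> / 2 * (v x)\<^sup>2)"
    by (rule Bochner_Integration.integrable_bound[OF ik]) (use \<gamma> in \<open>auto intro!: AE_I2\<close>)
  from Bochner_Integration.integrable_mult_right[OF this, of "2 / \<gamma>"]
  have "integrable hl (\<lambda>x. (v x)\<^sup>2)" using \<gamma> by simp
  then show "v \<in> L2" by (simp add: L2_iff)
qed

lemma H1_mult_bounded_L2:
  assumes "v \<in> H1" "w \<in> H1" shows "(\<lambda>x. v x * w x) \<in> L2"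
proof -
  obtain C where "\<And>x. 0 \<le> x \<Longrightarrow> \<bar>v x\<bar> \<le> C" using H1_bounded[OF assms(1)] by metis
  then show ?thesis
    by (intro L2_bounded_mult[where C=C] H1_L2 assms measurable_hl_continuous H1_continuous) auto
qed

lemma H1_cube_L2: assumes "v \<in> H1" shows "(\<lambda>x. v x ^ 3) \<in> L2"
proof -
  obtain C where C: "\<And>x. 0 \<le> x \<Longrightarrow> \<bar>v x\<bar> \<le> C" using H1_bounded[OF assms] by metis
  have "(\<lambda>x. v x * (v x * v x)) \<in> L2"
    using C by (intro L2_bounded_mult[where C=C] H1_mult_bounded_L2 assms measurable_hl_continuous H1_continuous) auto
  then show ?thesis by (simp add: power3_eq_cube mult.assoc)
qed

lemma weak_solution_tested:
  assumes "weak_solution \<gamma> w v" "w \<in> L2" "\<phi> \<in> H1"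
  shows "(\<integral>x. wderiv v x * wderiv \<phi> x \<partial>hl) + \<gamma> * (\<integral>x. v x * \<phi> x \<partial>hl) + (\<integral>x. v x ^ 3 * \<phi> x \<partial>hl)
    = (\<integral>x. w x * \<phi> x \<partial>hl)"
proof -
  have v: "v \<in> H1" using assms by (simp add: weak_solution_def)
  have i: "integrable hl (\<lambda>x. wderiv v x * wderiv \<phi> x)" "integrable hl (\<lambda>x. v x * \<phi> x)"
    "integrable hl (\<lambda>x. v x ^ 3 * \<phi> x)" "integrable hl (\<lambda>x. w x * \<phi> x)"
    by (rule L2_mult_integrable[OF H1_wderiv(1)[OF v] H1_wderiv(1)[OF assms(3)]]
        L2_mult_integrable[OF H1_L2[OF v] H1_L2[OF assms(3)]]
        L2_mult_integrable[OF H1_cube_L2[OF v] H1_L2[OF assms(3)]]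
        L2_mult_integrable[OF assms(2) H1_L2[OF assms(3)]])+
  have "(\<integral>x. wderiv v x * wderiv \<phi> x + \<gamma> * v x * \<phi> x + v x ^ 3 * \<phi> x - w x * \<phi> x \<partial>hl) = 0"
    using assms by (auto simp: weak_solution_def hl_integral_eq)
  then show ?thesis using i by (simp add: mult.assoc)
qed

text \<open>
  Test the difference of the two equations with the difference of the solutions; the gradient term and the cubic term
  have the right sign.
\<close>
lemma weak_solution_monotone:
  assumes "weak_solution \<gamma> w0 v0" "weak_solution \<gamma> w1 v1" "w0 \<in> L2" "w1 \<in> L2"
  shows "\<gamma> * (\<integral>x. (v1 x - v0 x)\<^sup>2 \<partial>hl) \<le> (\<integral>x. (w1 x - w0 x) * (v1 x - v0 x) \<partial>hl)"
proof -
  have v: "v0 \<in> H1" "v1 \<in> H1" using assms by (auto simp: weak_solution_def)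
  define D where "D x = v1 x - v0 x" for x
  have D: "D \<in> H1" "AE x in hl. wderiv D x = wderiv v1 x - wderiv v0 x"
    using H1_diff[OF v(2,1)] by (auto simp: D_def[abs_def])
  note i = L2_mult_integrable[OF H1_wderiv(1)[OF v(1)] H1_wderiv(1)[OF D(1)]]
    L2_mult_integrable[OF H1_wderiv(1)[OF v(2)] H1_wderiv(1)[OF D(1)]]
    L2_mult_integrable[OF H1_L2[OF v(1)] H1_L2[OF D(1)]] L2_mult_integrable[OF H1_L2[OF v(2)] H1_L2[OF D(1)]]
    L2_mult_integrable[OF H1_cube_L2[OF v(1)] H1_L2[OF D(1)]] L2_mult_integrable[OF H1_cube_L2[OF v(2)] H1_L2[OF D(1)]]
    L2_mult_integrable[OF assms(3) H1_L2[OF D(1)]] L2_mult_integrable[OF assms(4) H1_L2[OF D(1)]]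
  have e: "(\<integral>x. wderiv v1 x * wderiv D x \<partial>hl) - (\<integral>x. wderiv v0 x * wderiv D x \<partial>hl)
     + \<gamma> * ((\<integral>x. v1 x * D x \<partial>hl) - (\<integral>x. v0 x * D x \<partial>hl))
     + ((\<integral>x. v1 x ^ 3 * D x \<partial>hl) - (\<integral>x. v0 x ^ 3 * D x \<partial>hl))
     = (\<integral>x. w1 x * D x \<partial>hl) - (\<integral>x. w0 x * D x \<partial>hl)"
    using weak_solution_tested[OF assms(1,3) D(1)] weak_solution_tested[OF assms(2,4) D(1)]
    by (simp add: right_diff_distrib)
  have "0 \<le> (\<integral>x. wderiv v1 x * wderiv D x - wderiv v0 x * wderiv D x \<partial>hl)"
    using D(2) by (intro integral_nonneg_AE) (auto simp: left_diff_distrib[symmetric] elim!: eventually_mono)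
  then have 1: "0 \<le> (\<integral>x. wderiv v1 x * wderiv D x \<partial>hl) - (\<integral>x. wderiv v0 x * wderiv D x \<partial>hl)"
    using i by simp
  have "0 \<le> (\<integral>x. v1 x ^ 3 * D x - v0 x ^ 3 * D x \<partial>hl)"
  proof (rule integral_nonneg_AE, rule AE_I2)
    fix x
    have "v1 x ^ 3 * D x - v0 x ^ 3 * D x = (D x)\<^sup>2 * ((v1 x + v0 x / 2)\<^sup>2 + 3 / 4 * (v0 x)\<^sup>2)"
      by (simp add: D_def power2_eq_square power3_eq_cube algebra_simps)
    then show "0 \<le> v1 x ^ 3 * D x - v0 x ^ 3 * D x" by simp
  qed
  then have 2: "0 \<le> (\<integral>x. v1 x ^ 3 * D x \<partial>hl) - (\<integral>x. v0 x ^ 3 * D x \<partial>hl)" using i by simp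
  have "(\<integral>x. (v1 x - v0 x)\<^sup>2 \<partial>hl) = (\<integral>x. v1 x * D x - v0 x * D x \<partial>hl)"
    by (simp add: D_def power2_eq_square algebra_simps)
  also have "\<dots> = (\<integral>x. v1 x * D x \<partial>hl) - (\<integral>x. v0 x * D x \<partial>hl)" using i by simp
  finally have 3: "(\<integral>x. (v1 x - v0 x)\<^sup>2 \<partial>hl) = (\<integral>x. v1 x * D x \<partial>hl) - (\<integral>x. v0 x * D x \<partial>hl)" .
  have "(\<integral>x. (w1 x - w0 x) * (v1 x - v0 x) \<partial>hl) = (\<integral>x. w1 x * D x - w0 x * D x \<partial>hl)"
    by (simp add: D_def algebra_simps)
  also have "\<dots> = (\<integral>x. w1 x * D x \<partial>hl) - (\<integral>x. w0 x * D x \<partial>hl)" using i by simp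
  finally show ?thesis using 1 2 3 e by simp
qed

lemma continuous_square_integral_0:
  assumes D: "continuous_on {0..} D" "D \<in> L2" and 0: "(\<integral>x. (D x)\<^sup>2 \<partial>hl) \<le> 0" and x: "0 \<le> x"
  shows "D x = 0"
proof (rule ccontr)
  assume "D x \<noteq> 0"
  then have "\<bar>D x\<bar> / 2 > 0" by simp
  then obtain r where r: "r > 0" "\<And>y. y \<in> {0..} \<Longrightarrow> dist y x < r \<Longrightarrow> dist (D y) (D x) < \<bar>D x\<bar> / 2"
    using D(1) x unfolding continuous_on_iff by (metis atLeast_iff)
  have i: "integrable hl (\<lambda>y. (D y)\<^sup>2)" using D by (intro L2_square_integrable)
  have "0 < (\<bar>D x\<bar> / 2)\<^sup>2 * (r / 2)" using \<open>D x \<noteq> 0\<close> r by (intro mult_pos_pos) auto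
  also have "\<dots> = (\<integral>y. (\<bar>D x\<bar> / 2)\<^sup>2 * indicator {x<..x + r/2} y \<partial>hl)"
    using integral_hl_Ioc[of x "x + r/2"] x r by simp
  also have "\<dots> \<le> (\<integral>y. (D y)\<^sup>2 \<partial>hl)"
  proof (rule hl_mono[OF _ i])
    show "integrable hl (\<lambda>y. (\<bar>D x\<bar> / 2)\<^sup>2 * indicator {x<..x + r/2} y)"
      using integral_hl_Ioc[of x "x + r/2"] x r by simp
    fix y :: real
    show "(\<bar>D x\<bar> / 2)\<^sup>2 * indicator {x<..x + r/2} y \<le> (D y)\<^sup>2"
    proof (cases "y \<in> {x<..x + r/2}")
      case True
      then have "dist (D y) (D x) < \<bar>D x\<bar> / 2" using r x by (auto simp: dist_real_def)
      then have "\<bar>D x\<bar> / 2 \<le> \<bar>D y\<bar>" unfolding dist_real_def by arith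
      then have "\<bar>\<bar>D x\<bar> / 2\<bar> \<le> \<bar>D y\<bar>" by simp
      then have "(\<bar>D x\<bar> / 2)\<^sup>2 \<le> (D y)\<^sup>2" by (simp only: abs_le_square_iff)
      then show ?thesis using True by simp
    qed simp
  qed
  finally show False using 0 by simp
qed

lemma weak_solution_unique:
  assumes "\<gamma> > 0" "weak_solution \<gamma> w v0" "weak_solution \<gamma> w v1" "w \<in> L2" "0 \<le> x"
  shows "v1 x = v0 x"
proof -
  have v: "v0 \<in> H1" "v1 \<in> H1" using assms by (auto simp: weak_solution_def)
  have "\<gamma> * (\<integral>x. (v1 x - v0 x)\<^sup>2 \<partial>hl) \<le> 0"
    using weak_solution_monotone[OF assms(2,3,4,4)] by simp
  then have "(\<integral>x. (v1 x - v0 x)\<^sup>2 \<partial>hl) \<le> 0" using assms(1) by (simp add: mult_le_0_iff)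
  then have "v1 x - v0 x = 0"
    using v assms(5) by (intro continuous_square_integral_0[of "\<lambda>x. v1 x - v0 x"])
      (auto intro: continuous_intros H1_continuous L2_diff H1_L2)
  then show ?thesis by simp
qed

lemma has_weak_deriv_cong:
  assumes "\<And>x. 0 < x \<Longrightarrow> w x = h x" shows "has_weak_deriv w g = has_weak_deriv h g"
proof -
  have "(\<integral>x. w x * deriv \<phi> x \<partial>hl) = (\<integral>x. h x * deriv \<phi> x \<partial>hl)" for \<phi>
    by (rule hl_cong) (use assms in auto)
  then show ?thesis unfolding has_weak_deriv_def hl_integral_eq by simp
qed

text \<open>
  The values at negative arguments do not enter, which is what allows \<^const>\<open>N\<close> to prescribe them.
\<close>
lemma weak_solution_cong:
  assumes "\<And>x. 0 \<le> x \<Longrightarrow> v x = h x" shows "weak_solution \<gamma> w v = weak_solution \<gamma> w h"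
proof -
  have wd: "has_weak_deriv v = has_weak_deriv h"
    using assms by (intro ext has_weak_deriv_cong) auto
  then have "wderiv v = wderiv h" unfolding wderiv_def[abs_def] by simp
  moreover have "v \<in> H1 \<longleftrightarrow> h \<in> H1"
    unfolding H1_def using wd assms L2_cong[of v h] continuous_on_cong[of "{0..}" "{0..}" v h] by auto
  moreover have "(\<integral>x. wderiv h x * wderiv \<phi> x + \<gamma> * v x * \<phi> x + v x ^ 3 * \<phi> x - w x * \<phi> x \<partial>hl)
     = (\<integral>x. wderiv h x * wderiv \<phi> x + \<gamma> * h x * \<phi> x + h x ^ 3 * \<phi> x - w x * \<phi> x \<partial>hl)" for \<phi>
    by (rule hl_cong) (use assms in auto)
  ultimately show ?thesis unfolding weak_solution_def hl_integral_eq by simp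
qed

text \<open>
  The even classical solution is also the weak one. Keeping it as a function on the whole line turns every statement about
  \<open>v\<close> at the endpoint \<open>0\<close> into one about an interior point.
\<close>
lemma N_classical:
  assumes \<gamma>: "\<gamma> > 0" and w: "w \<in> H1"
  obtains v v1 :: "real \<Rightarrow> real" and B where
    "weak_solution \<gamma> w (N \<gamma> w)"
    "\<And>x. 0 \<le> x \<Longrightarrow> N \<gamma> w x = v x"
    "\<And>x. (v has_real_derivative v1 x) (at x)"
    "\<And>x. (v1 has_real_derivative \<gamma> * v x + v x ^ 3 - w \<bar>x\<bar>) (at x)"
    "\<And>x. v (- x) = v x" "v1 0 = 0" "\<And>x. \<bar>v x\<bar> \<le> B" "\<And>x. \<bar>v1 x\<bar> \<le> B"
proof -
  obtain C where C: "\<And>x. 0 \<le> x \<Longrightarrow> \<bar>w x\<bar> \<le> C" using H1_bounded[OF w] by metis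
  obtain v v1 B where v: "\<And>x. (v has_real_derivative v1 x) (at x)"
    "\<And>x. (v1 has_real_derivative \<gamma> * v x + v x ^ 3 - w \<bar>x\<bar>) (at x)"
    "\<And>x. v (- x) = v x" "v1 0 = 0" "\<And>x. \<bar>v x\<bar> \<le> B" "\<And>x. \<bar>v1 x\<bar> \<le> B"
    using semilinear_solution_exists[OF \<gamma> H1_continuous[OF w] C] by metis
  have c: "continuous_on A v" "continuous_on A v1" for A
    by (rule DERIV_continuous_on, rule has_field_derivative_at_within, rule v)+
  have L: "v \<in> L2" "v1 \<in> L2"
    using semilinear_solution_L2[OF \<gamma> H1_continuous[OF w] H1_L2[OF w] v(1,2,4,5,6)] by auto
  have wd: "has_weak_deriv v v1"
    by (rule piecewise_C1_weak_deriv[where S="{}"]) (use c L v in auto)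
  have vH: "v \<in> H1" using H1_I[OF c(1) L wd] .
  let ?v2 = "\<lambda>x. \<gamma> * v x + v x ^ 3 - w \<bar>x\<bar>"
  have wabs: "(\<lambda>x. w \<bar>x\<bar>) \<in> L2" using H1_L2[OF w] by (subst L2_cong[where h=w]) auto
  have L2: "?v2 \<in> L2" by (intro L2_add L2_diff L2_scale L H1_cube_L2 vH wabs)
  have c2: "continuous_on UNIV ?v2"
    by (intro continuous_intros c continuous_on_compose2[OF H1_continuous[OF w]]) auto
  have "weak_solution \<gamma> w v"
    unfolding weak_solution_def hl_integral_eq
  proof (intro conjI ballI vH)
    fix \<phi> assume \<phi>: "\<phi> \<in> H1"
    have bp: "(\<integral>x. v1 x * wderiv \<phi> x \<partial>hl) = - (\<integral>x. ?v2 x * \<phi> x \<partial>hl)"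
      by (rule half_line_by_parts[OF \<phi> v(2) c2 v(4) L(2) L2 v(6)])
    have AE: "AE x in hl. wderiv v x = v1 x" by (rule wderiv_AE_eq[OF vH L(2) wd])
    have i: "integrable hl (\<lambda>x. v1 x * wderiv \<phi> x)" "integrable hl (\<lambda>x. ?v2 x * \<phi> x)"
      using L2_mult_integrable[OF L(2) H1_wderiv(1)[OF \<phi>]] L2_mult_integrable[OF L2 H1_L2[OF \<phi>]] by auto
    have [measurable]: "v1 \<in> borel_measurable hl" "wderiv v \<in> borel_measurable hl" "wderiv \<phi> \<in> borel_measurable hl"
      "v \<in> borel_measurable hl" "\<phi> \<in> borel_measurable hl" "w \<in> borel_measurable hl"
      using L H1_wderiv[OF vH] H1_wderiv[OF \<phi>] H1_L2[OF \<phi>] H1_L2[OF w] by (auto intro: L2_measurable)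
    have "(\<integral>x. wderiv v x * wderiv \<phi> x + \<gamma> * v x * \<phi> x + v x ^ 3 * \<phi> x - w x * \<phi> x \<partial>hl)
       = (\<integral>x. v1 x * wderiv \<phi> x + (\<gamma> * v x + v x ^ 3 - w x) * \<phi> x \<partial>hl)"
      by (rule integral_cong_AE) (use AE in \<open>auto simp: algebra_simps elim!: eventually_mono\<close>)
    also have "\<dots> = (\<integral>x. v1 x * wderiv \<phi> x + ?v2 x * \<phi> x \<partial>hl)"
      by (rule hl_cong) auto
    also have "\<dots> = 0" using i bp by simp
    finally show "(\<integral>x. wderiv v x * wderiv \<phi> x + \<gamma> * v x * \<phi> x + v x ^ 3 * \<phi> x - w x * \<phi> x \<partial>hl) = 0" .
  qed
  define V where "V x = (if x < 0 then 0 else v x)" for x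
  have V: "weak_solution \<gamma> w V"
    using \<open>weak_solution \<gamma> w v\<close> by (subst weak_solution_cong[where h=v]) (auto simp: V_def)
  have NV: "N \<gamma> w = V"
    unfolding N_def
  proof (rule the_equality)
    show "weak_solution \<gamma> w V \<and> (\<forall>x<0. V x = 0)" using V by (simp add: V_def)
    fix h assume h: "weak_solution \<gamma> w h \<and> (\<forall>x<0. h x = 0)"
    show "h = V"
    proof
      fix x show "h x = V x"
        using h weak_solution_unique[OF \<gamma> V, of h x] H1_L2[OF w] by (cases "x < 0") (auto simp: V_def)
    qed
  qed
  show ?thesis
    by (rule that[of v v1 B]) (use V NV v in \<open>auto simp: V_def\<close>)
qed

section \<open>The first variation of \<open>J\<close>\<close>

text \<open>
  The convexity of the energy of the inhibitor. After the weak equations are inserted, the difference of the two sides is the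
  integral of \<open>- (v0' - v1')\<^sup>2 / 2 - \<gamma> (v0 - v1)\<^sup>2 / 2 + v0^3 v1 - 3/4 v0^4 - 1/4 v1^4\<close>, which is nonpositive by Young's inequality.
\<close>
lemma energy_comparison:
  assumes s: "weak_solution \<gamma> w0 v0" "weak_solution \<gamma> w1 v1" and w: "w0 \<in> L2" "w1 \<in> L2" and \<gamma>: "0 \<le> \<gamma>"
  shows "(1/2 * (\<integral>x. w1 x * v1 x \<partial>hl) + 1/4 * (\<integral>x. v1 x ^ 4 \<partial>hl))
    - (1/2 * (\<integral>x. w0 x * v0 x \<partial>hl) + 1/4 * (\<integral>x. v0 x ^ 4 \<partial>hl))
    \<le> (\<integral>x. w1 x * v1 x \<partial>hl) - (\<integral>x. w0 x * v1 x \<partial>hl)"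
proof -
  have v: "v0 \<in> H1" "v1 \<in> H1" using s by (auto simp: weak_solution_def)
  note L = H1_L2[OF v(1)] H1_L2[OF v(2)] and P = H1_wderiv(1)[OF v(1)] H1_wderiv(1)[OF v(2)]
    and C = H1_cube_L2[OF v(1)] H1_cube_L2[OF v(2)]
  note t = weak_solution_tested[OF s(1) w(1) v(1)] weak_solution_tested[OF s(2) w(2) v(2)]
    weak_solution_tested[OF s(1) w(1) v(2)]
  have q: "a ^ 3 * a = a ^ 4" for a :: real by (simp add: power_numeral_reduce)
  note i = L2_mult_integrable[OF P(1) P(1)] L2_mult_integrable[OF P(2) P(2)] L2_mult_integrable[OF P(1) P(2)]
    L2_mult_integrable[OF L(1) L(1)] L2_mult_integrable[OF L(2) L(2)] L2_mult_integrable[OF L(1) L(2)]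
    L2_mult_integrable[OF C(1) L(1), unfolded q] L2_mult_integrable[OF C(2) L(2), unfolded q] L2_mult_integrable[OF C(1) L(2)]
  let ?p0 = "wderiv v0" and ?p1 = "wderiv v1"
  let ?k = "\<lambda>x. - (1/2) * (?p0 x * ?p0 x) - (1/2) * (?p1 x * ?p1 x) + ?p0 x * ?p1 x
    - \<gamma>/2 * (v0 x * v0 x) - \<gamma>/2 * (v1 x * v1 x) + \<gamma> * (v0 x * v1 x)
    - (3/4) * v0 x ^ 4 - (1/4) * v1 x ^ 4 + v0 x ^ 3 * v1 x"
  have "(\<integral>x. ?k x \<partial>hl) \<le> (\<integral>x. 0 \<partial>hl)"
  proof (rule hl_mono)
    fix x :: real
    have e: "?k x = - (1/2) * (?p0 x - ?p1 x)\<^sup>2 - (1/2) * (\<gamma> * (v0 x - v1 x)\<^sup>2)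
        + (v0 x ^ 3 * v1 x - ((3/4) * v0 x ^ 4 + (1/4) * v1 x ^ 4))"
      by (simp add: power2_eq_square algebra_simps)
    have "0 \<le> (?p0 x - ?p1 x)\<^sup>2" "0 \<le> \<gamma> * (v0 x - v1 x)\<^sup>2" using \<gamma> by auto
    moreover have p4: "b ^ 3 * a \<le> (3/4) * b ^ 4 + (1/4) * a ^ 4" for a b :: real
    proof -
      have "0 \<le> (a\<^sup>2 - b\<^sup>2)\<^sup>2 + 2 * b\<^sup>2 * (a - b)\<^sup>2" by simp
      then show ?thesis by (simp add: power2_eq_square power_numeral_reduce algebra_simps)
    qed
    ultimately show "?k x \<le> 0" unfolding e using p4[of "v0 x" "v1 x"] by linarith
  qed (use i in auto)
  then have "- (1/2) * (\<integral>x. ?p0 x * ?p0 x \<partial>hl) - (1/2) * (\<integral>x. ?p1 x * ?p1 x \<partial>hl) + (\<integral>x. ?p0 x * ?p1 x \<partial>hl)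
    - \<gamma>/2 * (\<integral>x. v0 x * v0 x \<partial>hl) - \<gamma>/2 * (\<integral>x. v1 x * v1 x \<partial>hl) + \<gamma> * (\<integral>x. v0 x * v1 x \<partial>hl)
    - (3/4) * (\<integral>x. v0 x ^ 4 \<partial>hl) - (1/4) * (\<integral>x. v1 x ^ 4 \<partial>hl) + (\<integral>x. v0 x ^ 3 * v1 x \<partial>hl) \<le> 0"
    using i by simp
  then show ?thesis using t unfolding q by (simp add: algebra_simps)
qed

lemma F_factored: "F \<beta> \<xi> = \<xi> * (\<xi> * (\<xi>\<^sup>2 / 4 - (1 + \<beta>) * \<xi> / 3 + \<beta> / 2))"
  by (simp add: F_eq power2_eq_square power3_eq_cube power_numeral_reduce algebra_simps)

lemma f_L2: assumes "w \<in> H1" shows "(\<lambda>x. f \<beta> (w x)) \<in> L2"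
proof -
  have "(\<lambda>x. (- \<beta>) * w x + ((1 + \<beta>) * (w x * w x) + (-1) * w x ^ 3)) \<in> L2"
    by (intro L2_add L2_scale H1_mult_bounded_L2 H1_cube_L2 H1_L2 assms)
  then show ?thesis
    by (rule back_subst[of "\<lambda>h. h \<in> L2"]) (auto simp: f_def power3_eq_cube algebra_simps)
qed

lemma F_integrable: assumes "w \<in> H1" shows "integrable hl (\<lambda>x. F \<beta> (w x))"
proof -
  have "(\<lambda>x. (1/4) * w x ^ 3 + ((- (1 + \<beta>) / 3) * (w x * w x) + (\<beta> / 2) * w x)) \<in> L2"
    by (intro L2_add L2_scale H1_cube_L2 H1_mult_bounded_L2 H1_L2 assms)
  from L2_mult_integrable[OF H1_L2[OF assms] this]
  show ?thesis
    by (rule back_subst[of "integrable hl"])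
      (auto simp: F_eq power2_eq_square power3_eq_cube power_numeral_reduce field_simps)
qed

text \<open>
  Taylor's formula for the quartic \<^const>\<open>F\<close>, with a crude bound for the remainder.
\<close>
lemma F_quadratic_bound:
  assumes "\<bar>\<xi>\<bar> \<le> B" "\<bar>h\<bar> \<le> 1"
  shows "F \<beta> (\<xi> + h) \<le> F \<beta> \<xi> - f \<beta> \<xi> * h + (3 * B\<^sup>2 + 3 * (1 + \<bar>\<beta>\<bar>) * (B + 1) + 1) * h\<^sup>2"
proof -
  let ?r = "(3 * \<xi>\<^sup>2 - 2 * (1 + \<beta>) * \<xi> + \<beta>) / 2 + (6 * \<xi> - 2 * (1 + \<beta>)) / 6 * h + h\<^sup>2 / 4"
  have e: "F \<beta> (\<xi> + h) = F \<beta> \<xi> - f \<beta> \<xi> * h + ?r * h\<^sup>2"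
    by (simp add: F_eq f_def power2_eq_square power3_eq_cube power_numeral_reduce field_simps)
  have B: "0 \<le> B" using assms by linarith
  have a: "\<xi>\<^sup>2 \<le> B\<^sup>2" "h\<^sup>2 \<le> 1"
    using assms by (auto simp: abs_le_square_iff[symmetric] abs_square_le_1)
  have b: "\<bar>(1 + \<beta>) * \<xi>\<bar> \<le> (1 + \<bar>\<beta>\<bar>) * B"
    unfolding abs_mult using assms by (intro mult_mono) auto
  have c: "\<bar>\<xi> * h\<bar> \<le> B * 1" unfolding abs_mult using assms B by (intro mult_mono) auto
  have d: "\<bar>(1 + \<beta>) * h\<bar> \<le> (1 + \<bar>\<beta>\<bar>) * 1"
    unfolding abs_mult using assms by (intro mult_mono) auto
  have g: "0 \<le> \<bar>\<beta>\<bar> * B" using B by simp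
  have "?r = 3 / 2 * \<xi>\<^sup>2 - (1 + \<beta>) * \<xi> + \<beta> / 2 + \<xi> * h - (1 + \<beta>) * h / 3 + h\<^sup>2 / 4"
    by (simp add: field_simps)
  also have "\<dots> \<le> 3 * B\<^sup>2 + 3 * (1 + \<bar>\<beta>\<bar>) * (B + 1) + 1"
  proof -
    have x: "3 * (1 + \<bar>\<beta>\<bar>) * (B + 1) = 3 * B + 3 + 3 * (\<bar>\<beta>\<bar> * B) + 3 * \<bar>\<beta>\<bar>" by (simp add: algebra_simps)
    have y: "(1 + \<bar>\<beta>\<bar>) * B = B + \<bar>\<beta>\<bar> * B" by (simp add: algebra_simps)
    have z: "0 \<le> B\<^sup>2" by simp
    have b': "- ((1 + \<beta>) * \<xi>) \<le> B + \<bar>\<beta>\<bar> * B" using b unfolding y by linarith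
    have d': "- ((1 + \<beta>) * h / 3) \<le> (1 + \<bar>\<beta>\<bar>) / 3" using d by linarith
    have c': "\<xi> * h \<le> B" using c by linarith
    have a': "3 / 2 * \<xi>\<^sup>2 \<le> 3 / 2 * B\<^sup>2" using a by simp
    have gen: "X - P + b / 2 + Q - R + T / 4 \<le> 3 * B2 + (3 * B + 3 + 3 * mB + 3 * m) + 1"
      if "X \<le> 3 / 2 * B2" "- P \<le> B + mB" "Q \<le> B" "- R \<le> (1 + m) / 3" "T \<le> 1" "0 \<le> mB" "0 \<le> B" "0 \<le> B2" "b \<le> m" "0 \<le> m"
      for X P b Q R T B2 mB m B :: real
      using that by (simp add: field_simps)
    show ?thesis unfolding x by (rule gen[OF a' b' c' d' a(2) g B z abs_ge_self abs_ge_zero])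
  qed
  finally have "?r * h\<^sup>2 \<le> (3 * B\<^sup>2 + 3 * (1 + \<bar>\<beta>\<bar>) * (B + 1) + 1) * h\<^sup>2" by (intro mult_right_mono) auto
  with e show ?thesis by linarith
qed

lemma N_weak_solution: "\<gamma> > 0 \<Longrightarrow> w \<in> H1 \<Longrightarrow> weak_solution \<gamma> w (N \<gamma> w)"
  using N_classical by metis

lemma N_H1: "\<gamma> > 0 \<Longrightarrow> w \<in> H1 \<Longrightarrow> N \<gamma> w \<in> H1"
  using N_weak_solution by (auto simp: weak_solution_def)

lemma power4_integrable: assumes "v \<in> H1" shows "integrable hl (\<lambda>x. v x ^ 4)"
  using L2_mult_integrable[OF H1_cube_L2[OF assms] H1_L2[OF assms]] by (simp add: power_numeral_reduce mult.assoc)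

lemma J_expand:
  assumes "\<gamma> > 0" "w \<in> H1"
  shows "J \<beta> \<gamma> d w = d / 2 * (\<integral>x. (wderiv w x)\<^sup>2 \<partial>hl) + (\<integral>x. F \<beta> (w x) \<partial>hl)
    + (1/2 * (\<integral>x. w x * N \<gamma> w x \<partial>hl) + 1/4 * (\<integral>x. N \<gamma> w x ^ 4 \<partial>hl))"
proof -
  note i = L2_square_integrable[OF H1_wderiv(1)[OF assms(2)]] F_integrable[OF assms(2)]
    L2_mult_integrable[OF H1_L2[OF assms(2)] H1_L2[OF N_H1[OF assms]]] power4_integrable[OF N_H1[OF assms]]
  have "J \<beta> \<gamma> d w = (\<integral>x. d / 2 * (wderiv w x)\<^sup>2 + 1 / 2 * (w x * N \<gamma> w x) + F \<beta> (w x) + 1 / 4 * (N \<gamma> w x) ^ 4 \<partial>hl)"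
    by (simp add: J_def hl_integral_eq mult.assoc)
  also have "\<dots> = d / 2 * (\<integral>x. (wderiv w x)\<^sup>2 \<partial>hl) + 1/2 * (\<integral>x. w x * N \<gamma> w x \<partial>hl) + (\<integral>x. F \<beta> (w x) \<partial>hl)
     + 1/4 * (\<integral>x. N \<gamma> w x ^ 4 \<partial>hl)"
    using i by simp
  finally show ?thesis by simp
qed

text \<open>
  Every term of \<open>J\<close> is estimated from above by its linearization plus a multiple of \<open>\<epsilon>\<^sup>2\<close>. For the inhibitor the linear term is
  \<open>\<epsilon> \<integral> N (w + \<epsilon> \<phi>) \<phi>\<close>; monotonicity of \<^const>\<open>N\<close> replaces \<open>N (w + \<epsilon> \<phi>)\<close> by \<open>N w\<close> at the price of \<open>\<epsilon>\<^sup>2 / \<gamma> \<integral> \<phi>\<^sup>2\<close>.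
\<close>
lemma J_perturbation_bound:
  assumes \<gamma>: "\<gamma> > 0" and d: "0 \<le> d" and w: "w \<in> H1" and \<phi>: "\<phi> \<in> H1" and \<phi>1: "\<And>x. 0 \<le> x \<Longrightarrow> \<bar>\<phi> x\<bar> \<le> 1"
  obtains K where "\<And>\<epsilon>. 0 \<le> \<epsilon> \<Longrightarrow> \<epsilon> \<le> 1 \<Longrightarrow> J \<beta> \<gamma> d (\<lambda>x. w x + \<epsilon> * \<phi> x) \<le> J \<beta> \<gamma> d w
     + \<epsilon> * (d * (\<integral>x. wderiv w x * wderiv \<phi> x \<partial>hl) + (\<integral>x. (N \<gamma> w x - f \<beta> (w x)) * \<phi> x \<partial>hl)) + K * \<epsilon>\<^sup>2"
proof -
  let ?p = "wderiv w" and ?q = "wderiv \<phi>" and ?v = "N \<gamma> w"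
  obtain B where B: "0 \<le> B" "\<And>x. 0 \<le> x \<Longrightarrow> \<bar>w x\<bar> \<le> B" using H1_bounded[OF w] by metis
  define C where "C = 3 * B\<^sup>2 + 3 * (1 + \<bar>\<beta>\<bar>) * (B + 1) + 1"
  define K where "K = d / 2 * (\<integral>x. ?q x * ?q x \<partial>hl) + C * (\<integral>x. (\<phi> x)\<^sup>2 \<partial>hl) + 1 / \<gamma> * (\<integral>x. (\<phi> x)\<^sup>2 \<partial>hl)"
  note Lw = H1_L2[OF w] and L\<phi> = H1_L2[OF \<phi>] and Lp = H1_wderiv(1)[OF w] and Lq = H1_wderiv(1)[OF \<phi>]
    and Lv = H1_L2[OF N_H1[OF \<gamma> w]] and Lf = f_L2[OF w, of \<beta>]
  note i = L2_mult_integrable[OF Lp Lp] L2_mult_integrable[OF Lp Lq] L2_mult_integrable[OF Lq Lq]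
    L2_mult_integrable[OF Lv L\<phi>] L2_mult_integrable[OF Lf L\<phi>] L2_square_integrable[OF L\<phi>] F_integrable[OF w, of \<beta>]
  show ?thesis
  proof (rule that[of K])
    fix \<epsilon> :: real assume \<epsilon>: "0 \<le> \<epsilon>" "\<epsilon> \<le> 1"
    define h where "h = (\<lambda>x. w x + \<epsilon> * \<phi> x)"
    have h: "h \<in> H1" "AE x in hl. wderiv h x = ?p x + \<epsilon> * ?q x"
      using H1_add_scale[OF w \<phi>, of \<epsilon>] by (auto simp: h_def)
    let ?u = "N \<gamma> h"
    note Lh = H1_L2[OF h(1)] and Lu = H1_L2[OF N_H1[OF \<gamma> h(1)]] and Lr = H1_wderiv(1)[OF h(1)]
    have grad: "(\<integral>x. (wderiv h x)\<^sup>2 \<partial>hl) = (\<integral>x. ?p x * ?p x \<partial>hl) + 2 * \<epsilon> * (\<integral>x. ?p x * ?q x \<partial>hl) + \<epsilon>\<^sup>2 * (\<integral>x. ?q x * ?q x \<partial>hl)"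
    proof -
      have "(\<integral>x. (wderiv h x)\<^sup>2 \<partial>hl) = (\<integral>x. ?p x * ?p x + 2 * \<epsilon> * (?p x * ?q x) + \<epsilon>\<^sup>2 * (?q x * ?q x) \<partial>hl)"
      proof (rule integral_cong_AE)
        show "(\<lambda>x. (wderiv h x)\<^sup>2) \<in> borel_measurable hl" using L2_measurable[OF Lr] by measurable
        show "(\<lambda>x. ?p x * ?p x + 2 * \<epsilon> * (?p x * ?q x) + \<epsilon>\<^sup>2 * (?q x * ?q x)) \<in> borel_measurable hl"
          using L2_measurable[OF Lp] L2_measurable[OF Lq] by measurable
        show "AE x in hl. (wderiv h x)\<^sup>2 = ?p x * ?p x + 2 * \<epsilon> * (?p x * ?q x) + \<epsilon>\<^sup>2 * (?q x * ?q x)"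
          using h(2) by eventually_elim (simp add: power2_eq_square algebra_simps)
      qed
      then show ?thesis using i by simp
    qed
    have pot: "(\<integral>x. F \<beta> (h x) \<partial>hl) \<le> (\<integral>x. F \<beta> (w x) \<partial>hl) - \<epsilon> * (\<integral>x. f \<beta> (w x) * \<phi> x \<partial>hl) + C * \<epsilon>\<^sup>2 * (\<integral>x. (\<phi> x)\<^sup>2 \<partial>hl)"
    proof -
      have "(\<integral>x. F \<beta> (h x) \<partial>hl) \<le> (\<integral>x. F \<beta> (w x) - \<epsilon> * (f \<beta> (w x) * \<phi> x) + C * \<epsilon>\<^sup>2 * (\<phi> x)\<^sup>2 \<partial>hl)"
      proof (rule hl_mono)
        fix x :: real assume x: "0 < x"
        have "\<bar>\<epsilon> * \<phi> x\<bar> \<le> 1 * 1" unfolding abs_mult using \<epsilon> \<phi>1[of x] x by (intro mult_mono) auto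
        then show "F \<beta> (h x) \<le> F \<beta> (w x) - \<epsilon> * (f \<beta> (w x) * \<phi> x) + C * \<epsilon>\<^sup>2 * (\<phi> x)\<^sup>2"
          using F_quadratic_bound[of "w x" B "\<epsilon> * \<phi> x" \<beta>] B(2)[of x] x
          by (simp add: h_def C_def power_mult_distrib mult_ac)
      qed (use i F_integrable[OF h(1)] in auto)
      then show ?thesis using i by simp
    qed
    have dual: "(1/2 * (\<integral>x. h x * ?u x \<partial>hl) + 1/4 * (\<integral>x. ?u x ^ 4 \<partial>hl))
       - (1/2 * (\<integral>x. w x * ?v x \<partial>hl) + 1/4 * (\<integral>x. ?v x ^ 4 \<partial>hl)) \<le> \<epsilon> * (\<integral>x. ?v x * \<phi> x \<partial>hl) + \<epsilon>\<^sup>2 / \<gamma> * (\<integral>x. (\<phi> x)\<^sup>2 \<partial>hl)"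
    proof -
      note s = N_weak_solution[OF \<gamma> w] N_weak_solution[OF \<gamma> h(1)]
      have LD: "(\<lambda>x. ?u x - ?v x) \<in> L2" by (intro L2_diff Lu Lv)
      note j = L2_mult_integrable[OF Lh Lu] L2_mult_integrable[OF Lw Lu] L2_mult_integrable[OF Lu L\<phi>]
        L2_square_integrable[OF LD] L2_mult_integrable[OF L\<phi> LD]
      have 1: "(\<integral>x. h x * ?u x \<partial>hl) - (\<integral>x. w x * ?u x \<partial>hl) = \<epsilon> * (\<integral>x. ?u x * \<phi> x \<partial>hl)"
      proof -
        have "(\<integral>x. h x * ?u x \<partial>hl) - (\<integral>x. w x * ?u x \<partial>hl) = (\<integral>x. h x * ?u x - w x * ?u x \<partial>hl)" using j by simp
        also have "\<dots> = (\<integral>x. \<epsilon> * (?u x * \<phi> x) \<partial>hl)" by (simp add: h_def algebra_simps)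
        finally show ?thesis by simp
      qed
      have 2: "(\<integral>x. ?u x * \<phi> x \<partial>hl) = (\<integral>x. ?v x * \<phi> x \<partial>hl) + (\<integral>x. \<phi> x * (?u x - ?v x) \<partial>hl)"
      proof -
        have "(\<integral>x. ?v x * \<phi> x \<partial>hl) + (\<integral>x. \<phi> x * (?u x - ?v x) \<partial>hl) = (\<integral>x. ?v x * \<phi> x + \<phi> x * (?u x - ?v x) \<partial>hl)"
          using j i by simp
        then show ?thesis by (simp add: algebra_simps)
      qed
      have "\<gamma> * (\<integral>x. (?u x - ?v x)\<^sup>2 \<partial>hl) \<le> (\<integral>x. (h x - w x) * (?u x - ?v x) \<partial>hl)"
        by (rule weak_solution_monotone[OF s Lw Lh])
      also have "\<dots> = \<epsilon> * (\<integral>x. \<phi> x * (?u x - ?v x) \<partial>hl)"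
        by (simp add: h_def mult.assoc)
      finally have 3: "\<gamma> * (\<integral>x. (?u x - ?v x)\<^sup>2 \<partial>hl) \<le> \<epsilon> * (\<integral>x. \<phi> x * (?u x - ?v x) \<partial>hl)" .
      have "(\<integral>x. \<epsilon> * (\<phi> x * (?u x - ?v x)) \<partial>hl) \<le> (\<integral>x. \<gamma> / 2 * (?u x - ?v x)\<^sup>2 + \<epsilon>\<^sup>2 / (2 * \<gamma>) * (\<phi> x)\<^sup>2 \<partial>hl)"
      proof (rule hl_mono)
        fix x :: real
        \<comment> \<open>Young's inequality; half of the left-hand side is then absorbed by monotonicity.\<close>
        have "0 \<le> (\<gamma> * (?u x - ?v x) - \<epsilon> * \<phi> x)\<^sup>2" by simp
        then have "(\<epsilon> * (\<phi> x * (?u x - ?v x))) * (2 * \<gamma>) \<le> \<gamma> * (\<gamma> * (?u x - ?v x)\<^sup>2) + \<epsilon>\<^sup>2 * (\<phi> x)\<^sup>2"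
          by (simp add: power2_eq_square algebra_simps)
        then show "\<epsilon> * (\<phi> x * (?u x - ?v x)) \<le> \<gamma> / 2 * (?u x - ?v x)\<^sup>2 + \<epsilon>\<^sup>2 / (2 * \<gamma>) * (\<phi> x)\<^sup>2"
          using \<gamma> by (simp add: field_simps)
      qed (use j i in auto)
      then have 4: "\<epsilon> * (\<integral>x. \<phi> x * (?u x - ?v x) \<partial>hl) \<le> \<gamma> / 2 * (\<integral>x. (?u x - ?v x)\<^sup>2 \<partial>hl) + \<epsilon>\<^sup>2 / (2 * \<gamma>) * (\<integral>x. (\<phi> x)\<^sup>2 \<partial>hl)"
        using j i by simp
      have 5: "2 * (\<epsilon>\<^sup>2 / (2 * \<gamma>) * (\<integral>x. (\<phi> x)\<^sup>2 \<partial>hl)) = \<epsilon>\<^sup>2 / \<gamma> * (\<integral>x. (\<phi> x)\<^sup>2 \<partial>hl)" by simp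
      have "\<epsilon> * (\<integral>x. \<phi> x * (?u x - ?v x) \<partial>hl) \<le> \<epsilon>\<^sup>2 / \<gamma> * (\<integral>x. (\<phi> x)\<^sup>2 \<partial>hl)"
        using 3 4 unfolding 5[symmetric] by linarith
      then show ?thesis
        using energy_comparison[OF s Lw Lh] \<gamma> 1 unfolding 2 distrib_left by linarith
    qed
    have vf: "(\<integral>x. (?v x - f \<beta> (w x)) * \<phi> x \<partial>hl) = (\<integral>x. ?v x * \<phi> x \<partial>hl) - (\<integral>x. f \<beta> (w x) * \<phi> x \<partial>hl)"
      using i by (simp add: left_diff_distrib)
    have g2: "d / 2 * (\<integral>x. (wderiv h x)\<^sup>2 \<partial>hl) = d / 2 * (\<integral>x. (?p x)\<^sup>2 \<partial>hl)
        + \<epsilon> * (d * (\<integral>x. ?p x * ?q x \<partial>hl)) + d / 2 * (\<integral>x. ?q x * ?q x \<partial>hl) * \<epsilon>\<^sup>2"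
      unfolding grad by (simp add: power2_eq_square algebra_simps)
    show "J \<beta> \<gamma> d (\<lambda>x. w x + \<epsilon> * \<phi> x) \<le> J \<beta> \<gamma> d w
     + \<epsilon> * (d * (\<integral>x. ?p x * ?q x \<partial>hl) + (\<integral>x. (?v x - f \<beta> (w x)) * \<phi> x \<partial>hl)) + K * \<epsilon>\<^sup>2"
    proof -
      have K: "K * \<epsilon>\<^sup>2 = d / 2 * (\<integral>x. ?q x * ?q x \<partial>hl) * \<epsilon>\<^sup>2 + C * \<epsilon>\<^sup>2 * (\<integral>x. (\<phi> x)\<^sup>2 \<partial>hl) + \<epsilon>\<^sup>2 / \<gamma> * (\<integral>x. (\<phi> x)\<^sup>2 \<partial>hl)"
        by (simp add: K_def algebra_simps)
      show ?thesis
        using dual pot g2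
        unfolding h_def[symmetric] J_expand[OF \<gamma> h(1)] J_expand[OF \<gamma> w] vf K distrib_left right_diff_distrib
        by linarith
    qed
  qed
qed

lemma first_variation_nonneg:
  assumes \<gamma>: "\<gamma> > 0" and d: "0 \<le> d" and w: "w \<in> H1" and \<phi>: "\<phi> \<in> H1" and \<phi>1: "\<And>x. 0 \<le> x \<Longrightarrow> \<bar>\<phi> x\<bar> \<le> 1"
    and \<epsilon>0: "\<epsilon>0 > 0" and min: "\<And>\<epsilon>. 0 < \<epsilon> \<Longrightarrow> \<epsilon> < \<epsilon>0 \<Longrightarrow> J \<beta> \<gamma> d w \<le> J \<beta> \<gamma> d (\<lambda>x. w x + \<epsilon> * \<phi> x)"
  shows "0 \<le> d * (\<integral>x. wderiv w x * wderiv \<phi> x \<partial>hl) + (\<integral>x. (N \<gamma> w x - f \<beta> (w x)) * \<phi> x \<partial>hl)" (is "0 \<le> ?L")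
proof (rule ccontr)
  define L where "L = ?L"
  assume "\<not> 0 \<le> ?L"
  then have neg: "L < 0" by (simp add: L_def)
  obtain K where K: "\<And>\<epsilon>. 0 \<le> \<epsilon> \<Longrightarrow> \<epsilon> \<le> 1 \<Longrightarrow> J \<beta> \<gamma> d (\<lambda>x. w x + \<epsilon> * \<phi> x) \<le> J \<beta> \<gamma> d w + \<epsilon> * L + K * \<epsilon>\<^sup>2"
    unfolding L_def by (rule J_perturbation_bound[OF \<gamma> d w \<phi> \<phi>1]) blast+
  define c where "c = - L / (2 * (\<bar>K\<bar> + 1))"
  define \<epsilon> where "\<epsilon> = min (min 1 (\<epsilon>0 / 2)) c"
  have "c > 0" unfolding c_def using neg by (intro divide_pos_pos) auto
  then have \<epsilon>: "0 < \<epsilon>" "\<epsilon> \<le> 1" "\<epsilon> < \<epsilon>0" "\<epsilon> \<le> c"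
    using \<epsilon>0 unfolding \<epsilon>_def by auto
  have "\<epsilon> * (\<bar>K\<bar> + 1) \<le> c * (\<bar>K\<bar> + 1)"
    using \<epsilon> by (intro mult_right_mono) auto
  also have "\<dots> = - L / 2"
  proof -
    have "\<bar>K\<bar> + 1 \<noteq> 0" by linarith
    then show ?thesis unfolding c_def by (simp add: divide_simps)
  qed
  finally have "\<epsilon> * (\<bar>K\<bar> + 1) \<le> - L / 2" .
  moreover have "K * \<epsilon> \<le> \<epsilon> * (\<bar>K\<bar> + 1)" using \<epsilon> by (subst mult.commute) (intro mult_left_mono, auto)
  ultimately have "L + K * \<epsilon> < 0" using neg by linarith
  then have "\<epsilon> * (L + K * \<epsilon>) < 0" using \<epsilon> by (simp add: mult_less_0_iff)
  then show False
    using K[of \<epsilon>] min[of \<epsilon>] \<epsilon> by (simp add: power2_eq_square algebra_simps)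
qed

section \<open>Extrema and hat functions\<close>

text \<open>
  The function \<open>h1\<close> is required to be the derivative of \<open>h\<close> near \<open>m\<close>, but to be differentiable only at \<open>m\<close> itself.
\<close>
lemma second_derivative_at_max:
  fixes h h1 :: "real \<Rightarrow> real"
  assumes e: "e > 0" and d: "\<And>t. \<bar>t - m\<bar> < e \<Longrightarrow> (h has_real_derivative h1 t) (at t)"
    and max: "\<And>t. \<bar>t - m\<bar> < e \<Longrightarrow> h t \<le> h m" and d2: "(h1 has_real_derivative c) (at m)"
  shows "h1 m = 0" "c \<le> 0"
proof -
  show z: "h1 m = 0"
    by (rule DERIV_local_max[OF d e]) (use e max in \<open>auto simp: abs_minus_commute\<close>)
  show "c \<le> 0"
  proof (rule ccontr)
    assume "\<not> c \<le> 0"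
    then have "c > 0" by simp
    from DERIV_pos_inc_right[OF d2 this] obtain s where s: "s > 0" "\<And>k. 0 < k \<Longrightarrow> k < s \<Longrightarrow> h1 m < h1 (m + k)"
      by auto
    define t where "t = m + min s e / 2"
    have t: "m < t" "t < m + s" "t < m + e" using s e by (auto simp: t_def)
    have "h m < h t"
    proof (rule DERIV_pos_imp_increasing_open[OF t(1)])
      fix x assume x: "m < x" "x < t"
      then show "\<exists>y. (h has_real_derivative y) (at x) \<and> 0 < y"
      proof (intro exI conjI)
        show "(h has_real_derivative h1 x) (at x)" by (rule d) (use x t in linarith)
        have "h1 m < h1 (m + (x - m))" by (rule s(2)) (use x t in linarith)+
        then show "0 < h1 x" using z by simp
      qed
    next
      show "continuous_on {m..t} h"
      proof (rule DERIV_continuous_on, rule has_field_derivative_at_within)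
        fix x assume "x \<in> {m..t}"
        then show "(h has_real_derivative h1 x) (at x)" using t e by (intro d) auto
      qed
    qed
    then show False using max[of t] t by simp
  qed
qed

lemma second_derivative_at_min:
  fixes h h1 :: "real \<Rightarrow> real"
  assumes e: "e > 0" and d: "\<And>t. \<bar>t - m\<bar> < e \<Longrightarrow> (h has_real_derivative h1 t) (at t)"
    and min: "\<And>t. \<bar>t - m\<bar> < e \<Longrightarrow> h m \<le> h t" and d2: "(h1 has_real_derivative c) (at m)"
  shows "h1 m = 0" "0 \<le> c"
proof -
  have "- h1 m = 0" "- c \<le> 0"
    using second_derivative_at_max[of e m "\<lambda>t. - h t" "\<lambda>t. - h1 t" "- c"] e d min d2
    by (auto intro: DERIV_minus)
  then show "h1 m = 0" "0 \<le> c" by auto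
qed

lemma decaying_attains_max:
  fixes h :: "real \<Rightarrow> real"
  assumes c: "continuous_on {a..} h" and 0: "(h \<longlongrightarrow> 0) at_top" and q: "a \<le> q" "0 < h q"
  obtains m where "a \<le> m" "\<And>x. a \<le> x \<Longrightarrow> h x \<le> h m" "h q \<le> h m"
proof -
  have "\<forall>\<^sub>F x in at_top. h x < h q" by (rule order_tendstoD(2)[OF 0 q(2)])
  then obtain X where X: "\<And>x. X \<le> x \<Longrightarrow> h x < h q" by (auto simp: eventually_at_top_linorder)
  define Y where "Y = max X q"
  have "continuous_on {a..Y} h" using c by (rule continuous_on_subset) auto
  moreover have "{a..Y} \<noteq> {}" using q by (auto simp: Y_def)
  ultimately obtain m where m: "m \<in> {a..Y}" "\<And>x. x \<in> {a..Y} \<Longrightarrow> h x \<le> h m"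
    using continuous_attains_sup[of "{a..Y}" h] by auto
  have qm: "h q \<le> h m" using m(2)[of q] q by (auto simp: Y_def)
  have "h x \<le> h m" if "a \<le> x" for x
  proof (cases "x \<le> Y")
    case True
    then show ?thesis using m(2)[of x] that by auto
  next
    case False
    then have "h x < h q" by (intro X) (simp add: Y_def)
    then show ?thesis using qm by linarith
  qed
  with that[of m] m qm show ?thesis by auto
qed

lemma decaying_attains_min:
  fixes h :: "real \<Rightarrow> real"
  assumes c: "continuous_on {a..} h" and 0: "(h \<longlongrightarrow> 0) at_top" and q: "a \<le> q" "h q < 0"
  obtains m where "a \<le> m" "\<And>x. a \<le> x \<Longrightarrow> h m \<le> h x" "h m \<le> h q"
proof -
  have "continuous_on {a..} (\<lambda>x. - h x)" "((\<lambda>x. - h x) \<longlongrightarrow> 0) at_top"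
    using c tendsto_minus[OF 0] by (auto intro: continuous_intros)
  from decaying_attains_max[OF this q(1)] q obtain m where "a \<le> m" "\<And>x. a \<le> x \<Longrightarrow> - h x \<le> - h m" "- h q \<le> - h m"
    by (metis neg_0_less_iff_less)
  with that[of m] show ?thesis by simp
qed

lemma continuous_antiderivative:
  fixes g :: "real \<Rightarrow> real"
  assumes g: "continuous_on UNIV g"
  shows "((\<lambda>x. LBINT t=0..x. g t) has_real_derivative g x) (at x)"
proof -
  have "((\<lambda>x. LBINT t=ereal 0..ereal x. g t) has_vector_derivative g x) (at x within {- \<bar>x\<bar> - 1..\<bar>x\<bar> + 1})"
    by (rule interval_integral_FTC2) (auto intro: continuous_on_subset[OF g])
  moreover have "at x within {- \<bar>x\<bar> - 1..\<bar>x\<bar> + 1} = at x"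
    by (rule at_within_Icc_at) auto
  ultimately show ?thesis by (simp add: has_real_derivative_iff_has_vector_derivative zero_ereal_def)
qed

definition hat :: "real \<Rightarrow> real \<Rightarrow> real \<Rightarrow> real \<Rightarrow> real" where
  "hat a y b x = max 0 (min ((x - a) / (y - a)) ((b - x) / (b - y)))"

definition hat_slope :: "real \<Rightarrow> real \<Rightarrow> real \<Rightarrow> real \<Rightarrow> real" where
  "hat_slope a y b x = indicator {a<..y} x / (y - a) - indicator {y<..b} x / (b - y)"

lemma hat_left: "a < y \<Longrightarrow> y < b \<Longrightarrow> a \<le> x \<Longrightarrow> x \<le> y \<Longrightarrow> hat a y b x = (x - a) / (y - a)"
proof -
  assume *: "a < y" "y < b" "a \<le> x" "x \<le> y"
  then have "(x - a) / (y - a) \<le> 1" "1 \<le> (b - x) / (b - y)" "0 \<le> (x - a) / (y - a)" by auto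
  then show ?thesis by (simp add: hat_def)
qed

lemma hat_right: "a < y \<Longrightarrow> y < b \<Longrightarrow> y \<le> x \<Longrightarrow> x \<le> b \<Longrightarrow> hat a y b x = (b - x) / (b - y)"
proof -
  assume *: "a < y" "y < b" "y \<le> x" "x \<le> b"
  then have "1 \<le> (x - a) / (y - a)" "(b - x) / (b - y) \<le> 1" "0 \<le> (b - x) / (b - y)" by auto
  then show ?thesis by (simp add: hat_def)
qed

lemma hat_outside: "a < y \<Longrightarrow> y < b \<Longrightarrow> x \<le> a \<or> b \<le> x \<Longrightarrow> hat a y b x = 0"
proof -
  assume *: "a < y" "y < b" "x \<le> a \<or> b \<le> x"
  then have "(x - a) / (y - a) \<le> 0 \<or> (b - x) / (b - y) \<le> 0" by (auto simp: divide_le_0_iff)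
  then show ?thesis by (auto simp: hat_def)
qed

lemma hat_bounds: assumes "a < y" "y < b" shows "0 \<le> hat a y b x" "hat a y b x \<le> 1"
proof -
  show "0 \<le> hat a y b x" by (simp add: hat_def)
  have "(x - a) / (y - a) \<le> 1 \<or> (b - x) / (b - y) \<le> 1" using assms by auto
  then show "hat a y b x \<le> 1" by (auto simp: hat_def min_le_iff_disj)
qed

lemma hat_peak: "a < y \<Longrightarrow> y < b \<Longrightarrow> hat a y b y = 1"
  by (simp add: hat_left)

lemma continuous_hat: "a < y \<Longrightarrow> y < b \<Longrightarrow> continuous_on A (hat a y b)"
  unfolding hat_def by (intro continuous_intros) auto

lemma hat_H1:
  assumes "a < y" "y < b"
  shows "hat a y b \<in> H1" "hat_slope a y b \<in> L2" "has_weak_deriv (hat a y b) (hat_slope a y b)"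
proof -
  have c: "continuous_on A (hat a y b)" for A using assms by (rule continuous_hat)
  show L: "hat_slope a y b \<in> L2"
  proof (rule L2_bounded_support[where C="1 / (y - a) + 1 / (b - y)" and b=b])
    show "hat_slope a y b \<in> borel_measurable hl" unfolding hat_slope_def by measurable
    show "\<bar>hat_slope a y b x\<bar> \<le> 1 / (y - a) + 1 / (b - y)" for x
    proof -
      have "0 < 1 / (y - a)" "0 < 1 / (b - y)" using assms by auto
      then show ?thesis by (auto simp: hat_slope_def indicator_def)
    qed
    show "hat_slope a y b x = 0" if "b < x" for x using that assms by (auto simp: hat_slope_def)
  qed
  show wd: "has_weak_deriv (hat a y b) (hat_slope a y b)"
  proof (rule piecewise_C1_weak_deriv[where S="{a, y, b}", OF c _ _ L])
    fix x assume "0 < x" "x \<notin> {a, y, b}"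
    then consider "x < a" | "a < x" "x < y" | "y < x" "x < b" | "b < x" by fastforce
    then show "(hat a y b has_real_derivative hat_slope a y b x) (at x)"
    proof cases
      case 1
      have "((\<lambda>x. 0) has_real_derivative hat_slope a y b x) (at x)" using 1 assms by (auto simp: hat_slope_def)
      then show ?thesis
        by (rule has_field_derivative_transform_within_open[where S="{..<a}"]) (use 1 assms hat_outside in auto)
    next
      case 2
      have "((\<lambda>x. (x - a) / (y - a)) has_real_derivative hat_slope a y b x) (at x)"
        using 2 assms by (auto simp: hat_slope_def intro!: derivative_eq_intros)
      then show ?thesis
        by (rule has_field_derivative_transform_within_open[where S="{a<..<y}"]) (use 2 assms hat_left in auto)
    next
      case 3
      have "((\<lambda>x. (b - x) / (b - y)) has_real_derivative (0 - 1) / (b - y)) (at x)"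
        by (intro DERIV_cdivide DERIV_diff DERIV_const DERIV_ident)
      then have "((\<lambda>x. (b - x) / (b - y)) has_real_derivative hat_slope a y b x) (at x)"
        using 3 assms by (simp add: hat_slope_def)
      then show ?thesis
        by (rule has_field_derivative_transform_within_open[where S="{y<..<b}"]) (use 3 assms hat_right in auto)
    next
      case 4
      have "((\<lambda>x. 0) has_real_derivative hat_slope a y b x) (at x)" using 4 assms by (auto simp: hat_slope_def)
      then show ?thesis
        by (rule has_field_derivative_transform_within_open[where S="{b<..}"]) (use 4 assms hat_outside in auto)
    qed
  qed auto
  show "hat a y b \<in> H1"
    by (rule H1_I[OF c _ L wd]) (rule L2_continuous_support[OF c, where b=b], use assms hat_outside in auto)
qed

text \<open>
  The jump of the secant slope at \<open>y\<close>: nonnegative for convex, zero for affine functions.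
\<close>
definition kink :: "(real \<Rightarrow> real) \<Rightarrow> real \<Rightarrow> real \<Rightarrow> real \<Rightarrow> real" where
  "kink h a y b = (h b - h y) / (b - y) - (h y - h a) / (y - a)"

text \<open>
  Pairing a weak derivative with the slope of a hat only sees the values of the function at the three nodes. A hat with peak at \<open>0\<close>
  has its left half outside the half-line and contributes one slope only.
\<close>
lemma hat_slope_integral:
  assumes g: "\<And>a b. integrable hl (\<lambda>x. g x * indicator {a<..b} x)"
    and h: "\<And>a b. 0 \<le> a \<Longrightarrow> a \<le> b \<Longrightarrow> (\<integral>x. g x * indicator {a<..b} x \<partial>hl) = h b - h a"
  shows "0 \<le> a \<Longrightarrow> a < y \<Longrightarrow> y < b \<Longrightarrow> (\<integral>x. g x * hat_slope a y b x \<partial>hl) = - kink h a y b"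
    "a < 0 \<Longrightarrow> 0 < b \<Longrightarrow> (\<integral>x. g x * hat_slope a 0 b x \<partial>hl) = - ((h b - h 0) / b)"
proof -
  have e: "(\<integral>x. g x * hat_slope a y b x \<partial>hl) = (\<integral>x. g x * indicator {a<..y} x \<partial>hl) / (y - a)
      - (\<integral>x. g x * indicator {y<..b} x \<partial>hl) / (b - y)" for a y b
  proof -
    have "(\<integral>x. g x * hat_slope a y b x \<partial>hl) = (\<integral>x. (g x * indicator {a<..y} x) / (y - a) - (g x * indicator {y<..b} x) / (b - y) \<partial>hl)"
      by (simp add: hat_slope_def right_diff_distrib)
    also have "\<dots> = (\<integral>x. g x * indicator {a<..y} x / (y - a) \<partial>hl) - (\<integral>x. g x * indicator {y<..b} x / (b - y) \<partial>hl)"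
      by (intro Bochner_Integration.integral_diff integrable_divide g)
    finally show ?thesis by simp
  qed
  show "0 \<le> a \<Longrightarrow> a < y \<Longrightarrow> y < b \<Longrightarrow> (\<integral>x. g x * hat_slope a y b x \<partial>hl) = - kink h a y b"
    unfolding e by (simp add: h kink_def)
  have "(\<integral>x. g x * indicator {a<..0} x \<partial>hl) = (\<integral>x. 0 \<partial>hl)" for a
    by (rule hl_cong) auto
  then show "a < 0 \<Longrightarrow> 0 < b \<Longrightarrow> (\<integral>x. g x * hat_slope a 0 b x \<partial>hl) = - ((h b - h 0) / b)"
    unfolding e by (simp add: h)
qed

lemma kink_mvt:
  assumes ab: "a < y" "y < b" and d: "\<And>x. a \<le> x \<Longrightarrow> x \<le> b \<Longrightarrow> (h has_real_derivative h1 x) (at x)"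
  obtains s t where "a < s" "s < y" "y < t" "t < b" "kink h a y b = h1 t - h1 s"
proof -
  obtain s where s: "a < s" "s < y" "h y - h a = (y - a) * h1 s"
    using MVT2[OF ab(1), of h h1] d ab by force
  obtain t where t: "y < t" "t < b" "h b - h y = (b - y) * h1 t"
    using MVT2[OF ab(2), of h h1] d ab by force
  from that[of s t] s t ab show ?thesis by (simp add: kink_def)
qed

section \<open>The minimizer and its variations by hats\<close>

text \<open>
  The minimizer \<open>u\<close> with \<open>v\<close> the even extension of \<open>N u\<close>. Negativity of the energy excludes
  that the first of the three bands is empty.
\<close>
locale pulse =
  fixes \<beta> \<gamma> d M :: real and u v v1 :: "real \<Rightarrow> real"
  assumes \<beta>: "1/3 < \<beta>" "\<beta> < 1/2" and \<gamma>: "0 < \<gamma>" and \<gamma>_less: "\<gamma> < 2 * (\<beta> + F \<beta> \<beta>) - 1/2"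
    and M: "\<And>\<xi>. \<xi> \<le> - M \<Longrightarrow> 1 + 1 / \<gamma> \<le> f \<beta> \<xi>"
    and d: "0 < d" and d_less: "d < \<beta>\<^sup>2 / (4 * (1 + \<beta> * \<gamma>))"
    and adm: "u \<in> admissible \<beta> M"
    and minimal: "\<And>w. w \<in> admissible \<beta> M \<Longrightarrow> J \<beta> \<gamma> d u \<le> J \<beta> \<gamma> d w"
    and negative: "J \<beta> \<gamma> d u < 0"
    and N_eq: "\<And>x. 0 \<le> x \<Longrightarrow> N \<gamma> u x = v x"
    and v_deriv: "\<And>x. (v has_real_derivative v1 x) (at x)"
    and v1_deriv: "\<And>x. (v1 has_real_derivative \<gamma> * v x + v x ^ 3 - u \<bar>x\<bar>) (at x)"
    and v_even: "\<And>x. v (- x) = v x" and v1_0: "v1 0 = 0"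
begin

lemma u_H1: "u \<in> H1" using adm by (simp add: admissible_def)
lemma u_cont: "continuous_on {0..} u" using u_H1 by (rule H1_continuous)
lemma u_lim: "(u \<longlongrightarrow> 0) at_top" using u_H1 by (rule H1_tendsto_0)
lemma v_cont: "continuous_on A v" and v1_cont: "continuous_on A v1"
  by (rule DERIV_continuous_on, rule has_field_derivative_at_within, rule v_deriv v1_deriv)+
lemma v_lim: "(v \<longlongrightarrow> 0) at_top"
proof (rule Lim_transform_eventually[OF H1_tendsto_0[OF N_H1[OF \<gamma> u_H1]]])
  show "\<forall>\<^sub>F x in at_top. N \<gamma> u x = v x" using eventually_ge_at_top[of 0] by eventually_elim (rule N_eq)
qed

lemma f_cont: "continuous_on A (f \<beta>)"
  unfolding f_def by (intro continuous_intros)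

text \<open>
  The function \<open>U\<close> below solves \<open>d U'' = v - f u\<close>, so that \<open>u\<close> satisfies the Euler-Lagrange equation on an interval precisely if
  \<open>u - U\<close> is affine there.
\<close>
definition U2 :: "real \<Rightarrow> real" where "U2 x = (v x - f \<beta> (u \<bar>x\<bar>)) / d"
definition U1 :: "real \<Rightarrow> real" where "U1 x = (LBINT t=0..x. U2 t)"
definition U :: "real \<Rightarrow> real" where "U x = (LBINT t=0..x. U1 t)"

lemma u_abs_cont: "continuous_on A (\<lambda>x. u \<bar>x\<bar>)"
  by (rule continuous_on_compose2[OF u_cont]) (auto intro!: continuous_intros)

lemma U2_cont: "continuous_on A U2"
  unfolding U2_def using d by (intro continuous_intros v_cont continuous_on_compose2[OF f_cont u_abs_cont]) auto

lemma U1_deriv: "(U1 has_real_derivative U2 x) (at x)"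
  unfolding U1_def[abs_def] by (rule continuous_antiderivative[OF U2_cont])

lemma U1_cont: "continuous_on A U1"
  by (rule DERIV_continuous_on, rule has_field_derivative_at_within, rule U1_deriv)

lemma U_deriv: "(U has_real_derivative U1 x) (at x)"
  unfolding U_def[abs_def] by (rule continuous_antiderivative[OF U1_cont])

lemma U1_0: "U1 0 = 0" by (simp add: U1_def zero_ereal_def[symmetric])

lemma U2_eq: "0 \<le> x \<Longrightarrow> U2 x = (v x - f \<beta> (u x)) / d" by (simp add: U2_def)

lemma hat_variation:
  assumes ayb: "a < y" "y < b" "0 < b" and s: "\<bar>s\<bar> \<le> 1" and e: "\<epsilon>0 > 0"
    and adm': "\<And>\<epsilon>. 0 < \<epsilon> \<Longrightarrow> \<epsilon> < \<epsilon>0 \<Longrightarrow> (\<lambda>x. u x + \<epsilon> * (s * hat a y b x)) \<in> admissible \<beta> M"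
  shows "0 \<le> s * ((\<integral>x. wderiv u x * hat_slope a y b x \<partial>hl) + (\<integral>x. U2 x * hat a y b x \<partial>hl))"
proof -
  let ?\<phi> = "\<lambda>x. 0 + s * hat a y b x"
  have z: "(\<lambda>_. 0) \<in> H1" 
  proof (rule H1_I[where g="\<lambda>_. 0"])
    show "(\<lambda>_. 0) \<in> L2" by (rule L2_bounded_support[where C=0 and b=0]) auto
    then show "has_weak_deriv (\<lambda>_. 0) (\<lambda>_. 0)" by (simp add: has_weak_deriv_def)
  qed (auto intro: L2_bounded_support[where C=0 and b=0])
  have \<phi>: "?\<phi> \<in> H1" by (rule H1_add_scale(1)[OF z hat_H1(1)[OF ayb(1,2)]])
  have wd: "has_weak_deriv ?\<phi> (\<lambda>x. 0 + s * hat_slope a y b x)"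
    using hat_H1[OF ayb(1,2)] z by (intro has_weak_deriv_add_scale) (auto simp: has_weak_deriv_def H1_L2)
  have AE: "AE x in hl. wderiv ?\<phi> x = 0 + s * hat_slope a y b x"
    by (rule wderiv_AE_eq[OF \<phi> _ wd]) (simp add: L2_scale hat_H1[OF ayb(1,2)])
  have "0 \<le> d * (\<integral>x. wderiv u x * wderiv ?\<phi> x \<partial>hl) + (\<integral>x. (N \<gamma> u x - f \<beta> (u x)) * ?\<phi> x \<partial>hl)"
  proof (rule first_variation_nonneg[OF \<gamma> _ u_H1 \<phi> _ e])
    show "\<bar>?\<phi> x\<bar> \<le> 1" for x
      using hat_bounds[OF ayb(1,2), of x] s by (simp add: abs_mult mult_le_one)
    show "J \<beta> \<gamma> d u \<le> J \<beta> \<gamma> d (\<lambda>x. u x + \<epsilon> * ?\<phi> x)" if "0 < \<epsilon>" "\<epsilon> < \<epsilon>0" for \<epsilon>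
      using minimal[OF adm'[OF that]] by simp
  qed (use d in auto)
  also have "(\<integral>x. wderiv u x * wderiv ?\<phi> x \<partial>hl) = (\<integral>x. s * (wderiv u x * hat_slope a y b x) \<partial>hl)"
  proof (rule integral_cong_AE)
    show "(\<lambda>x. wderiv u x * wderiv ?\<phi> x) \<in> borel_measurable hl"
      using L2_measurable[OF H1_wderiv(1)[OF u_H1]] L2_measurable[OF H1_wderiv(1)[OF \<phi>]] by measurable
    show "(\<lambda>x. s * (wderiv u x * hat_slope a y b x)) \<in> borel_measurable hl"
      using L2_measurable[OF H1_wderiv(1)[OF u_H1]] L2_measurable[OF hat_H1(2)[OF ayb(1,2)]] by measurable
    show "AE x in hl. wderiv u x * wderiv ?\<phi> x = s * (wderiv u x * hat_slope a y b x)"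
      using AE by eventually_elim simp
  qed
  also have "(\<integral>x. (N \<gamma> u x - f \<beta> (u x)) * ?\<phi> x \<partial>hl) = (\<integral>x. (s * d) * (U2 x * hat a y b x) \<partial>hl)"
    by (rule hl_cong) (use d in \<open>auto simp: N_eq U2_eq\<close>)
  finally have "0 \<le> d * (s * ((\<integral>x. wderiv u x * hat_slope a y b x \<partial>hl) + (\<integral>x. U2 x * hat a y b x \<partial>hl)))"
    by (simp add: algebra_simps)
  then show ?thesis using d by (simp add: zero_le_mult_iff)
qed

lemma U2_hat_integral:
  shows "0 \<le> a \<Longrightarrow> a < y \<Longrightarrow> y < b \<Longrightarrow> (\<integral>x. U2 x * hat a y b x \<partial>hl) = kink U a y b"
    "a < 0 \<Longrightarrow> 0 < b \<Longrightarrow> (\<integral>x. U2 x * hat a 0 b x \<partial>hl) = (U b - U 0) / b"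
proof -
  have int1: "integrable hl (\<lambda>x. U1 x * indicator {p<..q} x)" for p q
  proof -
    have "continuous_on {0..q} U1" by (rule U1_cont)
    then obtain C where C: "\<And>x. x \<in> {0..q} \<Longrightarrow> \<bar>U1 x\<bar> \<le> C" by (rule continuous_on_Icc_bounded) blast
    have [measurable]: "U1 \<in> borel_measurable hl" by (rule measurable_hl_continuous[OF U1_cont])
    have "(\<lambda>x. U1 x * indicator {0<..q} x) \<in> L2"
    proof (rule L2_bounded_support[where C="\<bar>C\<bar>" and b=q])
      show "\<bar>U1 x * indicator {0<..q} x\<bar> \<le> \<bar>C\<bar>" if "0 < x" for x
        using C[of x] that by (auto simp: indicator_def)
      show "(\<lambda>x. U1 x * indicator {0<..q} x) \<in> borel_measurable hl" by measurable
    qed auto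
    from L2_integrable_Ioc[OF this, of p q] show ?thesis
      by (rule integrable_hl_cong[THEN iffD1, rotated]) (auto simp: indicator_def)
  qed
  have inc: "(\<integral>x. U1 x * indicator {p<..q} x \<partial>hl) = U q - U p" if "0 \<le> p" "p \<le> q" for p q
    by (rule hl_FTC[OF U_deriv U1_cont that])
  have whole: "(\<integral>x. U2 x * hat a y b x \<partial>hl) = - (\<integral>x. U1 x * hat_slope a y b x \<partial>hl) - hat a y b 0 * U1 0"
    if "a < y" "y < b" "0 < b" for a y b
  proof -
    note H = hat_H1[OF that(1,2)]
    have bp: "(\<integral>x. (hat a y b x * U2 x) * indicator {0<..b} x \<partial>hl) + (\<integral>x. (hat_slope a y b x * U1 x) * indicator {0<..b} x \<partial>hl)
       = hat a y b b * U1 b - hat a y b 0 * U1 0"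
      by (rule weak_deriv_by_parts[OF H1_continuous[OF H(1)] H(2,3) U1_deriv U2_cont]) (use that in auto)
    have "(\<integral>x. (hat a y b x * U2 x) * indicator {0<..b} x \<partial>hl) = (\<integral>x. U2 x * hat a y b x \<partial>hl)"
      by (rule hl_cong) (use that hat_outside[OF that(1,2)] in \<open>auto simp: indicator_def\<close>)
    moreover have "(\<integral>x. (hat_slope a y b x * U1 x) * indicator {0<..b} x \<partial>hl) = (\<integral>x. U1 x * hat_slope a y b x \<partial>hl)"
      by (rule hl_cong) (use that in \<open>auto simp: indicator_def hat_slope_def\<close>)
    ultimately show ?thesis using bp hat_outside[OF that(1,2), of b] by simp
  qed
  note hs = hat_slope_integral[of U1 U, OF int1 inc]
  show "0 \<le> a \<Longrightarrow> a < y \<Longrightarrow> y < b \<Longrightarrow> (\<integral>x. U2 x * hat a y b x \<partial>hl) = kink U a y b"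
    using whole[of a y b] hs(1)[of a y b] U1_0 by simp
  show "a < 0 \<Longrightarrow> 0 < b \<Longrightarrow> (\<integral>x. U2 x * hat a 0 b x \<partial>hl) = (U b - U 0) / b"
    using whole[of a 0 b] hs(2)[of a b] U1_0 by simp
qed

lemma u_hat_integral:
  shows "0 \<le> a \<Longrightarrow> a < y \<Longrightarrow> y < b \<Longrightarrow> (\<integral>x. wderiv u x * hat_slope a y b x \<partial>hl) = - kink u a y b"
    "a < 0 \<Longrightarrow> 0 < b \<Longrightarrow> (\<integral>x. wderiv u x * hat_slope a 0 b x \<partial>hl) = - ((u b - u 0) / b)"
  by (rule hat_slope_integral[of "wderiv u" u, OF L2_integrable_Ioc[OF H1_wderiv(1)[OF u_H1]]
      weak_deriv_increment[OF u_cont H1_wderiv[OF u_H1]]]; assumption)+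

text \<open>
  The first variation of \<^const>\<open>J\<close> in the direction of a hat, divided by \<open>d\<close>.
\<close>
lemma kink_variation:
  assumes "0 \<le> a" "a < y" "y < b" "\<bar>s\<bar> \<le> 1" "\<epsilon>0 > 0"
    "\<And>\<epsilon>. 0 < \<epsilon> \<Longrightarrow> \<epsilon> < \<epsilon>0 \<Longrightarrow> (\<lambda>x. u x + \<epsilon> * (s * hat a y b x)) \<in> admissible \<beta> M"
  shows "0 \<le> s * (kink U a y b - kink u a y b)"
  using hat_variation[of a y b s \<epsilon>0] assms by (simp add: u_hat_integral U2_hat_integral)

text \<open>
  The half hat with peak at \<open>0\<close>; the term with \<open>U' 0\<close> vanishes.
\<close>
lemma boundary_variation:
  assumes "0 < b" "\<epsilon>0 > 0"
    "\<And>\<epsilon>. 0 < \<epsilon> \<Longrightarrow> \<epsilon> < \<epsilon>0 \<Longrightarrow> (\<lambda>x. u x + \<epsilon> * hat (-1) 0 b x) \<in> admissible \<beta> M"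
  shows "u b - u 0 \<le> U b - U 0"
proof -
  have "0 \<le> - ((u b - u 0) / b) + (U b - U 0) / b"
    using hat_variation[of "-1" 0 b 1 \<epsilon>0] assms by (simp add: u_hat_integral U2_hat_integral)
  then have "(u b - u 0) / b \<le> (U b - U 0) / b" by linarith
  then show ?thesis using assms(1) by (simp add: divide_le_cancel)
qed

text \<open>
  The Euler-Lagrange equation at \<open>x\<close>. It is demanded on a neighbourhood, because extrema of \<open>u\<close> are analysed through its
  derivative near the point.
\<close>
definition EL :: "real \<Rightarrow> bool" where
  "EL x \<longleftrightarrow> (\<exists>e>0. \<forall>t. \<bar>t - x\<bar> < e \<longrightarrow>
     (u has_real_derivative deriv u t) (at t) \<and> (deriv u has_real_derivative U2 t) (at t))"

lemma EL_deriv: "EL x \<Longrightarrow> (u has_real_derivative deriv u x) (at x)"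
  and EL_deriv2: "EL x \<Longrightarrow> (deriv u has_real_derivative U2 x) (at x)"
  by (auto simp: EL_def)

lemma EL_nbhd: assumes "EL x" obtains e where "0 < e" "\<And>t. \<bar>t - x\<bar> < e \<Longrightarrow> EL t"
proof -
  obtain e where e: "e > 0" "\<forall>t. \<bar>t - x\<bar> < e \<longrightarrow>
     (u has_real_derivative deriv u t) (at t) \<and> (deriv u has_real_derivative U2 t) (at t)"
    using assms by (auto simp: EL_def)
  have "EL t" if "\<bar>t - x\<bar> < e" for t
    unfolding EL_def
  proof (intro exI[of _ "e - \<bar>t - x\<bar>"] conjI allI impI)
    fix s assume "\<bar>s - t\<bar> < e - \<bar>t - x\<bar>"
    then have "\<bar>s - x\<bar> < e" by linarith
    then show "(u has_real_derivative deriv u s) (at s)" "(deriv u has_real_derivative U2 s) (at s)" using e by auto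
  qed (use that in auto)
  with that e show ?thesis by blast
qed

lemma EL_of_affine:
  assumes g: "\<And>t. t \<in> {p<..<q} \<Longrightarrow> u t = U t + (m * t + c)" and x: "x \<in> {p<..<q}"
  shows "EL x"
proof -
  have d1: "(u has_real_derivative U1 t + m) (at t)" if "t \<in> {p<..<q}" for t
  proof (rule has_field_derivative_transform_within_open[where f="\<lambda>t. U t + (m * t + c)" and S="{p<..<q}"])
    show "((\<lambda>t. U t + (m * t + c)) has_real_derivative U1 t + m) (at t)"
      by (rule DERIV_cong[OF DERIV_add[OF U_deriv]]) (auto intro!: derivative_eq_intros)
  qed (use that g in auto)
  then have du: "deriv u t = U1 t + m" if "t \<in> {p<..<q}" for t using that by (intro DERIV_imp_deriv)
  have d2: "(deriv u has_real_derivative U2 t) (at t)" if "t \<in> {p<..<q}" for t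
  proof (rule has_field_derivative_transform_within_open[where f="\<lambda>t. U1 t + m" and S="{p<..<q}"])
    show "((\<lambda>t. U1 t + m) has_real_derivative U2 t) (at t)"
      by (rule DERIV_cong[OF DERIV_add[OF U1_deriv DERIV_const]]) auto
  qed (use that du in auto)
  show ?thesis
    unfolding EL_def
  proof (intro exI[of _ "min (x - p) (q - x)"] conjI allI impI)
    fix t assume "\<bar>t - x\<bar> < min (x - p) (q - x)"
    then have "t \<in> {p<..<q}" by auto
    then show "(u has_real_derivative deriv u t) (at t)" "(deriv u has_real_derivative U2 t) (at t)"
      using d1[of t] du[of t] d2[of t] by auto
  qed (use x in auto)
qed

lemma kink_diff: "kink u a y b - kink U a y b = kink (\<lambda>x. u x - U x) a y b"
  by (simp add: kink_def diff_divide_distrib)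

text \<open>
  One family of hats with common outer nodes suffices: equal kinks put all points of the graph of \<open>u - U\<close> on the chord between
  \<open>p\<close> and \<open>q\<close>.
\<close>
lemma EL_of_kinks:
  assumes pq: "p < q" and k: "\<And>y. y \<in> {p<..<q} \<Longrightarrow> kink u p y q = kink U p y q" and x: "x \<in> {p<..<q}"
  shows "EL x"
proof (rule EL_of_affine[OF _ x])
  define g where "g t = u t - U t" for t
  define m where "m = (g q - g p) / (q - p)"
  fix t assume t: "t \<in> {p<..<q}"
  have "kink g p t q = 0" using k[OF t] kink_diff[of p t q] by (simp add: g_def[abs_def])
  then have "(g q - g t) * (t - p) = (g t - g p) * (q - t)" using t by (simp add: kink_def field_simps)
  then have "g t * (q - p) = g p * (q - p) + (g q - g p) * (t - p)" by (simp add: algebra_simps)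
  then have "g t = (g p * (q - p) + (g q - g p) * (t - p)) / (q - p)" using pq by (simp add: eq_divide_eq)
  also have "\<dots> = g p + m * (t - p)" using pq by (simp add: m_def add_divide_distrib)
  finally show "u t = U t + (m * t + (g p - m * p))" by (simp add: g_def algebra_simps)
qed

end

section \<open>Obstacles and contact points\<close>

text \<open>
  The constraint on the value \<open>s\<close> at the point \<open>x\<close>. Stated pointwise, it makes admissibility of a local perturbation a
  local question.
\<close>
definition band_ok :: "real \<Rightarrow> real \<Rightarrow> real \<Rightarrow> ereal \<Rightarrow> real \<Rightarrow> real \<Rightarrow> bool" where
  "band_ok \<beta> M x1 x2 x s \<longleftrightarrow> (if x \<le> x1 then 0 < x1 \<longrightarrow> \<beta> \<le> s \<and> s \<le> 1
     else if ereal x \<le> x2 then 0 \<le> s \<and> s \<le> \<beta> else - (M + 1) \<le> s \<and> s \<le> 0)"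

definition bands :: "real \<Rightarrow> real \<Rightarrow> (real \<Rightarrow> real) \<Rightarrow> real \<Rightarrow> ereal \<Rightarrow> bool" where
  "bands \<beta> M w x1 x2 \<longleftrightarrow> 0 \<le> x1 \<and> ereal x1 < x2 \<and> (\<forall>x\<ge>0. band_ok \<beta> M x1 x2 x (w x))"

lemma admissible_iff_bands: "w \<in> admissible \<beta> M \<longleftrightarrow> w \<in> H1 \<and> (\<exists>x1 x2. bands \<beta> M w x1 x2)"
proof -
  have "bands \<beta> M w x1 x2 \<longleftrightarrow> 0 \<le> x1 \<and> ereal x1 < x2 \<and>
     (0 < x1 \<longrightarrow> (\<forall>x. 0 \<le> x \<and> x \<le> x1 \<longrightarrow> \<beta> \<le> w x \<and> w x \<le> 1)) \<and>
     (\<forall>x. x1 < x \<and> ereal x \<le> x2 \<longrightarrow> 0 \<le> w x \<and> w x \<le> \<beta>) \<and>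
     (\<forall>x. x2 < ereal x \<longrightarrow> - (M + 1) \<le> w x \<and> w x \<le> 0)" (is "?L \<longleftrightarrow> ?R") for x1 x2
  proof
    assume L: ?L
    have gt: "x1 < x" if "x2 < ereal x" for x using L that unfolding bands_def by (metis less_ereal.simps(1) order.strict_trans)
    show ?R
      using L gt unfolding bands_def band_ok_def
      by (smt (verit, best) linorder_not_le)
  next
    assume ?R
    then show ?L unfolding bands_def band_ok_def by (auto simp: not_le)
  qed
  then show ?thesis unfolding admissible_def by auto
qed

context pulse
begin

abbreviation W :: "real \<Rightarrow> ereal \<Rightarrow> bool" where "W x1 x2 \<equiv> 0 < x1 \<and> bands \<beta> M u x1 x2"

lemma M_pos: "0 < M"
proof (rule ccontr)
  assume "\<not> 0 < M"
  then have "1 + 1 / \<gamma> \<le> f \<beta> 0" by (intro M) auto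
  moreover have "0 < 1 / \<gamma>" using \<gamma> by simp
  ultimately show False by (simp add: f_def)
qed

lemma u_near:
  assumes "0 \<le> x" "0 < e" obtains r where "0 < r" "\<And>t. 0 \<le> t \<Longrightarrow> \<bar>t - x\<bar> < r \<Longrightarrow> \<bar>u t - u x\<bar> < e"
  using u_cont assms unfolding continuous_on_iff dist_real_def by (metis atLeast_iff)

text \<open>
  If the first band were empty then \<open>u \<le> \<beta>\<close>, where \<^const>\<open>F\<close> is nonnegative. The energy of the inhibitor is nonnegative as well,
  which contradicts the negative energy of the minimizer.
\<close>
lemma bands_exist: obtains x1 x2 where "W x1 x2"
proof -
  obtain x1 x2 where b: "bands \<beta> M u x1 x2" using adm by (auto simp: admissible_iff_bands)
  have "x1 \<noteq> 0"
  proof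
    assume "x1 = 0"
    have le: "u x \<le> \<beta>" if "0 < x" for x
    proof -
      have "band_ok \<beta> M x1 x2 x (u x)" using b that by (auto simp: bands_def)
      then show ?thesis using that \<open>x1 = 0\<close> \<beta> by (auto simp: band_ok_def split: if_splits)
    qed
    have F0: "0 \<le> F \<beta> s" if "s \<le> \<beta>" for s
    proof -
      have "s\<^sup>2 / 4 - (1 + \<beta>) * s / 3 + \<beta> / 2 \<ge> 0"
      proof -
        \<comment> \<open>Expanded around \<open>\<beta>\<close>, all terms are nonnegative for \<open>s \<le> \<beta>\<close>.\<close>
        have eq: "s\<^sup>2 / 4 - (1 + \<beta>) * s / 3 + \<beta> / 2 = ((s - \<beta>)\<^sup>2 + (\<beta> - s) * (4/3 - 2/3 * \<beta>) + \<beta> * (2/3 - \<beta>/3)) / 4"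
          by (simp add: power2_eq_square field_simps)
        have "0 \<le> (\<beta> - s) * (4/3 - 2/3 * \<beta>)" "0 \<le> \<beta> * (2/3 - \<beta>/3)"
          using that \<beta> by (auto intro!: mult_nonneg_nonneg)
        then show ?thesis unfolding eq by (intro divide_nonneg_pos add_nonneg_nonneg) auto
      qed
      moreover have "F \<beta> s = s\<^sup>2 * (s\<^sup>2 / 4 - (1 + \<beta>) * s / 3 + \<beta> / 2)"
        by (simp add: F_factored power2_eq_square algebra_simps)
      ultimately show ?thesis by simp
    qed
    note NH = N_H1[OF \<gamma> u_H1]
    have "0 \<le> (\<integral>x. wderiv (N \<gamma> u) x * wderiv (N \<gamma> u) x \<partial>hl) + \<gamma> * (\<integral>x. N \<gamma> u x * N \<gamma> u x \<partial>hl) + (\<integral>x. N \<gamma> u x ^ 3 * N \<gamma> u x \<partial>hl)"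
    proof -
      have "0 \<le> s ^ 3 * s" for s :: real
      proof -
        have "s ^ 3 * s = (s * s)\<^sup>2" by (simp add: power2_eq_square power3_eq_cube)
        then show ?thesis by simp
      qed
      then show ?thesis using \<gamma> by (auto intro!: add_nonneg_nonneg mult_nonneg_nonneg integral_nonneg_AE)
    qed
    then have "0 \<le> (\<integral>x. u x * N \<gamma> u x \<partial>hl)"
      using weak_solution_tested[OF N_weak_solution[OF \<gamma> u_H1] H1_L2[OF u_H1] NH] by simp
    moreover have "0 \<le> (\<integral>x. F \<beta> (u x) \<partial>hl)"
      by (rule integral_nonneg_AE, rule AE_hl_I) (use le F0 in auto)
    moreover have "0 \<le> (\<integral>x. N \<gamma> u x ^ 4 \<partial>hl)" "0 \<le> (\<integral>x. (wderiv u x)\<^sup>2 \<partial>hl)"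
      by (auto intro!: integral_nonneg_AE)
    ultimately have "0 \<le> J \<beta> \<gamma> d u"
      unfolding J_expand[OF \<gamma> u_H1] using d by (auto intro!: add_nonneg_nonneg mult_nonneg_nonneg)
    then show False using negative by simp
  qed
  then have "W x1 x2" using b by (auto simp: bands_def)
  then show ?thesis using that by blast
qed

lemma W_band: "W x1 x2 \<Longrightarrow> 0 \<le> x \<Longrightarrow> band_ok \<beta> M x1 x2 x (u x)"
  by (simp add: bands_def)

lemma W_lt: "W x1 x2 \<Longrightarrow> ereal x1 < x2"
  by (simp add: bands_def)

lemma W_left: "W x1 x2 \<Longrightarrow> 0 \<le> x \<Longrightarrow> x \<le> x1 \<Longrightarrow> \<beta> \<le> u x \<and> u x \<le> 1"
  using W_band[of x1 x2 x] by (simp add: band_ok_def)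

lemma W_mid: "W x1 x2 \<Longrightarrow> x1 < x \<Longrightarrow> ereal x \<le> x2 \<Longrightarrow> 0 \<le> u x \<and> u x \<le> \<beta>"
  using W_band[of x1 x2 x] by (simp add: band_ok_def)

lemma W_right: "W x1 x2 \<Longrightarrow> x2 < ereal x \<Longrightarrow> - (M + 1) \<le> u x \<and> u x \<le> 0"
proof -
  assume *: "W x1 x2" "x2 < ereal x"
  then have "ereal x1 < ereal x" using W_lt less_trans by blast
  then have "\<not> x \<le> x1" "\<not> ereal x \<le> x2" using * by auto
  then show ?thesis using W_band[of x1 x2 x] * by (simp add: band_ok_def)
qed

lemma u_le_1: assumes "0 \<le> x" shows "u x \<le> 1"
proof -
  obtain x1 x2 where "W x1 x2" by (rule bands_exist)
  from W_band[OF this assms] show ?thesis using \<open>W x1 x2\<close> \<beta> by (auto simp: band_ok_def split: if_splits)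
qed

lemma v_at_local_max:
  assumes "e > 0" "\<And>t. \<bar>t - m\<bar> < e \<Longrightarrow> v t \<le> v m" shows "\<gamma> * v m + v m ^ 3 \<le> u \<bar>m\<bar>"
  using second_derivative_at_max(2)[OF assms(1) v_deriv assms(2) v1_deriv] by simp

text \<open>
  At a positive maximum \<open>v'' \<le> 0\<close>, so \<open>\<gamma> v + v^3 \<le> u \<le> 1\<close>.
\<close>
lemma v_upper: assumes "0 \<le> x" shows "v x \<le> 1" "\<gamma> * v x \<le> 1"
proof -
  have "v x \<le> 1 \<and> \<gamma> * v x \<le> 1"
  proof (cases "0 < v x")
    case False
    then have "\<gamma> * v x \<le> 0" using \<gamma> by (simp add: mult_le_0_iff)
    then show ?thesis using False by simp
  next
    case True
    obtain m where m: "0 \<le> m" "\<And>t. 0 \<le> t \<Longrightarrow> v t \<le> v m" "v x \<le> v m"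
      using decaying_attains_max[OF v_cont v_lim assms True] by blast
    have "v t \<le> v m" for t
      using m(2)[of t] m(2)[of "- t"] v_even[of t] by (cases "0 \<le> t") auto
    then have le: "\<gamma> * v m + v m ^ 3 \<le> 1"
      using v_at_local_max[of 1 m] u_le_1[of "\<bar>m\<bar>"] by fastforce
    have pos: "0 < v m" using True m by linarith
    then have "0 < \<gamma> * v m" "0 < v m ^ 3" using \<gamma> by auto
    then have "\<gamma> * v m \<le> 1" "v m ^ 3 \<le> 1" using le by linarith+
    moreover have "v m \<le> 1"
    proof (rule ccontr)
      assume "\<not> v m \<le> 1"
      then have "1 < v m ^ 3" by (intro one_less_power) auto
      then show False using \<open>v m ^ 3 \<le> 1\<close> by simp
    qed
    moreover have "\<gamma> * v x \<le> \<gamma> * v m" using m \<gamma> by simp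
    ultimately show ?thesis using m by linarith
  qed
  then show "v x \<le> 1" "\<gamma> * v x \<le> 1" by auto
qed

lemma kink_U_mvt:
  assumes "a < y" "y < b" obtains s t \<xi> where "a < s" "s < \<xi>" "\<xi> < t" "t < b" "kink U a y b = (t - s) * U2 \<xi>"
proof -
  obtain s t where st: "a < s" "s < y" "y < t" "t < b" "kink U a y b = U1 t - U1 s"
    using kink_mvt[OF assms, of U U1] U_deriv by metis
  obtain \<xi> where "s < \<xi>" "\<xi> < t" "U1 t - U1 s = (t - s) * U2 \<xi>"
    using MVT2[of s t U1 U2] st U1_deriv by force
  with that[of s \<xi> t] st show ?thesis by simp
qed

lemma hat_admissible:
  assumes "W x1 x2" "a < y" "y < b" "\<And>x. 0 \<le> x \<Longrightarrow> a < x \<Longrightarrow> x < b \<Longrightarrow> band_ok \<beta> M x1 x2 x (u x + c * hat a y b x)"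
  shows "(\<lambda>x. u x + c * hat a y b x) \<in> admissible \<beta> M"
  unfolding admissible_iff_bands
proof (intro conjI exI)
  show "(\<lambda>x. u x + c * hat a y b x) \<in> H1" by (intro H1_add_scale(1) u_H1 hat_H1 assms)
  show "bands \<beta> M (\<lambda>x. u x + c * hat a y b x) x1 x2"
    unfolding bands_def
  proof (intro conjI allI impI)
    show "0 \<le> x1" "ereal x1 < x2" using assms(1) W_lt by auto
    fix x :: real assume "0 \<le> x"
    then show "band_ok \<beta> M x1 x2 x (u x + c * hat a y b x)"
      using assms(4)[of x] W_band[OF assms(1), of x] hat_outside[OF assms(2,3), of x]
      by (cases "a < x \<and> x < b") (auto simp: not_less)
  qed
qed

lemma band_nbhd:
  assumes W: "W x1 x2" and x: "0 < x" "x \<noteq> x1" "ereal x \<noteq> x2" and e: "0 < e"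
  obtains r where "0 < r" "r \<le> x"
    "\<And>t. \<bar>t - x\<bar> < r \<Longrightarrow> band_ok \<beta> M x1 x2 t = band_ok \<beta> M x1 x2 x \<and> \<bar>u t - u x\<bar> < e"
proof -
  obtain r0 where r0: "0 < r0" "\<And>t. 0 \<le> t \<Longrightarrow> \<bar>t - x\<bar> < r0 \<Longrightarrow> \<bar>u t - u x\<bar> < e"
    using u_near[of x e] x e by (metis less_eq_real_def)
  have "\<exists>r2>0. \<forall>t. \<bar>t - x\<bar> < r2 \<longrightarrow> (ereal t \<le> x2 \<longleftrightarrow> ereal x \<le> x2)"
  proof (cases x2)
    case (real y)
    then show ?thesis using x by (intro exI[of _ "\<bar>x - y\<bar>"]) auto
  qed (auto intro!: exI[of _ 1])
  then obtain r2 where r2: "0 < r2" "\<And>t. \<bar>t - x\<bar> < r2 \<Longrightarrow> (ereal t \<le> x2 \<longleftrightarrow> ereal x \<le> x2)" by blast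
  define r where "r = min (min r0 r2) (min \<bar>x - x1\<bar> x)"
  show ?thesis
  proof (rule that[of r])
    show "0 < r" "r \<le> x" using r0 r2 x by (auto simp: r_def)
    fix t assume t: "\<bar>t - x\<bar> < r"
    then have "(t \<le> x1) = (x \<le> x1)" by (auto simp: r_def)
    moreover have "ereal t \<le> x2 \<longleftrightarrow> ereal x \<le> x2" using t by (intro r2) (simp add: r_def)
    ultimately have "band_ok \<beta> M x1 x2 t = band_ok \<beta> M x1 x2 x" by (auto simp: band_ok_def fun_eq_iff)
    moreover have "\<bar>u t - u x\<bar> < e" using t by (intro r0) (auto simp: r_def)
    ultimately show "band_ok \<beta> M x1 x2 t = band_ok \<beta> M x1 x2 x \<and> \<bar>u t - u x\<bar> < e" by simp
  qed
qed

lemma EL_interior: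
  assumes W: "W x1 x2" and x: "0 < x" "x \<noteq> x1" "ereal x \<noteq> x2" and \<delta>: "0 < \<delta>"
    and ok: "\<And>s. \<bar>s - u x\<bar> \<le> \<delta> \<Longrightarrow> band_ok \<beta> M x1 x2 x s"
  shows "EL x"
proof -
  obtain r where r: "0 < r" "r \<le> x"
    "\<And>t. \<bar>t - x\<bar> < r \<Longrightarrow> band_ok \<beta> M x1 x2 t = band_ok \<beta> M x1 x2 x \<and> \<bar>u t - u x\<bar> < \<delta> / 2"
    using band_nbhd[OF W x, of "\<delta> / 2"] \<delta> by auto
  show ?thesis
  proof (rule EL_of_kinks[of "x - r" "x + r"])
    fix y assume y: "y \<in> {x - r<..<x + r}"
    have *: "0 \<le> s * (kink U (x - r) y (x + r) - kink u (x - r) y (x + r))" if s: "\<bar>s\<bar> = 1" for s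
    proof (rule kink_variation[of _ _ _ _ "\<delta> / 2"])
      fix \<epsilon> assume \<epsilon>: "0 < \<epsilon>" "\<epsilon> < \<delta> / 2"
      have "(\<lambda>t. u t + \<epsilon> * s * hat (x - r) y (x + r) t) \<in> admissible \<beta> M"
      proof (rule hat_admissible[OF W])
        fix t assume t: "x - r < t" "t < x + r"
        have "\<bar>\<epsilon> * s * hat (x - r) y (x + r) t\<bar> \<le> \<epsilon> * 1"
          unfolding abs_mult using hat_bounds[of "x - r" y "x + r" t] y s \<epsilon> by (intro mult_mono) auto
        moreover have tr: "\<bar>t - x\<bar> < r" using t by auto
        ultimately have "\<bar>u t + \<epsilon> * s * hat (x - r) y (x + r) t - u x\<bar> \<le> \<delta>"
          using r(3)[OF tr] \<epsilon> by linarith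
        then show "band_ok \<beta> M x1 x2 t (u t + \<epsilon> * s * hat (x - r) y (x + r) t)"
          using r(3)[OF tr] ok by simp
      qed (use y in auto)
      then show "(\<lambda>t. u t + \<epsilon> * (s * hat (x - r) y (x + r) t)) \<in> admissible \<beta> M" by (simp add: mult.assoc)
    qed (use y r \<delta> s in auto)
    show "kink u (x - r) y (x + r) = kink U (x - r) y (x + r)"
      using *[of 1] *[of "-1"] by simp
  qed (use r in auto)
qed

text \<open>
  At a contact with an obstacle the allowed side is \<open>s = 1\<close> or \<open>s = -1\<close>. Since \<open>u\<close> stays on that side, its kink at \<open>x\<close> has the sign of
  \<open>s\<close>; if \<open>s U''\<close> were negative, then the kink of \<open>U\<close> would have the opposite sign, and moving \<open>u\<close> in the direction \<open>s\<close> would lower the energy.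
\<close>
lemma contact_direction:
  assumes W: "W x1 x2" and x: "0 < x" "x \<noteq> x1" "ereal x \<noteq> x2" and \<delta>: "0 < \<delta>" and s: "\<bar>s\<bar> = 1"
    and ok: "\<And>t. 0 \<le> s * (t - u x) \<Longrightarrow> s * (t - u x) \<le> \<delta> \<Longrightarrow> band_ok \<beta> M x1 x2 x t"
    and extreme: "\<And>t. band_ok \<beta> M x1 x2 x t \<Longrightarrow> 0 \<le> s * (t - u x)"
  shows "0 \<le> s * U2 x"
proof (rule ccontr)
  assume neg: "\<not> 0 \<le> s * U2 x"
  have ss: "s * s = 1" using s by (metis abs_mult_self_eq mult.right_neutral)
  obtain r0 where r0: "0 < r0" "\<And>t. \<bar>t - x\<bar> < r0 \<Longrightarrow> s * U2 t < 0"
  proof -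
    have "continuous_on UNIV (\<lambda>t. s * U2 t)" by (intro continuous_intros U2_cont)
    then obtain r where "0 < r" "\<And>t. \<bar>t - x\<bar> < r \<Longrightarrow> \<bar>s * U2 t - s * U2 x\<bar> < - (s * U2 x)"
      unfolding continuous_on_iff dist_real_def using neg by (metis UNIV_I neg_0_less_iff_less not_le)
    then show ?thesis using that[of r] by force
  qed
  obtain r1 where r1: "0 < r1" "r1 \<le> x"
    "\<And>t. \<bar>t - x\<bar> < r1 \<Longrightarrow> band_ok \<beta> M x1 x2 t = band_ok \<beta> M x1 x2 x \<and> \<bar>u t - u x\<bar> < \<delta> / 2"
    using band_nbhd[OF W x, of "\<delta> / 2"] \<delta> by auto
  define r where "r = min r0 r1 / 2"
  have r: "0 < r" "r < r0" "r < r1" using r0 r1 by (auto simp: r_def)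
  have near: "band_ok \<beta> M x1 x2 t = band_ok \<beta> M x1 x2 x" "0 \<le> s * (u t - u x)" "s * (u t - u x) \<le> \<delta> / 2"
    if t: "\<bar>t - x\<bar> \<le> r" for t
  proof -
    have *: "band_ok \<beta> M x1 x2 t = band_ok \<beta> M x1 x2 x \<and> \<bar>u t - u x\<bar> < \<delta> / 2"
      using r1(3)[of t] t r by auto
    then show "band_ok \<beta> M x1 x2 t = band_ok \<beta> M x1 x2 x" by simp
    have "0 \<le> t" using t r r1 by auto
    then show "0 \<le> s * (u t - u x)" using W_band[OF W, of t] * by (intro extreme) auto
    have "s * (u t - u x) \<le> \<bar>s\<bar> * \<bar>u t - u x\<bar>" by (metis abs_ge_self abs_mult)
    then show "s * (u t - u x) \<le> \<delta> / 2" using * s by simp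
  qed
  have "0 \<le> s * (kink U (x - r) x (x + r) - kink u (x - r) x (x + r))"
  proof (rule kink_variation[of _ _ _ _ "\<delta> / 2"])
    fix \<epsilon> assume \<epsilon>: "0 < \<epsilon>" "\<epsilon> < \<delta> / 2"
    have "(\<lambda>t. u t + \<epsilon> * s * hat (x - r) x (x + r) t) \<in> admissible \<beta> M"
    proof (rule hat_admissible[OF W])
      fix t assume t: "x - r < t" "t < x + r"
      let ?h = "hat (x - r) x (x + r) t"
      have h: "0 \<le> ?h" "?h \<le> 1" using hat_bounds[of "x - r" x "x + r" t] r by auto
      have e: "s * (u t + \<epsilon> * s * ?h - u x) = s * (u t - u x) + \<epsilon> * ?h * (s * s)" by (simp add: algebra_simps)
      have "0 \<le> \<epsilon> * ?h" "\<epsilon> * ?h \<le> \<epsilon> * 1" using h \<epsilon> by (auto intro: mult_left_mono)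
      moreover have "\<bar>t - x\<bar> \<le> r" using t by auto
      ultimately have "0 \<le> s * (u t + \<epsilon> * s * ?h - u x)" "s * (u t + \<epsilon> * s * ?h - u x) \<le> \<delta>"
        unfolding e ss using near(2,3)[of t] \<epsilon> by linarith+
      then show "band_ok \<beta> M x1 x2 t (u t + \<epsilon> * s * ?h)" using near(1)[of t] t ok by auto
    qed (use r in auto)
    then show "(\<lambda>t. u t + \<epsilon> * (s * hat (x - r) x (x + r) t)) \<in> admissible \<beta> M" by (simp add: mult.assoc)
  qed (use r r1 \<delta> s in auto)
  moreover have "0 \<le> s * kink u (x - r) x (x + r)"
  proof -
    have "s * kink u (x - r) x (x + r) = (s * (u (x + r) - u x) + s * (u (x - r) - u x)) / r"
      using r by (simp add: kink_def field_simps)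
    then show ?thesis using near(2)[of "x + r"] near(2)[of "x - r"] r by simp
  qed
  moreover have "s * kink U (x - r) x (x + r) < 0"
  proof -
    obtain p q \<xi> where k: "x - r < p" "p < \<xi>" "\<xi> < q" "q < x + r" "kink U (x - r) x (x + r) = (q - p) * U2 \<xi>"
      by (rule kink_U_mvt[of "x - r" x "x + r"]) (use r in auto)
    have "s * U2 \<xi> < 0" using k r by (intro r0) auto
    then have "(q - p) * (s * U2 \<xi>) < 0" using k by (simp add: mult_less_0_iff)
    then show ?thesis unfolding k(5) by (simp only: mult.left_commute)
  qed
  ultimately show False by (simp add: right_diff_distrib)
qed

text \<open>
  At the lowest level \<open>f\<close> is at least \<open>1 + 1 / \<gamma>\<close>, more than \<open>v\<close> can be; lifting \<open>u\<close> there lowers the energy.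
\<close>
lemma u_gt_floor: assumes W: "W x1 x2" and x: "x2 < ereal x" shows "- (M + 1) < u x"
proof (rule ccontr)
  assume "\<not> - (M + 1) < u x"
  then have ux: "u x = - (M + 1)" using W_right[OF W x] by simp
  have x1: "x1 < x" using W_lt[OF W] x by (metis less_ereal.simps(1) less_trans)
  have x0: "0 < x" using x1 W by simp
  have b: "band_ok \<beta> M x1 x2 x t \<longleftrightarrow> - (M + 1) \<le> t \<and> t \<le> 0" for t
    using x x1 by (auto simp: band_ok_def not_le)
  have "0 \<le> 1 * U2 x"
    by (rule contact_direction[OF W x0 _ _ zero_less_one]) (use x x1 M_pos ux b in auto)
  then have "f \<beta> (u x) \<le> v x" using d x0 by (simp add: U2_eq zero_le_divide_iff)
  moreover have "1 + 1 / \<gamma> \<le> f \<beta> (u x)" by (rule M) (simp add: ux)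
  moreover have "v x \<le> 1 / \<gamma>" using v_upper(2)[of x] x0 \<gamma> by (simp add: field_simps)
  ultimately show False by simp
qed

lemma EL_left: assumes W: "W x1 x2" and x: "0 < x" "x < x1" "\<beta> < u x" "u x < 1" shows "EL x"
proof (rule EL_interior[OF W x(1), of "min (u x - \<beta>) (1 - u x)"])
  have "ereal x < ereal x1" using x by simp
  then show "ereal x \<noteq> x2" using W_lt[OF W] by (metis less_trans less_irrefl)
qed (use x in \<open>auto simp: band_ok_def\<close>)

lemma EL_mid: assumes W: "W x1 x2" and x: "x1 < x" "ereal x < x2" "0 < u x" "u x < \<beta>" shows "EL x"
  by (rule EL_interior[OF W, of _ "min (u x) (\<beta> - u x)"]) (use x W in \<open>auto simp: band_ok_def\<close>)

lemma EL_right: assumes W: "W x1 x2" and x: "x2 < ereal x" "u x < 0" shows "EL x"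
proof -
  have x1: "x1 < x" using W_lt[OF W] x by (metis less_ereal.simps(1) less_trans)
  show ?thesis
    by (rule EL_interior[OF W, of _ "min (- u x) (u x + (M + 1))"])
      (use x x1 W u_gt_floor[OF W x(1)] in \<open>auto simp: band_ok_def not_le\<close>)
qed

end

context pulse
begin

lemma d_small: "4 * d * (1 + \<beta> * \<gamma>) < \<beta>\<^sup>2"
proof -
  have "0 < 4 * (1 + \<beta> * \<gamma>)" using \<beta> \<gamma> by (simp add: add_pos_pos)
  then show ?thesis using d_less by (simp add: pos_less_divide_eq algebra_simps)
qed

lemma d\<gamma>_small: "4 * (d * \<gamma>) < \<beta>"
proof -
  have "4 * (d * \<gamma>) * \<beta> < \<beta> * \<beta>" using d_small d by (simp add: power2_eq_square algebra_simps)
  then show ?thesis using \<beta> by (simp add: mult_less_cancel_right)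
qed

text \<open>
  The larger root of \<open>d a\<^sup>2 - (\<beta> - d \<gamma>) a + 1 = 0\<close>; the bound on \<open>d\<close> makes the discriminant positive.
\<close>
lemma coupling_exists: obtains a where "0 < a" "d * a\<^sup>2 + 1 = (\<beta> - d * \<gamma>) * a" "d \<le> a\<^sup>2"
proof -
  define b where "b = \<beta> - d * \<gamma>"
  have b: "0 < b" using d\<gamma>_small \<beta> d \<gamma> unfolding b_def by (smt (verit) mult_pos_pos)
  have "0 \<le> d * \<beta> * \<gamma>" "0 \<le> (d * \<gamma>)\<^sup>2" using d \<beta> \<gamma> by auto
  then have D: "4 * d < b\<^sup>2" using d_small by (simp add: b_def power2_eq_square algebra_simps)
  define s where "s = sqrt (b\<^sup>2 - 4 * d)"
  have s: "0 \<le> s" "s\<^sup>2 = b\<^sup>2 - 4 * d" using D by (auto simp: s_def)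
  define a where "a = (b + s) / (2 * d)"
  have e: "2 * d * a = b + s" using d by (simp add: a_def)
  have a0: "0 < a" using b s d by (simp add: a_def)
  have "4 * d * (d * a\<^sup>2 + 1 - b * a) = (2 * d * a)\<^sup>2 + 4 * d - 2 * b * (2 * d * a)"
    by (simp add: power2_eq_square algebra_simps)
  also have "\<dots> = 0" unfolding e using s by (simp add: power2_eq_square algebra_simps)
  finally have q: "d * a\<^sup>2 + 1 = b * a" using d by simp
  have "\<beta>\<^sup>2 < 1" using \<beta> by (simp add: abs_square_less_1)
  moreover have "0 \<le> d * \<beta> * \<gamma>" using d \<beta> \<gamma> by auto
  ultimately have d1: "d < 1" using d_small by (simp add: algebra_simps)
  have "b \<le> 2 * d * a" using e s by simp
  then have "b\<^sup>2 \<le> (2 * d * a)\<^sup>2" using b by (intro power_mono) auto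
  then have "4 * d < 4 * d * (d * a\<^sup>2)" using D by (simp add: power2_eq_square algebra_simps)
  then have "1 < d * a\<^sup>2" using d by simp
  also have "\<dots> \<le> 1 * a\<^sup>2" using d1 by (intro mult_right_mono) auto
  finally have "d \<le> a\<^sup>2" using d1 by simp
  with that[of a] a0 q show ?thesis by (simp add: b_def)
qed

text \<open>
  At such a point \<open>v'' = \<gamma> v + v^3 - u < 0\<close>. The even extension turns a minimum over the half-line into one over the line, also at \<open>0\<close>.
\<close>
lemma v_no_negative_min:
  assumes y: "0 \<le> y" "v y < 0" "0 \<le> u y" and e: "0 < e" and min: "\<And>t. 0 \<le> t \<Longrightarrow> \<bar>t - y\<bar> < e \<Longrightarrow> v y \<le> v t"
  shows False
proof -
  have "v y \<le> v t" if "\<bar>t - y\<bar> < e" for t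
    using min[of t] min[of "- t"] v_even[of t] that y by (cases "0 \<le> t") auto
  then have "0 \<le> \<gamma> * v y + v y ^ 3 - u \<bar>y\<bar>"
    using second_derivative_at_min(2)[OF e v_deriv _ v1_deriv] by blast
  moreover have "\<gamma> * v y < 0" "v y ^ 3 < 0" using \<gamma> y by (auto simp: mult_less_0_iff power_less_zero_eq)
  ultimately show False using y by simp
qed

text \<open>
  A minimum of \<open>z = u + a v\<close> beyond the point \<open>x2\<close> with \<open>z < 0\<close> is excluded by the equation for \<open>z\<close> if \<open>u < 0\<close> there. If \<open>u = 0\<close> there,
  then \<open>v\<close> itself has a negative local minimum, or is minimal at \<open>x2\<close> over the tail and hence has a negative minimum on \<open>[0, x2]\<close>;
  both contradict \<open>v_no_negative_min\<close>. Before \<open>x2\<close>, where \<open>u \<ge> 0\<close>, the same lemma applies directly.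
\<close>
lemma u_lower_bound:
  obtains a where "0 < a" "\<And>x. 0 \<le> x \<Longrightarrow> 0 \<le> v x" "\<And>x. 0 \<le> x \<Longrightarrow> 0 \<le> u x + a * v x"
proof -
  obtain a where a: "0 < a" "d * a\<^sup>2 + 1 = (\<beta> - d * \<gamma>) * a" "d \<le> a\<^sup>2" by (rule coupling_exists)
  \<comment> \<open>The coefficient of \<open>z\<close> in \<open>d z'' = k z + d a v^3 - u^2 (1 + \<beta> - u)\<close>.\<close>
  define k where "k = \<beta> - d * a"
  have ak: "a * k = 1 + d * a * \<gamma>" using a(2) by (simp add: k_def power2_eq_square algebra_simps)
  have "0 < a * k" unfolding ak using a d \<gamma> by (simp add: add_pos_pos)
  then have k: "0 < k" using a by (simp add: zero_less_mult_iff)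
  define z where "z x = u x + a * v x" for x
  have z_cont: "continuous_on A z" if "A \<subseteq> {0..}" for A
    unfolding z_def by (intro continuous_intros v_cont continuous_on_subset[OF u_cont that])
  have z_lim: "(z \<longlongrightarrow> 0) at_top"
    using tendsto_add[OF u_lim tendsto_mult_right_zero[OF v_lim, of a]] unfolding z_def by simp
  obtain x1 x2 where W: "W x1 x2" by (rule bands_exist)
  have beyond: "0 \<le> z q" if q: "x2 < ereal q" for q
  proof (rule ccontr)
    assume "\<not> 0 \<le> z q"
    then have zq: "z q < 0" by simp
    have "x2 \<noteq> \<infinity>" "x2 \<noteq> -\<infinity>" using q W_lt[OF W] by auto
    then obtain X where X: "x2 = ereal X" by (cases x2) auto
    have X0: "0 < x1" "x1 < X" "X < q" using W W_lt[OF W] q X by auto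
    have cX: "continuous_on {X..} z" by (rule z_cont) (use X0 in auto)
    obtain p where p: "X \<le> p" "\<And>t. X \<le> t \<Longrightarrow> z p \<le> z t" "z p \<le> z q"
      using decaying_attains_min[OF cX z_lim _ zq] X0 by (metis less_imp_le)
    have zp: "z p < 0" using p zq by simp
    have p0: "0 < p" using p X0 by simp
    \<comment> \<open>The equation for \<open>u\<close> is available in the first case only.\<close>
    consider "X < p" "u p < 0" | "X < p" "0 \<le> u p" | "p = X" using p by linarith
    then show False
    proof cases
      case 1
      obtain r0 where r0: "0 < r0" "\<And>t. 0 \<le> t \<Longrightarrow> \<bar>t - p\<bar> < r0 \<Longrightarrow> \<bar>u t - u p\<bar> < - u p"
        using u_near[of p "- u p"] 1 p0 by auto
      define r where "r = min r0 (p - X)"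
      have r: "0 < r" using r0 1 by (simp add: r_def)
      have EL: "EL t" if t: "\<bar>t - p\<bar> < r" for t
      proof (rule EL_right[OF W])
        have "X < t" using t by (simp add: r_def) linarith
        then show "x2 < ereal t" by (simp add: X)
        show "u t < 0" using r0(2)[of t] t \<open>X < t\<close> X0 by (auto simp: r_def)
      qed
      have d1: "(z has_real_derivative deriv u t + a * v1 t) (at t)" if "\<bar>t - p\<bar> < r" for t
        unfolding z_def by (intro DERIV_add DERIV_cmult EL_deriv EL that v_deriv)
      have d2: "((\<lambda>t. deriv u t + a * v1 t) has_real_derivative U2 p + a * (\<gamma> * v p + v p ^ 3 - u \<bar>p\<bar>)) (at p)"
        using r by (intro DERIV_add DERIV_cmult EL_deriv2 EL v1_deriv) auto
      have "0 \<le> U2 p + a * (\<gamma> * v p + v p ^ 3 - u \<bar>p\<bar>)"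
      proof (rule second_derivative_at_min(2)[OF r d1 _ d2])
        fix t assume "\<bar>t - p\<bar> < r"
        then have "X < t" by (simp add: r_def) linarith
        then show "z p \<le> z t" using p by simp
      qed
      then have "0 \<le> d * (U2 p + a * (\<gamma> * v p + v p ^ 3 - u p))" using d p0 by simp
      also have "\<dots> = k * z p + d * a * v p ^ 3 - (u p)\<^sup>2 * (1 + \<beta> - u p)"
      proof -
        have "d * U2 p = v p - f \<beta> (u p)" using p0 d by (simp add: U2_eq)
        then have "d * (U2 p + a * (\<gamma> * v p + v p ^ 3 - u p)) = v p - f \<beta> (u p) + d * a * (\<gamma> * v p + v p ^ 3 - u p)"
          by (simp add: algebra_simps)
        also have "\<dots> = (1 + d * a * \<gamma>) * v p + (\<beta> - d * a) * u p + d * a * v p ^ 3 - (u p)\<^sup>2 * (1 + \<beta> - u p)"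
          by (simp add: f_def power2_eq_square power3_eq_cube algebra_simps)
        finally show ?thesis unfolding ak[symmetric] by (simp add: z_def k_def algebra_simps)
      qed
      also have "\<dots> < 0"
      proof -
        have "k * z p < 0" using k zp by (simp add: mult_less_0_iff)
        moreover have "d * a * v p ^ 3 \<le> (u p)\<^sup>2 * (1 + \<beta> - u p)"
        proof (cases "v p \<le> 0")
          case True
          then have "d * a * v p ^ 3 \<le> 0" using d a by (simp add: mult_le_0_iff power_le_zero_eq)
          also have "0 \<le> (u p)\<^sup>2 * (1 + \<beta> - u p)" using 1 \<beta> by simp
          finally show ?thesis .
        next
          case False
          then have vp: "0 < v p" by simp
          have "d * (a * v p ^ 3) \<le> a\<^sup>2 * (a * v p ^ 3)" using a vp by (intro mult_right_mono) auto
          also have "\<dots> = (a * v p) ^ 3" by (simp add: power2_eq_square power3_eq_cube)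
          also have "\<dots> \<le> (- u p) ^ 3" using zp a vp by (intro power_mono) (auto simp: z_def)
          also have "\<dots> = (u p)\<^sup>2 * (- u p)" by (simp add: power2_eq_square power3_eq_cube)
          also have "\<dots> \<le> (u p)\<^sup>2 * (1 + \<beta> - u p)" using \<beta> by (intro mult_left_mono) auto
          finally show ?thesis by (simp add: mult.assoc)
        qed
        ultimately show ?thesis by linarith
      qed
      finally show False by simp
    next
      case 2
      have up: "u p = 0" using 2 W_right[OF W, of p] X by simp
      have "v p < 0" using zp up a by (simp add: z_def mult_less_0_iff)
      then show False
      proof (rule v_no_negative_min[OF less_imp_le[OF p0] _ 2(2), of "p - X"])
        fix t assume t: "0 \<le> t" "\<bar>t - p\<bar> < p - X"
        then have "X < t" by linarith
        then have "z p \<le> z t" "u t \<le> 0" using p W_right[OF W, of t] X by auto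
        then have "a * v p \<le> a * v t" using up by (simp add: z_def)
        then show "v p \<le> v t" using a by simp
      qed (use 2 in auto)
    next
      case 3
      have "0 \<le> u p" using W_mid[OF W, of p] 3 X X0 by simp
      then have "a * v p < 0" using zp by (simp add: z_def)
      then have vp: "v p < 0" using a by (simp add: mult_less_0_iff)
      have up: "u p = 0"
      proof (rule ccontr)
        assume "u p \<noteq> 0"
        then have pos: "0 < u p" using \<open>0 \<le> u p\<close> by simp
        obtain r where r: "0 < r" "\<And>t. 0 \<le> t \<Longrightarrow> \<bar>t - p\<bar> < r \<Longrightarrow> \<bar>u t - u p\<bar> < u p"
          using u_near[of p "u p"] p0 pos by auto
        have "0 < u (p + r / 2)" using r(2)[of "p + r/2"] r(1) p0 by auto
        moreover have "u (p + r/2) \<le> 0" using W_right[OF W, of "p + r/2"] X 3 r by simp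
        ultimately show False by simp
      qed
      have right: "v p \<le> v t" if "p \<le> t" for t
      proof (cases "t = p")
        case False
        then have "X < t" using that 3 by simp
        then have "z p \<le> z t" "u t \<le> 0" using p W_right[OF W, of t] X by auto
        then have "a * v p \<le> a * v t" using up by (simp add: z_def)
        then show ?thesis using a by simp
      qed simp
      have "continuous_on {0..p} v" by (rule v_cont)
      moreover have "{0..p} \<noteq> {}" using p0 by auto
      ultimately obtain m where m: "m \<in> {0..p}" "\<And>t. t \<in> {0..p} \<Longrightarrow> v m \<le> v t"
        using continuous_attains_inf[of "{0..p}" v] by auto
      have vm: "v m \<le> v p" using m(2)[of p] p0 by auto
      show False
      proof (rule v_no_negative_min[of m 1])
        show "0 \<le> m" using m by simp
        show "v m < 0" using vm vp by linarith
        show "0 \<le> u m"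
          using m W_left[OF W, of m] W_mid[OF W, of m] 3 X \<beta> by (cases "m \<le> x1") auto
        fix t :: real assume t: "0 \<le> t"
        show "v m \<le> v t" using m(2)[of t] right[of t] vm t by (cases "t \<le> p") auto
      qed simp
    qed
  qed
  have v_nn: "0 \<le> v q" if q: "0 \<le> q" for q
  proof (rule ccontr)
    assume "\<not> 0 \<le> v q"
    then have "v q < 0" by simp
    then obtain m where m: "0 \<le> m" "\<And>t. 0 \<le> t \<Longrightarrow> v m \<le> v t" "v m \<le> v q"
      using decaying_attains_min[OF v_cont v_lim q] by metis
    have vm: "v m < 0" using m \<open>v q < 0\<close> by simp
    have um: "u m < 0"
      using v_no_negative_min[OF m(1) vm, of 1] m(2) by fastforce
    then have "x2 < ereal m"
      using W_left[OF W m(1)] W_mid[OF W, of m] \<beta> by (cases "m \<le> x1") (auto simp: not_le[symmetric])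
    then have "0 \<le> z m" by (rule beyond)
    moreover have "a * v m < 0" using a vm by (simp add: mult_less_0_iff)
    ultimately show False using um by (simp add: z_def)
  qed
  have "0 \<le> u x + a * v x" if x: "0 \<le> x" for x
  proof (cases "x2 < ereal x")
    case True
    then show ?thesis using beyond by (simp add: z_def)
  next
    case False
    then have "0 \<le> u x"
      using W_left[OF W x] W_mid[OF W, of x] \<beta> by (cases "x \<le> x1") auto
    then show ?thesis using a v_nn[OF x] by simp
  qed
  with that[of a] a v_nn show ?thesis by blast
qed

text \<open>
  The strong maximum principle for \<open>v'' \<le> K v\<close>, obtained by integrating the factorization \<open>(D - \<kappa>) (D + \<kappa>) v \<le> 0\<close> with
  \<open>\<kappa>\<^sup>2 = K\<close> twice: if \<open>v\<close> vanishes at one point, then it vanishes identically, and so does \<open>u\<close>.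
\<close>
lemma v_pos: assumes "0 \<le> y" shows "0 < v y"
proof (rule ccontr)
  obtain a where a: "0 < a" "\<And>x. 0 \<le> x \<Longrightarrow> 0 \<le> v x" "\<And>x. 0 \<le> x \<Longrightarrow> 0 \<le> u x + a * v x"
    by (rule u_lower_bound) blast
  have v_abs: "v \<bar>x\<bar> = v x" for x using v_even[of x] by (auto simp: abs_if)
  have v0: "0 \<le> v x" for x using a(2)[of "\<bar>x\<bar>"] by (simp add: v_abs)
  assume "\<not> 0 < v y"
  then have vy: "v y = 0" using v0[of y] by simp
  have v1y: "v1 y = 0"
    using second_derivative_at_min(1)[OF zero_less_one v_deriv _ v1_deriv, of y] v0 vy by simp
  define K where "K = \<gamma> + 1 + a"
  define \<kappa> where "\<kappa> = sqrt K"
  have \<kappa>: "0 < \<kappa>" "\<kappa> * \<kappa> = K" using \<gamma> a by (auto simp: \<kappa>_def K_def)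
  have v2: "\<gamma> * v x + v x ^ 3 - u \<bar>x\<bar> \<le> K * v x" for x
  proof -
    have v1: "v x \<le> 1" using v_upper(1)[of "\<bar>x\<bar>"] by (simp add: v_abs)
    have "v x ^ 3 = v x * (v x * v x)" by (simp add: power3_eq_cube)
    also have "\<dots> \<le> v x * 1" using v0[of x] v1 by (intro mult_left_mono mult_le_one) auto
    finally have "v x ^ 3 \<le> v x" by simp
    moreover have "- u \<bar>x\<bar> \<le> a * v x" using a(3)[of "\<bar>x\<bar>"] by (simp add: v_abs)
    ultimately show ?thesis by (simp add: K_def algebra_simps)
  qed
  \<comment> \<open>Nonincreasing with \<open>g y = 0\<close>, hence nonnegative to the left of \<open>y\<close>; then \<open>v x * exp (\<kappa> * x)\<close> is
      nondecreasing there and ends with the value \<open>0\<close>.\<close>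
  define g where "g x = (v1 x + \<kappa> * v x) * exp (- \<kappa> * x)" for x
  have g_deriv: "(g has_real_derivative (\<gamma> * v x + v x ^ 3 - u \<bar>x\<bar> - K * v x) * exp (- \<kappa> * x)) (at x)" for x
  proof -
    have "(g has_real_derivative ((\<gamma> * v x + v x ^ 3 - u \<bar>x\<bar>) + \<kappa> * v1 x) * exp (- \<kappa> * x)
        + (exp (- \<kappa> * x) * (- \<kappa>)) * (v1 x + \<kappa> * v x)) (at x)"
      unfolding g_def by (intro DERIV_mult DERIV_add DERIV_cmult v1_deriv v_deriv) (auto intro!: derivative_eq_intros)
    then show ?thesis unfolding \<kappa>(2)[symmetric] by (rule DERIV_cong) (simp add: algebra_simps)
  qed
  have g_nn: "0 \<le> g x" if "x \<le> y" for x
  proof -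
    have "g y \<le> g x"
    proof (rule DERIV_nonpos_imp_nonincreasing[OF that])
      fix t
      have "(\<gamma> * v t + v t ^ 3 - u \<bar>t\<bar> - K * v t) * exp (- \<kappa> * t) \<le> 0"
        using v2[of t] by (simp add: mult_le_0_iff)
      then show "\<exists>D. (g has_real_derivative D) (at t) \<and> D \<le> 0" using g_deriv by blast
    qed
    then show ?thesis by (simp add: g_def vy v1y)
  qed
  have v_zero: "v x = 0" if "x \<le> y" for x
  proof -
    have "v x * exp (\<kappa> * x) \<le> v y * exp (\<kappa> * y)"
    proof (rule DERIV_nonneg_imp_nondecreasing[OF that])
      fix t assume "x \<le> t" "t \<le> y"
      have e: "((\<lambda>t. v t * exp (\<kappa> * t)) has_real_derivative v1 t * exp (\<kappa> * t) + (exp (\<kappa> * t) * \<kappa>) * v t) (at t)"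
        by (intro DERIV_mult v_deriv) (auto intro!: derivative_eq_intros)
      have "0 \<le> v1 t + \<kappa> * v t" using g_nn[OF \<open>t \<le> y\<close>] by (simp add: g_def zero_le_mult_iff)
      then have "0 \<le> (v1 t + \<kappa> * v t) * exp (\<kappa> * t)" by simp
      then have "0 \<le> v1 t * exp (\<kappa> * t) + (exp (\<kappa> * t) * \<kappa>) * v t" by (simp add: algebra_simps)
      with e show "\<exists>D. ((\<lambda>t. v t * exp (\<kappa> * t)) has_real_derivative D) (at t) \<and> 0 \<le> D" by blast
    qed
    then show ?thesis using v0[of x] vy by (simp add: mult_le_0_iff)
  qed
  have vz: "v x = 0" for x using v_zero[of x] v_zero[of "- x"] v_even[of x] assms by (cases "x \<le> y") auto
  then have "v = (\<lambda>_. 0)" by auto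
  then have "v1 x = 0" for x using DERIV_unique[OF v_deriv[of x]] by simp
  then have "v1 = (\<lambda>_. 0)" by auto
  then have "(v1 has_real_derivative 0) (at 0)" by simp
  from DERIV_unique[OF v1_deriv[of 0] this] have "\<gamma> * v 0 + v 0 ^ 3 - u \<bar>0\<bar> = 0" .
  then have "u 0 = 0" using vz[of 0] by simp
  moreover obtain x1 x2 where W: "W x1 x2" by (rule bands_exist)
  ultimately show False using W_left[OF W, of 0] W \<beta> by simp
qed

lemma U2_pos_if: "0 \<le> x \<Longrightarrow> f \<beta> (u x) \<le> 0 \<Longrightarrow> 0 < U2 x"
  using v_pos[of x] d by (simp add: U2_eq)

lemma f_nonpos_mid: "0 \<le> s \<Longrightarrow> s \<le> \<beta> \<Longrightarrow> f \<beta> s \<le> 0"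
  using \<beta> unfolding f_def by (intro mult_nonneg_nonpos mult_nonneg_nonneg) auto

text \<open>
  Here and in the next two lemmas \<open>f (u x) = 0\<close> at a contact, so \<open>d U'' = v > 0\<close>, and pushing \<open>u\<close> down would lower the energy.
\<close>
lemma u_less_1: assumes W: "W x1 x2" and x: "0 < x" "x < x1" shows "u x < 1"
proof (rule ccontr)
  assume "\<not> u x < 1"
  then have ux: "u x = 1" using W_left[OF W, of x] x by simp
  have b: "band_ok \<beta> M x1 x2 x t \<longleftrightarrow> \<beta> \<le> t \<and> t \<le> 1" for t using x by (auto simp: band_ok_def)
  have "ereal x < x2" using x W_lt[OF W] by (metis less_ereal.simps(1) less_trans)
  then have "0 \<le> (-1) * U2 x"
    by (intro contact_direction[OF W x(1), of "1 - \<beta>"]) (use x \<beta> ux b in auto)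
  moreover have "0 < U2 x" using x ux by (intro U2_pos_if) (auto simp: f_def)
  ultimately show False by simp
qed

lemma u_less_beta: assumes W: "W x1 x2" and x: "x1 < x" "ereal x < x2" shows "u x < \<beta>"
proof (rule ccontr)
  assume "\<not> u x < \<beta>"
  then have ux: "u x = \<beta>" using W_mid[OF W, of x] x by simp
  have b: "band_ok \<beta> M x1 x2 x t \<longleftrightarrow> 0 \<le> t \<and> t \<le> \<beta>" for t using x by (auto simp: band_ok_def)
  have "0 \<le> (-1) * U2 x"
    by (intro contact_direction[OF W, of _ \<beta>]) (use x W \<beta> ux b in auto)
  moreover have "0 < U2 x" using x ux W by (intro U2_pos_if) (auto simp: f_def)
  ultimately show False by simp
qed

lemma u_less_0: assumes W: "W x1 x2" and x: "x2 < ereal x" shows "u x < 0"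
proof (rule ccontr)
  assume "\<not> u x < 0"
  then have ux: "u x = 0" using W_right[OF W x] by simp
  have x1: "x1 < x" using W_lt[OF W] x by (metis less_ereal.simps(1) less_trans)
  have b: "band_ok \<beta> M x1 x2 x t \<longleftrightarrow> - (M + 1) \<le> t \<and> t \<le> 0" for t using x x1 by (auto simp: band_ok_def not_le)
  have "0 \<le> (-1) * U2 x"
    by (intro contact_direction[OF W, of _ 1]) (use x x1 W M_pos ux b in auto)
  moreover have "0 < U2 x" using x1 ux W by (intro U2_pos_if) (auto simp: f_def)
  ultimately show False by simp
qed

end

section \<open>Crossings of the levels \<open>\<beta>\<close> and \<open>0\<close>\<close>

text \<open>
  By the mean value theorem \<open>h1\<close> is close to \<open>h (x + 1) - h x\<close> up to the size of \<open>h2\<close>.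
\<close>
lemma derivative_tendsto_0:
  fixes h h1 h2 :: "real \<Rightarrow> real"
  assumes d: "\<And>t. X < t \<Longrightarrow> (h has_real_derivative h1 t) (at t)" "\<And>t. X < t \<Longrightarrow> (h1 has_real_derivative h2 t) (at t)"
    and h: "(h \<longlongrightarrow> 0) at_top" and h2: "(h2 \<longlongrightarrow> 0) at_top"
  shows "(h1 \<longlongrightarrow> 0) at_top"
proof (rule tendstoI)
  fix e :: real assume e: "0 < e"
  have "\<forall>\<^sub>F x in at_top. dist (h x) 0 < e / 4" "\<forall>\<^sub>F x in at_top. dist (h2 x) 0 < e / 4"
    using tendstoD[OF h, of "e / 4"] tendstoD[OF h2, of "e / 4"] e by auto
  then have "\<forall>\<^sub>F x in at_top. \<bar>h x\<bar> < e / 4 \<and> \<bar>h2 x\<bar> < e / 4" by eventually_elim simp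
  then obtain Y where Y: "\<And>x. Y \<le> x \<Longrightarrow> \<bar>h x\<bar> < e / 4 \<and> \<bar>h2 x\<bar> < e / 4"
    by (auto simp: eventually_at_top_linorder)
  have "\<bar>h1 x\<bar> < e" if x: "max Y (X + 1) \<le> x" for x
  proof -
    obtain s where s: "x < s" "s < x + 1" "h (x + 1) - h x = (x + 1 - x) * h1 s"
      using MVT2[of x "x + 1" h h1] d(1) x by force
    obtain r where r: "x < r" "r < s" "h1 s - h1 x = (s - x) * h2 r"
      using MVT2[of x s h1 h2] d(2) x s by force
    have "\<bar>h1 s\<bar> < e / 2" using s Y[of x] Y[of "x + 1"] x by auto
    moreover have "\<bar>h1 s - h1 x\<bar> \<le> 1 * (e / 4)"
      unfolding r(3) abs_mult using Y[of r] r s x by (intro mult_mono) auto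
    ultimately show ?thesis using e by linarith
  qed
  then show "\<forall>\<^sub>F x in at_top. dist (h1 x) 0 < e"
    unfolding eventually_at_top_linorder by (intro exI[of _ "max Y (X + 1)"]) auto
qed

text \<open>
  A second crossing would leave a hump, and a hump has an interior maximum.
\<close>
lemma single_crossing:
  fixes w :: "real \<Rightarrow> real"
  assumes pq: "p < q" and c: "continuous_on {p..q} w" and ends: "l < w p" "w q < l"
    and nomax: "\<And>m e. p < m \<Longrightarrow> m < q \<Longrightarrow> 0 < e \<Longrightarrow> \<bar>p - m\<bar> \<ge> e \<Longrightarrow> \<bar>q - m\<bar> \<ge> e \<Longrightarrow>
      (\<And>t. \<bar>t - m\<bar> < e \<Longrightarrow> w t \<le> w m) \<Longrightarrow> False"
  obtains t where "p < t" "t < q" "\<And>s. p \<le> s \<Longrightarrow> s \<le> t \<Longrightarrow> l \<le> w s" "\<And>s. t \<le> s \<Longrightarrow> s \<le> q \<Longrightarrow> w s \<le> l"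
proof -
  obtain t where t: "p \<le> t" "t \<le> q" "w t = l"
    using IVT2'[of w q l p] pq c ends by auto
  have tpq: "p < t" "t < q" using t ends by (auto simp: order_less_le)
  have hump: False if ab: "p \<le> a" "a < b" "b \<le> q" and m0: "m0 \<in> {a..b}" "w a < w m0" "w b < w m0" for a b m0
  proof -
    have "continuous_on {a..b} w" using c by (rule continuous_on_subset) (use ab in auto)
    moreover have "{a..b} \<noteq> {}" using ab by auto
    ultimately obtain m where m: "m \<in> {a..b}" "\<And>t. t \<in> {a..b} \<Longrightarrow> w t \<le> w m"
      using continuous_attains_sup[of "{a..b}" w] by auto
    have "w m0 \<le> w m" using m(2) m0 by simp
    then have "m \<noteq> a" "m \<noteq> b" using m0 by auto
    then have am: "a < m" "m < b" using m by auto
    show False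
    proof (rule nomax[of m "min (m - a) (b - m)"])
      fix t assume "\<bar>t - m\<bar> < min (m - a) (b - m)"
      then have "a \<le> t" "t \<le> b" unfolding min_less_iff_conj by linarith+
      then show "w t \<le> w m" using m(2) by simp
    qed (use am ab in auto)
  qed
  show ?thesis
  proof (rule that[OF tpq])
    fix s assume s: "p \<le> s" "s \<le> t"
    show "l \<le> w s"
    proof (rule ccontr)
      assume "\<not> l \<le> w s"
      then show False using hump[of s q t] s tpq t ends by auto
    qed
  next
    fix s assume s: "t \<le> s" "s \<le> q"
    show "w s \<le> l"
    proof (rule ccontr)
      assume "\<not> w s \<le> l"
      moreover then have "s \<noteq> t" using t by auto
      ultimately show False using hump[of t q s] s tpq t ends by auto
    qed
  qed
qed

lemma at_within_tail: assumes "a < (y::real)" shows "at y within {a..} = at y"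
  using assms by (intro at_within_interior) auto

context pulse
begin

text \<open>
  Where \<open>d u'' = v - f u > 0\<close> the function \<open>u\<close> has no local maximum.
\<close>
lemma no_local_max:
  assumes "EL x" "0 < U2 x" "e > 0" "\<And>t. \<bar>t - x\<bar> < e \<Longrightarrow> u t \<le> u x" shows False
proof -
  obtain e' where e': "0 < e'" "\<And>t. \<bar>t - x\<bar> < e' \<Longrightarrow> EL t" using EL_nbhd[OF assms(1)] by blast
  have "U2 x \<le> 0"
    by (rule second_derivative_at_max(2)[of "min e e'" x u "deriv u"])
      (use assms e' in \<open>auto intro: EL_deriv EL_deriv2\<close>)
  then show False using assms by simp
qed

lemma gap: assumes "ereal x < x2" "0 < r" obtains t where "x < t" "t < x + r" "ereal t < x2"
proof (cases x2)
  case (real X)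
  define s where "s = min r (X - x)"
  have "0 < s" "s \<le> r" "s \<le> X - x" using assms real by (auto simp: s_def)
  then show ?thesis using real by (intro that[of "x + s / 2"]) auto
qed (use assms that[of "x + r / 2"] in auto)

lemma u_x1: assumes W: "W x1 x2" shows "u x1 = \<beta>"
proof (rule ccontr)
  assume "u x1 \<noteq> \<beta>"
  then have gt: "\<beta> < u x1" using W_left[OF W, of x1] W by auto
  obtain r where r: "0 < r" "\<And>t. 0 \<le> t \<Longrightarrow> \<bar>t - x1\<bar> < r \<Longrightarrow> \<bar>u t - u x1\<bar> < u x1 - \<beta>"
    using u_near[of x1 "u x1 - \<beta>"] gt W by auto
  obtain t where t: "x1 < t" "t < x1 + r" "ereal t < x2" using gap[OF W_lt[OF W] r(1)] by blast
  then have "\<beta> < u t" using r(2)[of t] W by auto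
  then show False using W_mid[OF W t(1) less_imp_le[OF t(3)]] by simp
qed

lemma u_x2: assumes W: "W x1 (ereal X)" shows "u X = 0"
proof (rule ccontr)
  assume "u X \<noteq> 0"
  have X: "x1 < X" using W_lt[OF W] by simp
  then have pos: "0 < u X" using \<open>u X \<noteq> 0\<close> W_mid[OF W, of X] by auto
  obtain r where r: "0 < r" "\<And>t. 0 \<le> t \<Longrightarrow> \<bar>t - X\<bar> < r \<Longrightarrow> \<bar>u t - u X\<bar> < u X"
    using u_near[of X "u X"] pos X W by auto
  have "0 < u (X + r/2)" using r(2)[of "X + r/2"] r(1) X W by auto
  then show False using W_right[OF W, of "X + r/2"] r by simp
qed

text \<open>
  Suppose \<open>u y = 0\<close>. After \<open>y\<close> a positive value would produce a maximum of \<open>u\<close> in the convex range, so \<open>u\<close> vanishes up to \<open>x2\<close>. Then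
  \<open>y\<close> may serve as the second transition point instead of \<open>x2\<close>, and \<open>u_less_0\<close> contradicts the zeros behind \<open>y\<close>.
\<close>
lemma u_pos_mid: assumes W: "W x1 x2" and y: "x1 < y" "ereal y < x2" shows "0 < u y"
proof (rule ccontr)
  assume "\<not> 0 < u y"
  then have uy: "u y = 0" using W_mid[OF W, of y] y by simp
  have y0: "0 < y" using W y by simp
  have zero: "u t = 0" if t: "y < t" "ereal t < x2" for t
  proof (rule ccontr)
    assume "u t \<noteq> 0"
    then have ut: "0 < u t" using W_mid[OF W _ less_imp_le[OF t(2)]] t y by auto
    have "\<exists>m. y < m \<and> ereal m < x2 \<and> 0 < u m \<and> (\<forall>s. y < s \<and> ereal s < x2 \<longrightarrow> u s \<le> u m)"
    proof (cases "x2 = \<infinity>")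
      case True
      have "continuous_on {y..} u" using u_cont by (rule continuous_on_subset) (use y0 in auto)
      then obtain m where "y \<le> m" "\<And>x. y \<le> x \<Longrightarrow> u x \<le> u m" "u t \<le> u m"
        using decaying_attains_max[OF _ u_lim _ ut] t by (metis less_imp_le)
      then show ?thesis using True ut uy by (intro exI[of _ m]) (auto simp: order_less_le)
    next
      case False
      then obtain X where X: "x2 = ereal X" using y by (cases x2) auto
      have "continuous_on {y..X} u" using u_cont by (rule continuous_on_subset) (use y0 in auto)
      moreover have "{y..X} \<noteq> {}" using y X by auto
      ultimately obtain m where m: "m \<in> {y..X}" "\<And>s. s \<in> {y..X} \<Longrightarrow> u s \<le> u m"
        using continuous_attains_sup[of "{y..X}" u] by auto
      have "u t \<le> u m" using m(2)[of t] t X by auto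
      moreover have "u X = 0" using u_x2 W X by auto
      ultimately have "m \<noteq> y" "m \<noteq> X" using uy ut by auto
      then show ?thesis using m X \<open>u t \<le> u m\<close> ut by (intro exI[of _ m]) auto
    qed
    then obtain m where m: "y < m" "ereal m < x2" "0 < u m" "\<And>s. y < s \<Longrightarrow> ereal s < x2 \<Longrightarrow> u s \<le> u m" by blast
    have um: "u m < \<beta>" using u_less_beta[OF W] m y by auto
    have EL: "EL m" using m um y by (intro EL_mid[OF W]) auto
    have "0 < U2 m" using m um y0 by (intro U2_pos_if f_nonpos_mid) auto
    obtain m' where m': "m < m'" "ereal m' < x2" using gap[OF m(2) zero_less_one] by blast
    show False
    proof (rule no_local_max[OF EL \<open>0 < U2 m\<close>, of "min (m - y) (m' - m)"])
      fix s assume s: "\<bar>s - m\<bar> < min (m - y) (m' - m)"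
      then have "y < s" "s < m'" by auto
      then have "ereal s < x2" using m' by (metis less_ereal.simps(1) less_trans)
      then show "u s \<le> u m" using m(4) \<open>y < s\<close> by blast
    qed (use m m' in auto)
  qed
  have W': "W x1 (ereal y)"
    unfolding bands_def
  proof (intro conjI allI impI)
    show "0 < x1" "0 \<le> x1" "ereal x1 < ereal y" using W y by auto
    fix x :: real assume x: "0 \<le> x"
    consider "x \<le> x1" | "x1 < x" "x \<le> y" | "y < x" "ereal x < x2" | "y < x" "ereal x = x2" | "y < x" "x2 < ereal x" by fastforce
    then show "band_ok \<beta> M x1 (ereal y) x (u x)"
    proof cases
      case 1
      then show ?thesis using W_left[OF W x] by (simp add: band_ok_def)
    next
      case 2
      then have "ereal x \<le> x2" using y by (metis ereal_less_eq(3) less_imp_le order_trans)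
      then show ?thesis using 2 W_mid[OF W, of x] by (simp add: band_ok_def)
    next
      case 3
      then show ?thesis using zero[of x] y M_pos by (simp add: band_ok_def)
    next
      case 4
      then have "u x = 0" using u_x2 W by auto
      then show ?thesis using 4 y M_pos by (simp add: band_ok_def)
    next
      case 5
      then show ?thesis using W_right[OF W, of x] y by (simp add: band_ok_def)
    qed
  qed
  obtain t where t: "y < t" "ereal t < x2" using gap[OF y(2) zero_less_one] by blast
  have "u t < 0" using u_less_0[OF W', of t] t by simp
  then show False using zero[of t] t by simp
qed

lemma U2_near_pos: assumes "0 < U2 x" obtains r where "0 < r" "\<And>t. \<bar>t - x\<bar> < r \<Longrightarrow> 0 < U2 t"
proof -
  obtain r where "0 < r" "\<And>t. \<bar>t - x\<bar> < r \<Longrightarrow> \<bar>U2 t - U2 x\<bar> < U2 x"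
    using U2_cont[of UNIV] assms unfolding continuous_on_iff dist_real_def by (metis UNIV_I)
  then show ?thesis using that[of r] by force
qed

text \<open>
  As in \<open>u_pos_mid\<close>: close to \<open>x1\<close> the equation makes \<open>u\<close> convex above \<open>\<beta>\<close>, so a contact there forces a flat piece, and the contact point
  can replace \<open>x1\<close>, against \<open>u_less_beta\<close>.
\<close>
lemma left_of_x1:
  assumes W: "W x1 x2"
  obtains r where "0 < r" "r < x1" "\<And>t. x1 - r \<le> t \<Longrightarrow> t < x1 \<Longrightarrow> \<beta> < u t"
proof -
  have "0 < U2 x1" using W u_x1[OF W] by (intro U2_pos_if) (auto simp: f_def)
  then obtain r0 where r0: "0 < r0" "\<And>t. \<bar>t - x1\<bar> < r0 \<Longrightarrow> 0 < U2 t" by (rule U2_near_pos) blast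
  define r where "r = min r0 x1 / 2"
  have r: "0 < r" "r < r0" "r < x1" using r0 W by (auto simp: r_def)
  have "\<beta> < u t" if t: "x1 - r \<le> t" "t < x1" for t
  proof (rule ccontr)
    assume "\<not> \<beta> < u t"
    then have ut: "u t = \<beta>" using W_left[OF W, of t] t r by auto
    have t0: "0 < t" using t r by linarith
    have flat: "u s = \<beta>" if s: "t \<le> s" "s \<le> x1" for s
    proof (rule ccontr)
      assume "u s \<noteq> \<beta>"
      then have us: "\<beta> < u s" using W_left[OF W, of s] s t0 by auto
      have "continuous_on {t..x1} u" using u_cont by (rule continuous_on_subset) (use t0 in auto)
      moreover have "{t..x1} \<noteq> {}" using t by auto
      ultimately obtain m where m: "m \<in> {t..x1}" "\<And>s. s \<in> {t..x1} \<Longrightarrow> u s \<le> u m"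
        using continuous_attains_sup[of "{t..x1}" u] by auto
      have um: "\<beta> < u m" using m(2)[of s] s us by auto
      then have "m \<noteq> t" "m \<noteq> x1" using ut u_x1[OF W] by auto
      then have mm: "t < m" "m < x1" using m by auto
      have EL: "EL m" using mm t0 um u_less_1[OF W, of m] by (intro EL_left[OF W]) auto
      show False
      proof (rule no_local_max[OF EL _ , of "min (m - t) (x1 - m)"])
        show "0 < U2 m" using mm t r by (intro r0) auto
        fix s assume "\<bar>s - m\<bar> < min (m - t) (x1 - m)"
        then have "t \<le> s" "s \<le> x1" unfolding min_less_iff_conj by linarith+
        then show "u s \<le> u m" using m(2) by simp
      qed (use mm in auto)
    qed
    have W': "W t x2"
      unfolding bands_def
    proof (intro conjI allI impI)
      have tx2: "ereal t < x2" using W_lt[OF W] t by (metis less_ereal.simps(1) less_trans)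
      show "0 < t" "0 \<le> t" "ereal t < x2" using t0 tx2 by auto
      fix x :: real assume x: "0 \<le> x"
      consider "x \<le> t" | "t < x" "x \<le> x1" | "x1 < x" by fastforce
      then show "band_ok \<beta> M t x2 x (u x)"
      proof cases
        case 1
        then show ?thesis using W_left[OF W x] t by (simp add: band_ok_def)
      next
        case 2
        then have "ereal x \<le> x2" using W_lt[OF W] by (metis ereal_less_eq(3) less_imp_le order_trans)
        then show ?thesis using 2 flat[of x] \<beta> by (simp add: band_ok_def)
      next
        case 3
        then show ?thesis using W_band[OF W x] t by (simp add: band_ok_def)
      qed
    qed
    have "u ((t + x1) / 2) < \<beta>"
    proof (rule u_less_beta[OF W'])
      have "ereal ((t + x1) / 2) < ereal x1" using t by simp
      then show "ereal ((t + x1) / 2) < x2" using W_lt[OF W] by (rule less_trans)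
    qed (use t in auto)
    then show False using flat[of "(t + x1) / 2"] t by simp
  qed
  with that r show ?thesis by blast
qed

lemma affine_of_EL:
  assumes "\<And>t. t \<in> {p<..<q} \<Longrightarrow> EL t"
  obtains m c where "\<And>t. t \<in> {p<..<q} \<Longrightarrow> u t = U t + (m * t + c)"
proof -
  have "\<exists>m. \<forall>t\<in>{p<..<q}. deriv u t - U1 t = m"
  proof (rule has_field_derivative_zero_constant)
    fix t assume "t \<in> {p<..<q}"
    then have "((\<lambda>t. deriv u t - U1 t) has_real_derivative U2 t - U2 t) (at t)"
      by (intro DERIV_diff EL_deriv2 assms U1_deriv)
    then show "((\<lambda>t. deriv u t - U1 t) has_real_derivative 0) (at t within {p<..<q})"
      by (simp add: has_field_derivative_at_within)
  qed auto
  then obtain m where m: "\<And>t. t \<in> {p<..<q} \<Longrightarrow> deriv u t - U1 t = m" by blast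
  have "\<exists>c. \<forall>t\<in>{p<..<q}. u t - U t - m * t = c"
  proof (rule has_field_derivative_zero_constant)
    fix t assume t: "t \<in> {p<..<q}"
    then have "((\<lambda>t. u t - U t - m * t) has_real_derivative deriv u t - U1 t - m * 1) (at t)"
      by (intro DERIV_diff EL_deriv assms U_deriv DERIV_cmult DERIV_ident)
    then show "((\<lambda>t. u t - U t - m * t) has_real_derivative 0) (at t within {p<..<q})"
      using m[OF t] by (simp add: has_field_derivative_at_within)
  qed auto
  then obtain c where "\<And>t. t \<in> {p<..<q} \<Longrightarrow> u t - U t - m * t = c" by blast
  then have "\<And>t. t \<in> {p<..<q} \<Longrightarrow> u t = U t + (m * t + c)" by (simp add: algebra_simps)
  then show ?thesis by (rule that)
qed

text \<open>
  On each side \<open>u - U\<close> is affine, and one vanishing kink matches the slopes.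
\<close>
lemma EL_across:
  assumes r: "0 < r" "r \<le> x" and L: "\<And>t. t \<in> {x - r<..<x} \<Longrightarrow> EL t" and R: "\<And>t. t \<in> {x<..<x + r} \<Longrightarrow> EL t"
    and ab: "x - r < a" "a < x" "x < b" "b < x + r" and k: "kink u a x b = kink U a x b"
  shows "EL x"
proof -
  obtain m1 c1 where 1: "\<And>t. t \<in> {x - r<..<x} \<Longrightarrow> u t = U t + (m1 * t + c1)" using affine_of_EL[OF L] by blast
  obtain m2 c2 where 2: "\<And>t. t \<in> {x<..<x + r} \<Longrightarrow> u t = U t + (m2 * t + c2)" using affine_of_EL[OF R] by blast
  have x0: "0 < x" using r by simp
  have cu: "isCont u x"
    using u_cont x0 by (simp add: continuous_on_interior)
  have cU: "isCont U x" using U_deriv by (rule DERIV_isCont)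
  have g: "isCont (\<lambda>t. u t - U t - (m * t + c)) x" for m c
    by (intro continuous_intros cu cU)
  have e1: "u x = U x + (m1 * x + c1)"
  proof -
    have "((\<lambda>t. u t - U t - (m1 * t + c1)) \<longlongrightarrow> u x - U x - (m1 * x + c1)) (at_left x)"
      using g by (meson continuous_within filterlim_at_split isCont_def)
    moreover have "x - r < x" using r by simp
    from eventually_at_left_real[OF this] have "\<forall>\<^sub>F t in at_left x. u t - U t - (m1 * t + c1) = 0"
      by eventually_elim (auto simp: 1)
    then have "((\<lambda>t. u t - U t - (m1 * t + c1)) \<longlongrightarrow> 0) (at_left x)"
      by (rule tendsto_eventually)
    ultimately have "u x - U x - (m1 * x + c1) = 0"
      using tendsto_unique trivial_limit_at_left_real by blast
    then show ?thesis by simp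
  qed
  have e2: "u x = U x + (m2 * x + c2)"
  proof -
    have "((\<lambda>t. u t - U t - (m2 * t + c2)) \<longlongrightarrow> u x - U x - (m2 * x + c2)) (at_right x)"
      using g by (meson continuous_within filterlim_at_split isCont_def)
    moreover have "x < x + r" using r by simp
    from eventually_at_right_real[OF this] have "\<forall>\<^sub>F t in at_right x. u t - U t - (m2 * t + c2) = 0"
      by eventually_elim (auto simp: 2)
    then have "((\<lambda>t. u t - U t - (m2 * t + c2)) \<longlongrightarrow> 0) (at_right x)"
      by (rule tendsto_eventually)
    ultimately have "u x - U x - (m2 * x + c2) = 0"
      using tendsto_unique trivial_limit_at_right_real by blast
    then show ?thesis by simp
  qed
  have "kink (\<lambda>t. u t - U t) a x b = 0" using k kink_diff[of a x b] by simp
  moreover have "(u b - U b) - (u x - U x) = m2 * (b - x)"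
    using 2[of b] ab e2 by (simp add: algebra_simps)
  moreover have "(u x - U x) - (u a - U a) = m1 * (x - a)"
    using 1[of a] ab e1 by (simp add: algebra_simps)
  ultimately have m: "m2 = m1" using ab by (simp add: kink_def)
  then have c: "c2 = c1" using e1 e2 by simp
  show ?thesis
  proof (rule EL_of_affine[where p="x - r" and q="x + r" and m=m1 and c=c1])
    fix t assume "t \<in> {x - r<..<x + r}"
    then show "u t = U t + (m1 * t + c1)"
      using 1[of t] 2[of t] e1 m c by (cases t x rule: linorder_cases) auto
  qed (use r in auto)
qed

text \<open>
  With \<open>u'' > 0\<close> on both sides, adding or subtracting a small hat with peak at \<open>x\<close> only moves the crossing point, so that both
  perturbations are admissible. The level \<open>l\<close> is \<open>\<beta>\<close> or \<open>0\<close>, and the last hypothesis says that functions crossing it once are admissible.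
\<close>
lemma EL_crossing:
  assumes r: "0 < r" "r \<le> x"
    and L: "\<And>t. t \<in> {x - r<..<x} \<Longrightarrow> EL t \<and> 0 < U2 t \<and> l < u t"
    and R: "\<And>t. t \<in> {x<..<x + r} \<Longrightarrow> EL t \<and> 0 < U2 t \<and> u t < l"
    and ux: "u x = l" and \<delta>: "0 < \<delta>"
    and adm': "\<And>w t. w \<in> H1 \<Longrightarrow> x - r < t \<Longrightarrow> t < x + r \<Longrightarrow> (\<And>s. \<bar>w s - u s\<bar> \<le> \<delta>) \<Longrightarrow> (\<And>s. \<bar>s - x\<bar> \<ge> r \<Longrightarrow> w s = u s) \<Longrightarrow>
       (\<And>s. x - r < s \<Longrightarrow> s \<le> t \<Longrightarrow> l \<le> w s) \<Longrightarrow> (\<And>s. t \<le> s \<Longrightarrow> s < x + r \<Longrightarrow> w s \<le> l) \<Longrightarrow> w \<in> admissible \<beta> M"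
  shows "EL x"
proof -
  define a where "a = x - r / 2"
  define b where "b = x + r / 2"
  have ab: "x - r < a" "a < x" "x < b" "b < x + r" "0 < a" using r by (auto simp: a_def b_def)
  define h where "h = hat a x b"
  note hb = hat_bounds[OF ab(2,3), folded h_def] and ho = hat_outside[OF ab(2,3), folded h_def]
  have hx: "h x = 1" using hat_peak[OF ab(2,3)] by (simp add: h_def)
  have ua: "l < u a" and ub: "u b < l" using L[of a] R[of b] ab by auto
  have uge: "l \<le> u s" if "x - r < s" "s \<le> x" for s using L[of s] that ux by (cases "s = x") auto
  have ule: "u s \<le> l" if "x \<le> s" "s < x + r" for s using R[of s] that ux by (cases "s = x") auto
  have nomax: False
    if m: "(a < m \<and> m < x) \<or> (x < m \<and> m < b)" and e: "0 < e" "\<bar>a - m\<bar> \<ge> e" "\<bar>x - m\<bar> \<ge> e" "\<bar>b - m\<bar> \<ge> e"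
      and max: "\<And>t. \<bar>t - m\<bar> < e \<Longrightarrow> u t + c * h t \<le> u m + c * h m" for m e c
  proof -
    have "\<exists>k. \<forall>t. \<bar>t - m\<bar> < e \<longrightarrow> EL t \<and> 0 < U2 t \<and> (h has_real_derivative k) (at t)"
      using m
    proof
      assume m: "a < m \<and> m < x"
      have "EL t \<and> 0 < U2 t \<and> (h has_real_derivative 1 / (x - a)) (at t)" if t: "\<bar>t - m\<bar> < e" for t
      proof -
        have at: "a < t" "t < x" using t e m by auto
        have "((\<lambda>t. (t - a) / (x - a)) has_real_derivative (1 - 0) / (x - a)) (at t)"
          by (intro DERIV_cdivide DERIV_diff DERIV_const DERIV_ident)
        then have "((\<lambda>t. (t - a) / (x - a)) has_real_derivative 1 / (x - a)) (at t)" by simp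
        then have "(h has_real_derivative 1 / (x - a)) (at t)"
          by (rule has_field_derivative_transform_within_open[where S="{a<..<x}"])
            (use at ab hat_left[OF ab(2,3)] in \<open>auto simp: h_def\<close>)
        then show ?thesis using L[of t] at ab by auto
      qed
      then show ?thesis by blast
    next
      assume m: "x < m \<and> m < b"
      have "EL t \<and> 0 < U2 t \<and> (h has_real_derivative (0 - 1) / (b - x)) (at t)" if t: "\<bar>t - m\<bar> < e" for t
      proof -
        have at: "x < t" "t < b" using t e m by auto
        have "((\<lambda>t. (b - t) / (b - x)) has_real_derivative (0 - 1) / (b - x)) (at t)"
          by (intro DERIV_cdivide DERIV_diff DERIV_const DERIV_ident)
        then have "(h has_real_derivative (0 - 1) / (b - x)) (at t)"
          by (rule has_field_derivative_transform_within_open[where S="{x<..<b}"])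
            (use at ab hat_right[OF ab(2,3)] in \<open>auto simp: h_def\<close>)
        then show ?thesis using R[of t] at ab by auto
      qed
      then show ?thesis by blast
    qed
    then obtain k where k: "\<And>t. \<bar>t - m\<bar> < e \<Longrightarrow> EL t \<and> 0 < U2 t \<and> (h has_real_derivative k) (at t)" by blast
    have "U2 m + 0 \<le> 0"
    proof (rule second_derivative_at_max(2)[where e=e and m=m and h="\<lambda>t. u t + c * h t" and ?h1.0="\<lambda>t. deriv u t + c * k"])
      show "((\<lambda>t. u t + c * h t) has_real_derivative deriv u t + c * k) (at t)" if "\<bar>t - m\<bar> < e" for t
        using k[OF that] by (intro DERIV_add DERIV_cmult EL_deriv) auto
      show "((\<lambda>t. deriv u t + c * k) has_real_derivative U2 m + 0) (at m)"
        using k[of m] e by (intro DERIV_add DERIV_const EL_deriv2) auto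
    qed (use e max in auto)
    then show False using k[of m] e by simp
  qed
  define \<epsilon>0 where "\<epsilon>0 = min \<delta> (min (u a - l) (l - u b))"
  have \<epsilon>0: "0 < \<epsilon>0" using \<delta> ua ub by (simp add: \<epsilon>0_def)
  have H: "(\<lambda>t. u t + c * h t) \<in> H1" for c
    unfolding h_def by (intro H1_add_scale(1) u_H1 hat_H1 ab)
  have ch: "continuous_on {p..q} (\<lambda>t. u t + c * h t)" if "0 \<le> p" for p q c
    using H1_continuous[OF H, of c] by (rule continuous_on_subset) (use that in auto)
  have small: "\<bar>(u s + c * h s) - u s\<bar> \<le> \<delta>" if "\<bar>c\<bar> < \<epsilon>0" for c s
  proof -
    have "\<bar>c * h s\<bar> \<le> \<bar>c\<bar> * 1" unfolding abs_mult using hb[of s] by (intro mult_left_mono) auto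
    then show ?thesis using that by (simp add: \<epsilon>0_def)
  qed
  have out: "u s + c * h s = u s" if "r \<le> \<bar>s - x\<bar>" for s c
  proof -
    have "s \<le> a \<or> b \<le> s" using that ab r unfolding a_def b_def by linarith
    then show ?thesis using ho by simp
  qed
  have up: "(\<lambda>t. u t + \<epsilon> * h t) \<in> admissible \<beta> M" if \<epsilon>: "0 < \<epsilon>" "\<epsilon> < \<epsilon>0" for \<epsilon>
  proof -
    let ?w = "\<lambda>t. u t + \<epsilon> * h t"
    obtain t where t: "x < t" "t < b" "\<And>s. x \<le> s \<Longrightarrow> s \<le> t \<Longrightarrow> l \<le> ?w s" "\<And>s. t \<le> s \<Longrightarrow> s \<le> b \<Longrightarrow> ?w s \<le> l"
    proof (rule single_crossing[of x b ?w l])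
      show "l < ?w x" "?w b < l" using ux hx \<epsilon> ub ho[of b] by auto
      show "continuous_on {x..b} ?w" using r by (intro ch) auto
      fix m e assume "x < m" "m < b" "0 < e" "e \<le> \<bar>x - m\<bar>" "e \<le> \<bar>b - m\<bar>" "\<And>t. \<bar>t - m\<bar> < e \<Longrightarrow> ?w t \<le> ?w m"
      then show False using ab by (intro nomax[of m e \<epsilon>]) auto
    qed (use ab in auto)
    show ?thesis
    proof (rule adm'[OF H, of t])
      show "\<bar>?w s - u s\<bar> \<le> \<delta>" for s using \<epsilon> by (intro small) auto
      show "l \<le> ?w s" if "x - r < s" "s \<le> t" for s
        using t(3)[of s] uge[of s] that hb(1)[of s] \<epsilon> by (cases "x \<le> s") (auto intro: order_trans)
      show "?w s \<le> l" if "t \<le> s" "s < x + r" for s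
        using t(4)[of s] ule[of s] that ho[of s] t by (cases "s \<le> b") auto
    qed (use t ab out in auto)
  qed
  have down: "(\<lambda>t. u t + (- \<epsilon>) * h t) \<in> admissible \<beta> M" if \<epsilon>: "0 < \<epsilon>" "\<epsilon> < \<epsilon>0" for \<epsilon>
  proof -
    let ?w = "\<lambda>t. u t + (- \<epsilon>) * h t"
    obtain t where t: "a < t" "t < x" "\<And>s. a \<le> s \<Longrightarrow> s \<le> t \<Longrightarrow> l \<le> ?w s" "\<And>s. t \<le> s \<Longrightarrow> s \<le> x \<Longrightarrow> ?w s \<le> l"
    proof (rule single_crossing[of a x ?w l])
      show "l < ?w a" "?w x < l" using ux hx \<epsilon> ua ho[of a] by auto
      show "continuous_on {a..x} ?w" using ab by (intro ch) auto
      fix m e assume "a < m" "m < x" "0 < e" "e \<le> \<bar>a - m\<bar>" "e \<le> \<bar>x - m\<bar>" "\<And>t. \<bar>t - m\<bar> < e \<Longrightarrow> ?w t \<le> ?w m"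
      then show False using ab by (intro nomax[of m e "- \<epsilon>"]) auto
    qed (use ab in auto)
    show ?thesis
    proof (rule adm'[OF H, of t])
      show "\<bar>?w s - u s\<bar> \<le> \<delta>" for s using \<epsilon> by (intro small) auto
      show "l \<le> ?w s" if "x - r < s" "s \<le> t" for s
        using t(3)[of s] uge[of s] that ho[of s] t by (cases "a \<le> s") auto
      show "?w s \<le> l" if "t \<le> s" "s < x + r" for s
      proof (cases "s \<le> x")
        case True
        then show ?thesis using t(4) that by auto
      next
        case False
        have "0 \<le> \<epsilon> * h s" using \<epsilon> hb(1)[of s] by simp
        then show ?thesis using ule[of s] that False by simp
      qed
    qed (use t ab out in auto)
  qed
  have "0 \<le> 1 * (kink U a x b - kink u a x b)"
    by (rule kink_variation[OF _ ab(2,3) _ \<epsilon>0]) (use ab up in \<open>auto simp: h_def\<close>)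
  moreover have "0 \<le> (-1) * (kink U a x b - kink u a x b)"
    by (rule kink_variation[OF _ ab(2,3) _ \<epsilon>0]) (use ab down in \<open>auto simp: h_def\<close>)
  ultimately have "kink u a x b = kink U a x b" by simp
  then show ?thesis
    using L R by (intro EL_across[OF r _ _ ab(1-4)]) auto
qed

end

section \<open>The first integral and the level \<open>\<beta>\<close>\<close>

lemma f_expand: "f \<beta> s = - \<beta> * s + (1 + \<beta>) * s\<^sup>2 - s ^ 3"
  by (simp add: f_def power2_eq_square power3_eq_cube algebra_simps)

lemma F_deriv: "(F \<beta> has_real_derivative - f \<beta> s) (at s)"
proof -
  have "((\<lambda>s. s^4 / 4 - (1 + \<beta>) * s^3 / 3 + \<beta> * s\<^sup>2 / 2) has_real_derivative - f \<beta> s) (at s)"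
    by (rule derivative_eq_intros refl | simp)+ (simp add: f_expand field_simps power2_eq_square)
  then show ?thesis by (simp add: F_eq[abs_def])
qed

context pulse
begin

lemma EL_x1: assumes W: "W x1 x2" shows "EL x1"
proof -
  obtain r1 where r1: "0 < r1" "r1 < x1" "\<And>t. x1 - r1 \<le> t \<Longrightarrow> t < x1 \<Longrightarrow> \<beta> < u t" by (rule left_of_x1[OF W]) blast
  have "0 < U2 x1" using W u_x1[OF W] by (intro U2_pos_if) (auto simp: f_def)
  then obtain r2 where r2: "0 < r2" "\<And>t. \<bar>t - x1\<bar> < r2 \<Longrightarrow> 0 < U2 t" by (rule U2_near_pos) blast
  obtain r3 where r3: "0 < r3" "\<And>t. 0 \<le> t \<Longrightarrow> \<bar>t - x1\<bar> < r3 \<Longrightarrow> \<bar>u t - u x1\<bar> < \<beta> / 2"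
    by (rule u_near[of x1 "\<beta> / 2"]) (use W \<beta> in auto)
  obtain Y where Y: "x1 < Y" "ereal Y < x2" using gap[OF W_lt[OF W] zero_less_one] by blast
  define r where "r = min (min r1 r2) (min r3 (Y - x1))"
  have r: "0 < r" "r \<le> r1" "r \<le> r2" "r \<le> r3" "x1 + r \<le> Y" using r1 r2 r3 Y by (auto simp: r_def)
  have near: "\<bar>u t - \<beta>\<bar> < \<beta> / 2" if "\<bar>t - x1\<bar> < r" for t
    using r3(2)[of t] that r r1 u_x1[OF W] by auto
  show ?thesis
  proof (rule EL_crossing[of r x1 \<beta> "\<beta> / 2"])
    fix t assume t: "t \<in> {x1 - r<..<x1}"
    then have "\<beta> < u t" using r1(3)[of t] r by auto
    moreover have "0 < t" using t r r1 by auto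
    ultimately show "EL t \<and> 0 < U2 t \<and> \<beta> < u t"
      using t r u_less_1[OF W, of t] by (auto intro!: EL_left[OF W] r2)
  next
    fix t assume t: "t \<in> {x1<..<x1 + r}"
    then have tx: "ereal t < x2" using Y r by (smt (verit) greaterThanLessThan_iff less_ereal.simps(1) less_trans)
    then show "EL t \<and> 0 < U2 t \<and> u t < \<beta>"
      using t r u_less_beta[OF W, of t] u_pos_mid[OF W, of t] by (auto intro!: EL_mid[OF W] r2)
  next
    fix w t assume w: "w \<in> H1" "x1 - r < t" "t < x1 + r" "\<And>s. \<bar>w s - u s\<bar> \<le> \<beta> / 2" "\<And>s. r \<le> \<bar>s - x1\<bar> \<Longrightarrow> w s = u s"
      "\<And>s. x1 - r < s \<Longrightarrow> s \<le> t \<Longrightarrow> \<beta> \<le> w s" "\<And>s. t \<le> s \<Longrightarrow> s < x1 + r \<Longrightarrow> w s \<le> \<beta>"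
    have tx: "ereal t < x2" using Y r w(3) by (smt (verit) less_ereal.simps(1) less_trans)
    have t0: "0 < t" using w r r1 by linarith
    have "bands \<beta> M w t x2"
      unfolding bands_def
    proof (intro conjI allI impI)
      show "0 \<le> t" "ereal t < x2" using t0 tx by auto
      fix s :: real assume s: "0 \<le> s"
      consider "s \<le> x1 - r" | "x1 - r < s" "s < x1 + r" | "x1 + r \<le> s" by linarith
      then show "band_ok \<beta> M t x2 s (w s)"
      proof cases
        case 1
        then have "w s = u s" "s \<le> t" "s \<le> x1" using w r by auto
        then show ?thesis using W_left[OF W s] by (simp add: band_ok_def)
      next
        case 2
        have n: "\<bar>u s - \<beta>\<bar> < \<beta> / 2" using 2 by (intro near) auto
        have sx: "ereal s \<le> x2" using 2 Y r by (smt (verit) ereal_less_eq(3) less_imp_le order_trans)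
        have "w s \<le> 1" "0 \<le> w s" using n w(4)[of s] \<beta> by linarith+
        then show ?thesis using w(6,7)[of s] 2 sx by (auto simp: band_ok_def)
      next
        case 3
        then have "w s = u s" "\<not> s \<le> t" "\<not> s \<le> x1" using w r by auto
        then show ?thesis using W_band[OF W s] by (simp add: band_ok_def)
      qed
    qed
    then show "w \<in> admissible \<beta> M" using w(1) by (auto simp: admissible_iff_bands)
  qed (use r r1 \<beta> u_x1[OF W] in auto)
qed

lemma EL_x2: assumes W: "W x1 (ereal X)" shows "EL X"
proof -
  have X: "0 < x1" "x1 < X" using W W_lt[OF W] by auto
  have "0 < U2 X" using X u_x2[OF W] by (intro U2_pos_if) (auto simp: f_def)
  then obtain r2 where r2: "0 < r2" "\<And>t. \<bar>t - X\<bar> < r2 \<Longrightarrow> 0 < U2 t" by (rule U2_near_pos) blast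
  obtain r3 where r3: "0 < r3" "\<And>t. 0 \<le> t \<Longrightarrow> \<bar>t - X\<bar> < r3 \<Longrightarrow> \<bar>u t - u X\<bar> < \<beta> / 2"
    by (rule u_near[of X "\<beta> / 2"]) (use X \<beta> in auto)
  define r where "r = min r2 (min r3 (X - x1))"
  have r: "0 < r" "r \<le> r2" "r \<le> r3" "x1 \<le> X - r" using r2 r3 X by (auto simp: r_def)
  have near: "\<bar>u t\<bar> < \<beta> / 2" if "\<bar>t - X\<bar> < r" for t
    using r3(2)[of t] that r X u_x2[OF W] by auto
  show ?thesis
  proof (rule EL_crossing[of r X 0 "\<beta> / 2"])
    fix t assume t: "t \<in> {X - r<..<X}"
    then have "x1 < t" "t < X" using r by auto
    then show "EL t \<and> 0 < U2 t \<and> 0 < u t"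
      using t r u_less_beta[OF W, of t] u_pos_mid[OF W, of t] by (auto intro!: EL_mid[OF W] r2)
  next
    fix t assume t: "t \<in> {X<..<X + r}"
    then show "EL t \<and> 0 < U2 t \<and> u t < 0"
      using t r u_less_0[OF W, of t] by (auto intro!: EL_right[OF W] r2)
  next
    fix w t assume w: "w \<in> H1" "X - r < t" "t < X + r" "\<And>s. \<bar>w s - u s\<bar> \<le> \<beta> / 2" "\<And>s. r \<le> \<bar>s - X\<bar> \<Longrightarrow> w s = u s"
      "\<And>s. X - r < s \<Longrightarrow> s \<le> t \<Longrightarrow> 0 \<le> w s" "\<And>s. t \<le> s \<Longrightarrow> s < X + r \<Longrightarrow> w s \<le> 0"
    have "bands \<beta> M w x1 (ereal t)"
      unfolding bands_def
    proof (intro conjI allI impI)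
      show "0 \<le> x1" "ereal x1 < ereal t" using X w r by auto
      fix s :: real assume s: "0 \<le> s"
      consider "s \<le> x1" | "x1 < s" "s \<le> X - r" | "X - r < s" "s < X + r" | "X + r \<le> s" by linarith
      then show "band_ok \<beta> M x1 (ereal t) s (w s)"
      proof cases
        case 1
        then have "w s = u s" using w r by auto
        then show ?thesis using W_left[OF W s] 1 by (simp add: band_ok_def)
      next
        case 2
        then have "w s = u s" "s \<le> t" "s \<le> X" using w r by auto
        then show ?thesis using W_mid[OF W, of s] 2 by (simp add: band_ok_def)
      next
        case 3
        have n: "\<bar>u s\<bar> < \<beta> / 2" using 3 by (intro near) auto
        have "w s \<le> \<beta>" "- (M + 1) \<le> w s" using n w(4)[of s] \<beta> M_pos by linarith+
        then show ?thesis using w(6,7)[of s] 3 r by (auto simp: band_ok_def)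
      next
        case 4
        then have "w s = u s" "\<not> s \<le> t" "X < s" "\<not> s \<le> x1" using w r X by auto
        then show ?thesis using W_right[OF W, of s] by (simp add: band_ok_def)
      qed
    qed
    then show "w \<in> admissible \<beta> M" using w(1) by (auto simp: admissible_iff_bands)
  qed (use r X \<beta> u_x2[OF W] in auto)
qed

text \<open>
  The equation holds at the two transition points and off the levels; the hypothesis on \<open>\<beta>\<close> excludes contacts between \<open>y\<close> and \<open>x1\<close>.
\<close>
lemma EL_beyond:
  assumes W: "W x1 x2" and y: "0 \<le> y" "\<And>t. y < t \<Longrightarrow> t < x1 \<Longrightarrow> \<beta> < u t" and t: "y < t"
  shows "EL t"
proof -
  consider "t < x1" | "t = x1" | "x1 < t" "ereal t < x2" | "ereal t = x2" | "x2 < ereal t" by fastforce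
  then show ?thesis
  proof cases
    case 1
    then show ?thesis using y t u_less_1[OF W, of t] by (intro EL_left[OF W]) auto
  next
    case 2
    then show ?thesis using EL_x1[OF W] by simp
  next
    case 3
    then show ?thesis using u_less_beta[OF W] u_pos_mid[OF W] by (intro EL_mid[OF W]) auto
  next
    case 4
    then show ?thesis using EL_x2 W by auto
  next
    case 5
    then show ?thesis using u_less_0[OF W] by (intro EL_right[OF W]) auto
  qed
qed

lemma v1_lim: "(v1 \<longlongrightarrow> 0) at_top"
proof (rule derivative_tendsto_0[of 0 v v1 "\<lambda>x. \<gamma> * v x + v x ^ 3 - u \<bar>x\<bar>"])
  have "((\<lambda>x. \<gamma> * v x + v x ^ 3 - u x) \<longlongrightarrow> \<gamma> * 0 + 0 ^ 3 - 0) at_top"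
    by (intro tendsto_intros v_lim u_lim)
  moreover have "\<forall>\<^sub>F x in at_top. \<gamma> * v x + v x ^ 3 - u x = \<gamma> * v x + v x ^ 3 - u \<bar>x\<bar>"
    using eventually_gt_at_top[of "0::real"] by eventually_elim simp
  ultimately show "((\<lambda>x. \<gamma> * v x + v x ^ 3 - u \<bar>x\<bar>) \<longlongrightarrow> 0) at_top"
    by (simp add: filterlim_cong[OF refl refl])
qed (rule v_deriv v1_deriv v_lim)+

lemma U2_lim: "(U2 \<longlongrightarrow> 0) at_top"
proof -
  have "isCont (f \<beta>) 0" using f_cont[of UNIV] by (simp add: continuous_on_eq_continuous_at)
  then have "((\<lambda>x. f \<beta> (u x)) \<longlongrightarrow> f \<beta> 0) at_top" using u_lim by (rule isCont_tendsto_compose)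
  then have "((\<lambda>x. (v x - f \<beta> (u x)) / d) \<longlongrightarrow> (0 - f \<beta> 0) / d) at_top"
    using d by (intro tendsto_intros v_lim) auto
  moreover have "\<forall>\<^sub>F x in at_top. (v x - f \<beta> (u x)) / d = U2 x"
    using eventually_gt_at_top[of "0::real"] by eventually_elim (simp add: U2_eq)
  ultimately show ?thesis by (simp add: filterlim_cong[OF refl refl] f_def)
qed

lemma deriv_u_lim:
  assumes "\<And>t. y < t \<Longrightarrow> EL t" shows "(deriv u \<longlongrightarrow> 0) at_top"
  by (rule derivative_tendsto_0[of y u "deriv u" U2]) (use assms in \<open>auto intro: EL_deriv EL_deriv2 u_lim U2_lim\<close>)

text \<open>
  The value of \<open>d/2 u'^2\<close> that the first integral of the system prescribes to an orbit tending to the rest state \<open>0\<close>.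
\<close>
definition potential :: "real \<Rightarrow> real" where
  "potential t = F \<beta> (u t) + u t * v t - \<gamma> / 2 * (v t)\<^sup>2 - v t ^ 4 / 4 + (v1 t)\<^sup>2 / 2"

text \<open>
  The difference of the two sides is constant along solutions of the system and tends to \<open>0\<close> at infinity.
\<close>
lemma hamiltonian:
  assumes y: "0 \<le> y" and E: "\<And>t. y < t \<Longrightarrow> EL t" and t: "y < t"
  shows "d / 2 * (deriv u t)\<^sup>2 = potential t"
proof -
  let ?H = "\<lambda>t. d / 2 * (deriv u t)\<^sup>2 - potential t"
  have "\<exists>c. \<forall>t\<in>{y<..}. ?H t = c"
  proof (rule has_field_derivative_zero_constant)
    fix t assume "t \<in> {y<..}"
    then have t: "y < t" "0 < t" using y by auto
    note D = EL_deriv[OF E[OF t(1)]] EL_deriv2[OF E[OF t(1)]] v_deriv[of t] v1_deriv[of t]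
    have Fd: "((\<lambda>t. F \<beta> (u t)) has_real_derivative - f \<beta> (u t) * deriv u t) (at t)"
      by (rule DERIV_chain2[OF F_deriv D(1)])
    have "(?H has_real_derivative d / 2 * (2 * deriv u t * U2 t) - (- f \<beta> (u t) * deriv u t + (deriv u t * v t + v1 t * u t)
        - \<gamma> / 2 * (2 * v t * v1 t) - 4 * v t ^ 3 * v1 t / 4 + 2 * v1 t * (\<gamma> * v t + v t ^ 3 - u \<bar>t\<bar>) / 2)) (at t)"
      unfolding potential_def
      by (rule derivative_eq_intros D Fd refl | simp)+
    moreover have "d / 2 * (2 * deriv u t * U2 t) - (- f \<beta> (u t) * deriv u t + (deriv u t * v t + v1 t * u t)
        - \<gamma> / 2 * (2 * v t * v1 t) - 4 * v t ^ 3 * v1 t / 4 + 2 * v1 t * (\<gamma> * v t + v t ^ 3 - u \<bar>t\<bar>) / 2) = 0"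
      using d t by (simp add: U2_eq field_simps)
    ultimately show "(?H has_real_derivative 0) (at t within {y<..})"
      by (simp add: has_field_derivative_at_within)
  qed auto
  then obtain c where c: "\<And>t. y < t \<Longrightarrow> ?H t = c" by auto
  have "(F \<beta> \<longlongrightarrow> F \<beta> 0) (at 0)" using DERIV_isCont[OF F_deriv] by (simp add: isCont_def)
  then have "isCont (F \<beta>) 0" by (simp add: isCont_def)
  then have Fl: "((\<lambda>t. F \<beta> (u t)) \<longlongrightarrow> F \<beta> 0) at_top" using u_lim by (rule isCont_tendsto_compose)
  have "(?H \<longlongrightarrow> d / 2 * 0\<^sup>2 - (F \<beta> 0 + 0 * 0 - \<gamma> / 2 * 0\<^sup>2 - 0 ^ 4 / 4 + 0\<^sup>2 / 2)) at_top"
    unfolding potential_def by (intro tendsto_intros deriv_u_lim[OF E] Fl u_lim v_lim v1_lim) auto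
  then have "(?H \<longlongrightarrow> 0) at_top" by (simp add: F_eq)
  moreover have "(?H \<longlongrightarrow> c) at_top"
  proof (rule tendsto_eventually)
    show "\<forall>\<^sub>F t in at_top. ?H t = c" using eventually_gt_at_top[of y] by eventually_elim (rule c)
  qed
  ultimately have "c = 0" using tendsto_unique trivial_limit_at_top_linorder by blast
  then show ?thesis using c[OF t] by simp
qed

text \<open>
  For \<open>0 < v \<le> 1\<close> the powers of \<open>v\<close> are at most \<open>v\<close>, so the expression is bounded below by the interpolation
  \<open>F \<beta> (1 - v) + (\<beta> + F \<beta> - \<gamma>/2 - 1/4) v\<close>, whose two coefficients are positive.
\<close>
lemma potential_pos: assumes "0 \<le> y" "u y = \<beta>" shows "0 < potential y"
proof -
  have v: "0 < v y" "v y \<le> 1" using v_pos v_upper assms by auto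
  have FB: "0 < F \<beta> \<beta>"
  proof -
    have "F \<beta> \<beta> = \<beta> ^ 3 * (2 - \<beta>) / 12" by (simp add: F_eq power2_eq_square power3_eq_cube power_numeral_reduce field_simps)
    moreover have "0 < \<beta> ^ 3 * (2 - \<beta>)" using \<beta> by (intro mult_pos_pos) auto
    ultimately show ?thesis by simp
  qed
  have "(v y)\<^sup>2 \<le> v y" using v by (simp add: power2_eq_square mult_left_le)
  then have 1: "\<gamma> / 2 * (v y)\<^sup>2 \<le> \<gamma> / 2 * v y" using \<gamma> by (intro mult_left_mono) auto
  have "v y ^ 3 \<le> 1" using v by (simp add: power_le_one)
  then have 2: "v y ^ 4 \<le> v y" using v by (simp add: power_numeral_reduce mult_left_le)
  have "0 < (\<beta> + F \<beta> \<beta> - \<gamma> / 2 - 1 / 4) * v y" using v \<gamma>_less by (intro mult_pos_pos) auto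
  moreover have "0 \<le> F \<beta> \<beta> * (1 - v y)" using FB v by simp
  ultimately have "0 < F \<beta> \<beta> + \<beta> * v y - \<gamma> / 2 * v y - v y / 4" by (simp add: algebra_simps)
  then have "0 < F \<beta> \<beta> + \<beta> * v y - \<gamma> / 2 * (v y)\<^sup>2 - v y ^ 4 / 4" using 1 2 by linarith
  moreover have "0 \<le> (v1 y)\<^sup>2 / 2" by simp
  ultimately show ?thesis unfolding potential_def assms(2) by linarith
qed

lemma potential_cont: "continuous_on {0..} potential"
proof -
  have "continuous_on UNIV (F \<beta>)"
    by (rule DERIV_continuous_on, rule has_field_derivative_at_within, rule F_deriv)
  then have "continuous_on {0..} (\<lambda>t. F \<beta> (u t))"
    by (rule continuous_on_compose2[OF _ u_cont]) auto
  then show ?thesis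
    unfolding potential_def by (intro continuous_intros u_cont v_cont v1_cont) auto
qed

lemma steep_after_touch:
  assumes y: "0 \<le> y" "u y = \<beta>" and E: "\<And>t. y < t \<Longrightarrow> EL t" and z: "y < z" "\<And>t. y < t \<Longrightarrow> t < z \<Longrightarrow> \<beta> < u t"
  obtains c s where "0 < c" "0 < s" "\<And>t. y < t \<Longrightarrow> t < y + s \<Longrightarrow> c * (t - y) \<le> u t - \<beta>"
proof -
  have P: "0 < potential y" using potential_pos[OF y] .
  obtain s0 where s0: "0 < s0" "\<And>t. 0 \<le> t \<Longrightarrow> \<bar>t - y\<bar> < s0 \<Longrightarrow> \<bar>potential t - potential y\<bar> < potential y / 2"
    using potential_cont y P unfolding continuous_on_iff dist_real_def by (metis atLeast_iff half_gt_zero)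
  \<comment> \<open>Half of the potential at \<open>y\<close> survives nearby and bounds \<open>d/2 u'^2\<close> from below by \<open>d/2 c\<^sup>2\<close>.\<close>
  define c where "c = sqrt (potential y / d)"
  have c: "0 < c" "c\<^sup>2 = potential y / d" using P d by (auto simp: c_def)
  have "c * (t - y) \<le> u t - \<beta>" if t: "y < t" "t < y + min s0 (z - y)" for t
  proof -
    have "continuous_on {y..t} u" using u_cont by (rule continuous_on_subset) (use y in auto)
    then obtain l \<xi> where \<xi>: "y < \<xi>" "\<xi> < t" "(u has_real_derivative l) (at \<xi>)" "u t - u y = (t - y) * l"
      using MVT[OF t(1), of u] EL_deriv[OF E] by (metis real_differentiable_def)
    have l: "l = deriv u \<xi>" using DERIV_unique[OF \<xi>(3) EL_deriv[OF E[OF \<xi>(1)]]] .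
    have "\<bar>\<xi> - y\<bar> < s0" using \<xi> t by linarith
    then have "\<bar>potential \<xi> - potential y\<bar> < potential y / 2" using \<xi> y(1) by (intro s0(2)) auto
    then have "potential y / 2 < potential \<xi>" unfolding abs_less_iff by linarith
    also have "\<dots> = d / 2 * l\<^sup>2" using hamiltonian[OF y(1) E \<xi>(1)] l by simp
    finally have "c\<^sup>2 < l\<^sup>2" using d by (simp add: c field_simps)
    then have "c < \<bar>l\<bar>" using c by (metis abs_le_square_iff abs_of_pos not_le)
    moreover have "t < z" using t by linarith
    then have "0 < (t - y) * l" using \<xi>(4) y z(2)[of t] t by simp
    then have "0 < l" using t by (simp add: zero_less_mult_iff)
    ultimately have "(t - y) * c \<le> (t - y) * l" using t by (intro mult_left_mono) auto
    then show ?thesis using \<xi>(4) y by (simp add: mult.commute)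
  qed
  with that[of c "min s0 (z - y)"] c s0 z show ?thesis by auto
qed

text \<open>
  Let \<open>y\<close> be the last point before \<open>x1\<close> with \<open>u y = \<beta>\<close>. To the right of \<open>y\<close> the equation holds and \<open>u\<close> rises with a positive slope \<open>c\<close>, so
  the kink of \<open>u\<close> at \<open>y\<close> over width \<open>r\<close> is at least \<open>c\<close>. The kink of \<open>U\<close> is of order \<open>r\<close>, and lifting \<open>u\<close> near \<open>y\<close> would lower the energy.
  For \<open>y = 0\<close> the half hat plays the same role.
\<close>
lemma above_beta: assumes W: "W x1 x2" and t: "0 \<le> t" "t < x1" shows "\<beta> < u t"
proof (rule ccontr)
  assume "\<not> \<beta> < u t"
  then have ut: "u t = \<beta>" using W_left[OF W, of t] t by auto
  obtain r1 where r1: "0 < r1" "r1 < x1" "\<And>t. x1 - r1 \<le> t \<Longrightarrow> t < x1 \<Longrightarrow> \<beta> < u t" by (rule left_of_x1[OF W]) blast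
  let ?T = "{s \<in> {0..x1 - r1}. u s = \<beta>}"
  have "continuous_on {0..x1 - r1} u" using u_cont by (rule continuous_on_subset) auto
  then have "closed ?T" using continuous_closed_preimage_constant[of "{0..x1 - r1}" u \<beta>] by auto
  then have "compact ?T" by (intro compact_eq_bounded_closed[THEN iffD2]) (auto intro: bounded_subset[of "{0..x1 - r1}"])
  moreover have "t \<in> ?T" using ut t r1(3)[of t] by (cases "x1 - r1 \<le> t") auto
  ultimately obtain y where y: "y \<in> ?T" "\<And>s. s \<in> ?T \<Longrightarrow> s \<le> y" using compact_attains_sup[of ?T] by blast
  have y0: "0 \<le> y" "u y = \<beta>" "y < x1" using y r1 by auto
  have gt: "\<beta> < u s" if s: "y < s" "s < x1" for s
  proof (rule ccontr)
    assume "\<not> \<beta> < u s"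
    then have "s \<in> ?T" using W_left[OF W, of s] s y0 r1(3)[of s] by (cases "x1 - r1 \<le> s") auto
    then show False using y(2) s by force
  qed
  have E: "EL s" if "y < s" for s using EL_beyond[OF W y0(1) gt that] .
  obtain c s where c: "0 < c" "0 < s" "\<And>t. y < t \<Longrightarrow> t < y + s \<Longrightarrow> c * (t - y) \<le> u t - \<beta>"
    using steep_after_touch[OF y0(1,2) E y0(3) gt] by blast
  obtain C0 where C0: "\<And>t. t \<in> {0..x1} \<Longrightarrow> \<bar>U2 t\<bar> \<le> C0" by (rule continuous_on_Icc_bounded[OF U2_cont]) blast
  define C where "C = max C0 1"
  have C: "1 \<le> C" "\<And>t. t \<in> {0..x1} \<Longrightarrow> U2 t \<le> C" using C0 by (auto simp: C_def abs_le_iff intro: le_max_iff_disj[THEN iffD2])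
  obtain r3 where r3: "0 < r3" "\<And>t. 0 \<le> t \<Longrightarrow> \<bar>t - y\<bar> < r3 \<Longrightarrow> \<bar>u t - u y\<bar> < (1 - \<beta>) / 2"
    by (rule u_near[of y "(1 - \<beta>) / 2"]) (use y0 \<beta> in auto)
  \<comment> \<open>The last bound makes the kink of \<open>U\<close>, at most \<open>2 r C\<close>, smaller than \<open>c\<close>.\<close>
  define r0 where "r0 = min (min s (x1 - y)) (min r3 (c / (2 * C)))"
  define r where "r = (if y = 0 then r0 else min r0 y) / 2"
  have r0: "0 < r0" using c C r3 y0 by (auto simp: r0_def)
  then have r: "0 < r" "r < r0" "y \<noteq> 0 \<Longrightarrow> r < y" using y0 by (auto simp: r_def)
  have rr: "r < s" "r < x1 - y" "r < r3" "r < c / (2 * C)" using r by (auto simp: r0_def)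
  then have Cr: "2 * r * C < c" using C by (simp add: field_simps)
  have up: "c * r \<le> u (y + r) - \<beta>" using c(3)[of "y + r"] r rr by simp
  have ok: "band_ok \<beta> M x1 x2 p (u p + \<epsilon> * h)"
    if "0 \<le> p" "\<bar>p - y\<bar> < r" "0 < \<epsilon>" "\<epsilon> < (1 - \<beta>) / 2" "0 \<le> h" "h \<le> 1" for p \<epsilon> h
  proof -
    have "p \<le> x1" using that rr by linarith
    have h: "0 \<le> \<epsilon> * h" "\<epsilon> * h \<le> \<epsilon>" using that by (auto intro: mult_left_le)
    have "\<bar>u p - \<beta>\<bar> < (1 - \<beta>) / 2" using r3(2)[of p] that rr y0 by auto
    then have "u p - \<beta> < (1 - \<beta>) / 2" by (simp only: abs_less_iff)
    then have "u p < (1 + \<beta>) / 2" by (simp add: field_simps)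
    then have "u p + \<epsilon> < (1 + \<beta>) / 2 + (1 - \<beta>) / 2" using that(4) by (rule add_strict_mono)
    also have "\<dots> = 1" by (simp add: field_simps)
    finally have "u p + \<epsilon> * h \<le> 1" using h by linarith
    moreover have "\<beta> \<le> u p" using W_left[OF W that(1) \<open>p \<le> x1\<close>] by simp
    then have "\<beta> \<le> u p + \<epsilon> * h" using h by linarith
    ultimately have "\<beta> \<le> u p + \<epsilon> * h" "u p + \<epsilon> * h \<le> 1" by auto
    then show ?thesis using \<open>p \<le> x1\<close> by (simp add: band_ok_def)
  qed
  have \<epsilon>0: "0 < (1 - \<beta>) / 2" using \<beta> by simp
  show False
  proof (cases "y = 0")
    case True
    have "u r - u 0 \<le> U r - U 0"
    proof (rule boundary_variation[OF r(1) \<epsilon>0])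
      fix \<epsilon> assume \<epsilon>: "0 < \<epsilon>" "\<epsilon> < (1 - \<beta>) / 2"
      show "(\<lambda>x. u x + \<epsilon> * hat (- 1) 0 r x) \<in> admissible \<beta> M"
      proof (rule hat_admissible[OF W])
        fix x assume "0 \<le> x" "- 1 < x" "x < r"
        then show "band_ok \<beta> M x1 x2 x (u x + \<epsilon> * hat (- 1) 0 r x)"
          using True \<epsilon> r by (intro ok hat_bounds) auto
      qed (use r in auto)
    qed
    also obtain \<xi> where \<xi>: "0 < \<xi>" "\<xi> < r" "U r - U 0 = (r - 0) * U1 \<xi>"
      using MVT2[OF r(1), of U U1] U_deriv by blast
    moreover obtain \<eta> where \<eta>: "0 < \<eta>" "\<eta> < \<xi>" "U1 \<xi> - U1 0 = (\<xi> - 0) * U2 \<eta>"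
      using MVT2[OF \<xi>(1), of U1 U2] U1_deriv by blast
    ultimately have "u r - u 0 \<le> r * (\<xi> * U2 \<eta>)" using U1_0 by simp
    also have "\<dots> \<le> r * (\<xi> * C)" using C(2)[of \<eta>] \<eta> \<xi> rr r True by (intro mult_left_mono) auto
    also have "\<dots> \<le> r * (r * C)" using \<xi> r C(1) by (intro mult_left_mono mult_right_mono) auto
    finally have "r * c \<le> r * (r * C)" using up True y0 by (simp add: mult.commute)
    then have "c \<le> r * C" using r by simp
    moreover have "0 \<le> r * C" using r C by simp
    ultimately show False using Cr by simp
  next
    case False
    have y1: "0 < y" "r < y" using False y0 r by auto
    have "0 \<le> 1 * (kink U (y - r) y (y + r) - kink u (y - r) y (y + r))"
    proof (rule kink_variation[OF _ _ _ _ \<epsilon>0])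
      fix \<epsilon> assume \<epsilon>: "0 < \<epsilon>" "\<epsilon> < (1 - \<beta>) / 2"
      have "(\<lambda>x. u x + \<epsilon> * hat (y - r) y (y + r) x) \<in> admissible \<beta> M"
      proof (rule hat_admissible[OF W])
        fix x assume "0 \<le> x" "y - r < x" "x < y + r"
        then show "band_ok \<beta> M x1 x2 x (u x + \<epsilon> * hat (y - r) y (y + r) x)"
          using \<epsilon> r by (intro ok hat_bounds) auto
      qed (use r in auto)
      then show "(\<lambda>x. u x + \<epsilon> * (1 * hat (y - r) y (y + r) x)) \<in> admissible \<beta> M" by simp
    qed (use r y1 in auto)
    then have "kink u (y - r) y (y + r) \<le> kink U (y - r) y (y + r)" by simp
    also obtain a b \<xi> where ab: "y - r < a" "a < \<xi>" "\<xi> < b" "b < y + r" "kink U (y - r) y (y + r) = (b - a) * U2 \<xi>"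
      by (rule kink_U_mvt[of "y - r" y "y + r"]) (use r in auto)
    note ab(5)
    also have "(b - a) * U2 \<xi> \<le> (b - a) * C" using ab C(2)[of \<xi>] y1 rr by (intro mult_left_mono) auto
    also have "\<dots> \<le> 2 * r * C" using ab C(1) by (intro mult_right_mono) auto
    finally have "kink u (y - r) y (y + r) < c" using Cr by simp
    moreover have "c \<le> kink u (y - r) y (y + r)"
    proof -
      have "kink u (y - r) y (y + r) = (u (y + r) - \<beta>) / r + (u (y - r) - \<beta>) / r"
        using y0 by (simp add: kink_def diff_divide_distrib)
      moreover have "0 \<le> (u (y - r) - \<beta>) / r" using W_left[OF W, of "y - r"] y1 y0 r by simp
      moreover have "c \<le> (u (y + r) - \<beta>) / r" using up r by (simp add: field_simps)
      ultimately show ?thesis by simp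
    qed
    ultimately show False by simp
  qed
qed

end

context pulse
begin

text \<open>
  If \<open>u\<close> stayed positive, then \<open>v'' \<le> (\<gamma> + 1) v\<close>, so \<open>v\<close> would decay at most exponentially. For small \<open>u\<close> and \<open>v\<close> the system gives
  \<open>d (u' v - u v')' \<ge> v\<^sup>2\<close>; integrating from infinity, \<open>u' v - u v' \<le> - c v\<^sup>2\<close>, that is \<open>(u / v)' \<le> - c\<close>, which cannot last.
\<close>
lemma x2_finite: assumes W: "W x1 x2" shows "x2 \<noteq> \<infinity>"
proof
  assume inf: "x2 = \<infinity>"
  have x10: "0 < x1" using W by simp
  have up: "0 < u t" and ub: "u t < \<beta>" and E: "EL t" if "x1 < t" for t
    using that u_pos_mid[OF W, of t] u_less_beta[OF W, of t] EL_mid[OF W, of t] inf by auto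
  have vp: "0 < v t" "v t \<le> 1" if "x1 < t" for t using v_pos[of t] v_upper(1)[of t] that x10 by auto
  define k where "k = sqrt (\<gamma> + 1)"
  have k: "0 < k" "k * k = \<gamma> + 1" using \<gamma> by (auto simp: k_def)
  \<comment> \<open>The decay is at most exponential: \<open>(v' + k v) exp (- k t)\<close> is nonincreasing with limit \<open>0\<close>, hence nonnegative.\<close>
  have slow: "- k * v x \<le> v1 x" if x: "x1 < x" for x
  proof -
    define g where "g t = (v1 t + k * v t) * exp (- k * t)" for t
    have gd: "(g has_real_derivative (\<gamma> * v t + v t ^ 3 - u \<bar>t\<bar> - (\<gamma> + 1) * v t) * exp (- k * t)) (at t)" for t
    proof -
      have "(g has_real_derivative ((\<gamma> * v t + v t ^ 3 - u \<bar>t\<bar>) + k * v1 t) * exp (- k * t)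
          + (exp (- k * t) * (- k)) * (v1 t + k * v t)) (at t)"
        unfolding g_def by (intro DERIV_mult DERIV_add DERIV_cmult v1_deriv v_deriv) (auto intro!: derivative_eq_intros)
      then show ?thesis unfolding k(2)[symmetric] by (rule DERIV_cong) (simp add: algebra_simps)
    qed
    have mono: "g t \<le> g x" if "x \<le> t" for t
    proof (rule DERIV_nonpos_imp_nonincreasing[OF that])
      fix s assume s: "x \<le> s" "s \<le> t"
      have "v s ^ 3 = v s * (v s * v s)" by (simp add: power3_eq_cube)
      also have "\<dots> \<le> v s * 1" using vp[of s] s x by (intro mult_left_mono mult_le_one) auto
      finally have "\<gamma> * v s + v s ^ 3 - u \<bar>s\<bar> - (\<gamma> + 1) * v s \<le> 0"
        using up[of s] s x x10 by (simp add: algebra_simps)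
      then have "(\<gamma> * v s + v s ^ 3 - u \<bar>s\<bar> - (\<gamma> + 1) * v s) * exp (- k * s) \<le> 0" by (simp add: mult_le_0_iff)
      then show "\<exists>D. (g has_real_derivative D) (at s) \<and> D \<le> 0" using gd by blast
    qed
    have "((\<lambda>t. exp (- k * t)) \<longlongrightarrow> 0) at_top"
      using k by (intro filterlim_compose[OF exp_at_bot])
        (simp add: filterlim_uminus_at_bot filterlim_tendsto_pos_mult_at_top[OF tendsto_const _ filterlim_ident])
    then have "(g \<longlongrightarrow> (0 + k * 0) * 0) at_top"
      unfolding g_def by (intro tendsto_intros v1_lim v_lim)
    then have "(g \<longlongrightarrow> 0) at_top" by simp
    then have "0 \<le> g x"
    proof (rule tendsto_upperbound)
      show "\<forall>\<^sub>F t in at_top. g t \<le> g x" using eventually_ge_at_top[of x] by eventually_elim (rule mono)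
    qed simp
    then show ?thesis by (simp add: g_def zero_le_mult_iff)
  qed
  have "\<forall>\<^sub>F t in at_top. v t < d / (1 + \<beta>)" using d \<beta> by (intro order_tendstoD(2)[OF v_lim]) auto
  then obtain X0 where X0: "\<And>t. X0 \<le> t \<Longrightarrow> v t < d / (1 + \<beta>)" by (auto simp: eventually_at_top_linorder)
  define X where "X = max X0 (x1 + 1)"
  have X: "x1 < t" "(1 + \<beta>) * v t \<le> d" if "X \<le> t" for t
    using that X0[of t] \<beta> by (auto simp: X_def field_simps)
  \<comment> \<open>The rate for which \<open>(c v\<^sup>2)' \<ge> - v\<^sup>2 / d\<close>, since \<open>v' \<ge> - k v\<close>.\<close>
  define c where "c = 1 / (2 * d * k)"
  have c: "0 < c" "2 * c * k * d = 1" using d k by (auto simp: c_def)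
  \<comment> \<open>Nondecreasing with limit \<open>0\<close>, hence nonpositive.\<close>
  define Y where "Y t = deriv u t * v t - u t * v1 t + c * (v t)\<^sup>2" for t
  have Y_deriv: "(Y has_real_derivative U2 t * v t - u t * (\<gamma> * v t + v t ^ 3 - u \<bar>t\<bar>) + 2 * c * v t * v1 t) (at t)"
    if t: "X \<le> t" for t
  proof -
    note D = EL_deriv[OF E[OF X(1)[OF t]]] EL_deriv2[OF E[OF X(1)[OF t]]] v_deriv[of t] v1_deriv[of t]
    have "(Y has_real_derivative (U2 t * v t + v1 t * deriv u t) - (deriv u t * v1 t + (\<gamma> * v t + v t ^ 3 - u \<bar>t\<bar>) * u t)
        + c * (2 * (v t * v1 t))) (at t)"
      unfolding Y_def
      by (intro DERIV_add DERIV_diff DERIV_mult DERIV_cmult D) (rule derivative_eq_intros D refl | simp)+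
    then show ?thesis by (rule DERIV_cong) (simp add: algebra_simps)
  qed
  have Y_mono: "0 \<le> U2 t * v t - u t * (\<gamma> * v t + v t ^ 3 - u \<bar>t\<bar>) + 2 * c * v t * v1 t" if t: "X \<le> t" for t
  proof -
    note xt = X(1)[OF t]
    have t0: "0 < t" using xt x10 by simp
    have uv: "0 < u t" "0 < v t" "v t \<le> 1" using up[OF xt] vp[OF xt] by auto
    have "d * (U2 t * v t) = (v t - f \<beta> (u t)) * v t" using d t0 by (simp add: U2_eq)
    then have e: "d * (U2 t * v t - u t * (\<gamma> * v t + v t ^ 3 - u \<bar>t\<bar>)) = (v t)\<^sup>2
        + (\<beta> - d * \<gamma> - d * (v t)\<^sup>2) * (u t * v t) + (d - (1 + \<beta>) * v t) * (u t)\<^sup>2 + u t ^ 3 * v t"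
      using t0 by (simp add: f_expand power2_eq_square power3_eq_cube algebra_simps)
    have "0 \<le> \<beta> - d * \<gamma> - d * (v t)\<^sup>2"
    proof -
      have "d * (v t)\<^sup>2 \<le> d * 1" using uv d by (intro mult_left_mono) (auto simp: power_le_one)
      moreover have "4 * d < \<beta>"
      proof -
        have "0 \<le> d * (\<beta> * \<gamma>)" using d \<beta> \<gamma> by simp
        then have "4 * d < \<beta> * \<beta>" using d_small by (simp add: power2_eq_square algebra_simps)
        also have "\<dots> \<le> \<beta> * 1" using \<beta> by (intro mult_left_mono) auto
        finally show ?thesis by simp
      qed
      ultimately show ?thesis using d\<gamma>_small \<beta> by linarith
    qed
    then have "0 \<le> (\<beta> - d * \<gamma> - d * (v t)\<^sup>2) * (u t * v t)" using uv by (intro mult_nonneg_nonneg) auto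
    moreover have "0 \<le> (d - (1 + \<beta>) * v t) * (u t)\<^sup>2" using X(2)[OF t] by (intro mult_nonneg_nonneg) auto
    moreover have "0 \<le> u t ^ 3 * v t" using uv by simp
    ultimately have 1: "(v t)\<^sup>2 \<le> d * (U2 t * v t - u t * (\<gamma> * v t + v t ^ 3 - u \<bar>t\<bar>))" unfolding e by linarith
    have "(2 * c * v t * d) * (- k * v t) \<le> (2 * c * v t * d) * v1 t"
      using slow[OF xt] c d uv by (intro mult_left_mono) auto
    moreover have "(2 * c * v t * d) * (- k * v t) = - ((2 * c * k * d) * (v t)\<^sup>2)"
      by (simp add: power2_eq_square algebra_simps)
    moreover have "(2 * c * v t * d) * v1 t = d * (2 * c * v t * v1 t)" by (simp add: algebra_simps)
    ultimately have 2: "- (v t)\<^sup>2 \<le> d * (2 * c * v t * v1 t)" unfolding c(2) by linarith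
    have "0 \<le> d * (U2 t * v t - u t * (\<gamma> * v t + v t ^ 3 - u \<bar>t\<bar>) + 2 * c * v t * v1 t)"
      using 1 2 by (simp add: distrib_left)
    then show ?thesis using d by (simp add: zero_le_mult_iff)
  qed
  have "(Y \<longlongrightarrow> 0 * 0 - 0 * 0 + c * 0\<^sup>2) at_top"
    unfolding Y_def by (intro tendsto_intros deriv_u_lim[OF E] v_lim u_lim v1_lim)
  then have Ylim: "(Y \<longlongrightarrow> 0) at_top" by simp
  have Y0: "Y x \<le> 0" if x: "X \<le> x" for x
  proof (rule tendsto_lowerbound[OF Ylim])
    show "\<forall>\<^sub>F t in at_top. Y x \<le> Y t"
      using eventually_ge_at_top[of x]
    proof eventually_elim
      case (elim t)
      show ?case
      proof (rule DERIV_nonneg_imp_nondecreasing[OF elim])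
        fix s assume "x \<le> s" "s \<le> t"
        then have "X \<le> s" using x by simp
        then show "\<exists>D. (Y has_real_derivative D) (at s) \<and> 0 \<le> D" using Y_deriv Y_mono by blast
      qed
    qed
  qed simp
  \<comment> \<open>Nonincreasing because \<open>q' = Y / v\<^sup>2\<close>.\<close>
  define q where "q t = u t / v t + c * t" for t
  have q_anti: "q t \<le> q X" if t: "X \<le> t" for t
  proof (rule DERIV_nonpos_imp_nonincreasing[OF t])
    fix s assume "X \<le> s" "s \<le> t"
    then have s: "X \<le> s" "x1 < s" using X(1) by auto
    have vs: "0 < v s" using vp[OF s(2)] by simp
    have "(q has_real_derivative (deriv u s * v s - u s * v1 s) / (v s * v s) + c * 1) (at s)"
      unfolding q_def using vs
      by (intro DERIV_add DERIV_cmult DERIV_ident DERIV_divide EL_deriv E s v_deriv) auto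
    moreover have "(deriv u s * v s - u s * v1 s) / (v s * v s) + c * 1 = Y s / (v s * v s)"
      using vs by (simp add: Y_def field_simps power2_eq_square)
    moreover have "Y s / (v s * v s) \<le> 0" using Y0[OF s(1)] vs by (simp add: divide_le_0_iff)
    ultimately show "\<exists>D. (q has_real_derivative D) (at s) \<and> D \<le> 0" by metis
  qed
  define t where "t = max X (q X / c)"
  have t: "X \<le> t" "q X / c \<le> t" by (auto simp: t_def)
  have "q X \<le> c * t" using t(2) c by (simp add: field_simps)
  moreover have "0 < u t / v t" using up vp X(1)[OF t(1)] by simp
  ultimately show False using q_anti[OF t(1)] by (simp add: q_def)
qed

lemma f_antimono: assumes "s \<le> t" "t \<le> 0" shows "f \<beta> t \<le> f \<beta> s"
proof -
  have "f \<beta> s - f \<beta> t = (t - s) * (\<beta> + (1 + \<beta>) * (- s - t) + (s\<^sup>2 + s * t + t\<^sup>2))"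
    by (simp add: f_expand power2_eq_square power3_eq_cube algebra_simps)
  moreover have "0 \<le> (1 + \<beta>) * (- s - t)" using assms \<beta> by (intro mult_nonneg_nonneg) auto
  moreover have "0 \<le> s * t" using assms by (intro mult_nonpos_nonpos) auto
  moreover have "0 \<le> t - s" using assms by simp
  ultimately have "0 \<le> f \<beta> s - f \<beta> t" using \<beta> by (auto intro!: mult_nonneg_nonneg add_nonneg_nonneg)
  then show ?thesis by simp
qed

text \<open>
  Beyond the zero of \<open>u\<close> the right-hand side of \<open>v'' = \<gamma> v + v^3 - u\<close> is positive, and a convex function that tends to \<open>0\<close> decreases.
\<close>
lemma v_decreasing:
  assumes W: "W x1 (ereal X)" and pq: "X \<le> p" "p < q" shows "v q < v p"
proof -
  have X: "0 < X" using W W_lt[OF W] by auto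
  have v2: "0 < \<gamma> * v t + v t ^ 3 - u \<bar>t\<bar>" if "X \<le> t" for t
  proof -
    have "0 < \<gamma> * v t" "0 < v t ^ 3" using v_pos[of t] that X \<gamma> by auto
    moreover have "u \<bar>t\<bar> \<le> 0" using that X u_x2[OF W] u_less_0[OF W, of t] by (cases "t = X") auto
    ultimately show ?thesis using that X by linarith
  qed
  have mono: "v1 s < v1 t" if "X \<le> s" "s < t" for s t
    by (rule DERIV_pos_imp_increasing[OF that(2)]) (use that v1_deriv v2 in \<open>meson order_trans\<close>)
  have neg: "v1 s < 0" if s: "X \<le> s" for s
  proof -
    have "v1 (s + 1) \<le> 0"
    proof (rule tendsto_lowerbound[OF v1_lim])
      show "\<forall>\<^sub>F t in at_top. v1 (s + 1) \<le> v1 t"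
        using eventually_gt_at_top[of "s + 1"] by eventually_elim (use mono s in \<open>auto intro: less_imp_le\<close>)
    qed simp
    then show ?thesis using mono[of s "s + 1"] s by simp
  qed
  show ?thesis
    by (rule DERIV_neg_imp_decreasing[OF pq(2)]) (use pq v_deriv neg in \<open>meson order_trans\<close>)
qed

text \<open>
  Take a maximum \<open>m\<close> of \<open>u\<close> between the two minima \<open>p < q\<close>. Then \<open>v m \<le> f (u m) \<le> f (u q) \<le> v q\<close>, although \<open>v\<close> decreases.
\<close>
lemma no_two_local_minima:
  assumes W: "W x1 (ereal X)" and pq: "X < p" "p < q"
    and p: "0 < e" "\<And>t. \<bar>t - p\<bar> < e \<Longrightarrow> u p \<le> u t" and q: "\<And>t. \<bar>t - q\<bar> < e \<Longrightarrow> u q \<le> u t"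
  shows False
proof -
  have X: "0 < X" using W W_lt[OF W] by auto
  have E: "EL t" if "X < t" for t using that u_less_0[OF W, of t] by (intro EL_right[OF W]) auto
  have "0 \<le> U2 q"
  proof -
    obtain e' where e': "0 < e'" "\<And>t. \<bar>t - q\<bar> < e' \<Longrightarrow> EL t" using EL_nbhd[OF E] pq by (metis less_trans)
    show ?thesis
      by (rule second_derivative_at_min(2)[of "min e e'" q u "deriv u"])
        (use p e' q in \<open>auto intro: EL_deriv EL_deriv2\<close>)
  qed
  then have vq: "f \<beta> (u q) \<le> v q" using d pq X by (simp add: U2_eq zero_le_divide_iff)
  have "continuous_on {p..q} u" using u_cont by (rule continuous_on_subset) (use pq X in auto)
  moreover have "{p..q} \<noteq> {}" using pq by auto
  ultimately obtain m0 where m0: "m0 \<in> {p..q}" "\<And>t. t \<in> {p..q} \<Longrightarrow> u t \<le> u m0"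
    using continuous_attains_sup[of "{p..q}" u] by auto
  define k where "k = min e (q - p)"
  have k: "0 < k" "k \<le> e" "k \<le> q - p" using p pq by (auto simp: k_def)
  \<comment> \<open>A step small enough to stay in both neighbourhoods, so that the maximum is also taken inside.\<close>
  define h where "h = k / 2"
  have h: "0 < h" "h < e" "p + h < q" using k unfolding h_def by linarith+
  have "\<exists>m. p < m \<and> m < q \<and> u m = u m0"
  proof -
    consider "m0 = p" | "m0 = q" | "p < m0" "m0 < q" using m0(1) by force
    then show ?thesis
    proof cases
      case 1
      have "u p \<le> u (p + h)" using h by (intro p) auto
      then show ?thesis using 1 m0(2)[of "p + h"] h by (intro exI[of _ "p + h"]) auto
    next
      case 2
      have "u q \<le> u (q - h)" using h by (intro q) auto
      then show ?thesis using 2 m0(2)[of "q - h"] h by (intro exI[of _ "q - h"]) auto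
    qed blast
  qed
  then obtain m where m: "p < m" "m < q" "u m = u m0" by blast
  have Em: "EL m" using m pq by (intro E) auto
  have "\<not> 0 < U2 m"
  proof
    assume pos: "0 < U2 m"
    show False
    proof (rule no_local_max[OF Em pos, of "min (m - p) (q - m)"])
      fix t assume "\<bar>t - m\<bar> < min (m - p) (q - m)"
      then have "p \<le> t" "t \<le> q" unfolding min_less_iff_conj by linarith+
      then show "u t \<le> u m" using m0(2) m by simp
    qed (use m in auto)
  qed
  then have "v m \<le> f \<beta> (u m)" using d pq m X by (simp add: U2_eq zero_less_divide_iff)
  also have "\<dots> \<le> f \<beta> (u q)"
    using m0(2)[of q] m pq u_less_0[OF W, of m] by (intro f_antimono) auto
  also have "\<dots> \<le> v q" by (rule vq)
  finally have "v m \<le> v q" .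
  moreover have "v q < v m" using pq m by (intro v_decreasing[OF W]) auto
  ultimately show False by simp
qed

lemma pulse_profile:
  obtains x1 x2 where "0 < x1" "x1 < x2" "{x. 0 \<le> x \<and> u x = \<beta>} = {x1}" "{x. 0 \<le> x \<and> u x = 0} = {x2}"
    "\<And>x. 0 \<le> x \<Longrightarrow> x < x1 \<Longrightarrow> \<beta> < u x" "\<And>x. x1 < x \<Longrightarrow> x < x2 \<Longrightarrow> 0 < u x \<and> u x < \<beta>" "\<And>x. x2 < x \<Longrightarrow> u x < 0"
    "\<And>x. x \<in> {x1..x2} \<Longrightarrow> u differentiable at x \<and> deriv u x < 0"
    "\<exists>x3>x2. u x3 < 0 \<and> {y. global_min_point_on u {x2<..} y} = {x3} \<and> {y. local_min_point_on u {x1..} y} = {x3}"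
proof -
  obtain x1 y2 where W0: "W x1 y2" by (rule bands_exist)
  then obtain X where "y2 = ereal X" using x2_finite[OF W0] W_lt[OF W0] by (cases y2) auto
  then have W: "W x1 (ereal X)" using W0 by simp
  have X: "0 < x1" "x1 < X" using W W_lt[OF W] by auto
  have left: "\<beta> < u x" if "0 \<le> x" "x < x1" for x using above_beta[OF W that] .
  have mid: "0 < u x \<and> u x < \<beta>" if "x1 < x" "x < X" for x
    using u_pos_mid[OF W, of x] u_less_beta[OF W, of x] that by simp
  have right: "u x < 0" if "X < x" for x using u_less_0[OF W, of x] that by simp
  have u1: "u x1 = \<beta>" and u2: "u X = 0" using u_x1[OF W] u_x2[OF W] by auto
  have E: "EL t" if "0 < t" for t
    by (rule EL_beyond[OF W, of 0]) (use left that in auto)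
  have U2_mid: "0 < U2 t" if "x1 \<le> t" "t \<le> X" for t
  proof (rule U2_pos_if)
    have "0 \<le> u t" "u t \<le> \<beta>" using mid[of t] that u1 u2 \<beta> by (cases "t = x1"; cases "t = X"; force)+
    then show "f \<beta> (u t) \<le> 0" by (rule f_nonpos_mid)
  qed (use that X in auto)
  have dX: "deriv u X < 0"
  proof (rule ccontr)
    assume "\<not> deriv u X < 0"
    then have ge: "0 \<le> deriv u X" by simp
    have X0: "0 < X" using X by simp
    have "\<exists>t>X. u X < u t"
    proof (cases "deriv u X = 0")
      case False
      then have "0 < deriv u X" using ge by simp
      then obtain s where "s > 0" "\<And>h. 0 < h \<Longrightarrow> h < s \<Longrightarrow> u X < u (X + h)"
        using DERIV_pos_inc_right[OF EL_deriv[OF E[OF X0]]] by auto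
      then show ?thesis by (intro exI[of _ "X + s / 2"]) auto
    next
      case True
      have U: "0 < U2 X" using U2_mid X by simp
      then obtain s where s: "s > 0" "\<And>h. 0 < h \<Longrightarrow> h < s \<Longrightarrow> deriv u X < deriv u (X + h)"
        using DERIV_pos_inc_right[OF EL_deriv2[OF E[OF X0]]] by auto
      obtain \<xi> where \<xi>: "X < \<xi>" "\<xi> < X + s / 2" "u (X + s / 2) - u X = (X + s / 2 - X) * deriv u \<xi>"
        using MVT2[of X "X + s / 2" u "deriv u"] s(1) EL_deriv[OF E] X0 by force
      have "0 < deriv u \<xi>" using s(2)[of "\<xi> - X"] \<xi> s(1) True by auto
      then have "0 < u (X + s / 2) - u X" unfolding \<xi>(3) using s(1) by simp
      then show ?thesis using s(1) by (intro exI[of _ "X + s / 2"]) auto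
    qed
    then show False using right u2 by force
  qed
  have dneg: "deriv u t < 0" if t: "x1 \<le> t" "t \<le> X" for t
  proof (cases "t = X")
    case False
    then have tX: "t < X" using t by simp
    have "deriv u t < deriv u X"
    proof (rule DERIV_pos_imp_increasing[OF tX])
      fix s assume s: "t \<le> s" "s \<le> X"
      then show "\<exists>D. (deriv u has_real_derivative D) (at s) \<and> 0 < D"
        using EL_deriv2[OF E, of s] U2_mid[of s] t X by (intro exI[of _ "U2 s"]) auto
    qed
    then show ?thesis using dX by simp
  qed (use dX in simp)
  have "continuous_on {X..} u" using u_cont by (rule continuous_on_subset) (use X in auto)
  then obtain x3 where x3: "X \<le> x3" "\<And>x. X \<le> x \<Longrightarrow> u x3 \<le> u x" "u x3 \<le> u (X + 1)"
    using decaying_attains_min[OF _ u_lim, of X "X + 1"] right[of "X + 1"] by auto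
  have ux3: "u x3 < 0" using x3(3) right[of "X + 1"] by simp
  then have x3X: "X < x3" using x3(1) u2 by (cases "x3 = X") auto
  have loc_min: "\<exists>e>0. \<forall>t. \<bar>t - y\<bar> < e \<longrightarrow> u y \<le> u t" if "local_min_point_on u {x1..} y" "x1 < y" for y
  proof -
    have "\<forall>\<^sub>F x in at y. u y \<le> u x" using that at_within_tail[OF that(2)] by (simp add: local_min_point_on_def)
    then obtain e where "e > 0" "\<And>t. t \<noteq> y \<Longrightarrow> dist t y < e \<Longrightarrow> u y \<le> u t" by (auto simp: eventually_at)
    then show ?thesis by (intro exI[of _ e]) (auto simp: dist_real_def, metis order_refl)
  qed
  have x3_loc: "u x3 \<le> u t" if "\<bar>t - x3\<bar> < x3 - X" for t using x3(2)[of t] that by auto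
  have unique: "y = x3" if y: "X < y" "e > 0" "\<And>t. \<bar>t - y\<bar> < e \<Longrightarrow> u y \<le> u t" for y e
  proof (rule ccontr)
    assume "y \<noteq> x3"
    then consider "y < x3" | "x3 < y" by linarith
    then show False
    proof cases
      case 1
      show False
        by (rule no_two_local_minima[OF W y(1) 1, of "min e (x3 - X)"]) (use y x3_loc x3X in auto)
    next
      case 2
      show False
        by (rule no_two_local_minima[OF W x3X 2, of "min e (x3 - X)"]) (use y x3_loc x3X in auto)
    qed
  qed
  have not_min: "\<not> local_min_point_on u {x1..} y" if y: "x1 \<le> y" "y \<le> X" for y
  proof
    assume "local_min_point_on u {x1..} y"
    then have "\<forall>\<^sub>F x in at y within {x1..}. u y \<le> u x" by (simp add: local_min_point_on_def)
    then obtain e where e: "e > 0" "\<And>t. t \<in> {x1..} \<Longrightarrow> t \<noteq> y \<Longrightarrow> dist t y < e \<Longrightarrow> u y \<le> u t"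
      by (auto simp: eventually_at)
    have "0 < y" using y X by simp
    from DERIV_neg_dec_right[OF EL_deriv[OF E[OF this]] dneg[OF y]]
    obtain s where s: "s > 0" "\<And>h. 0 < h \<Longrightarrow> h < s \<Longrightarrow> u (y + h) < u y" by auto
    define h where "h = min e s / 2"
    have h: "0 < h" "h < e" "h < s" using e s unfolding h_def by linarith+
    have "u y \<le> u (y + h)" using h y by (intro e(2)) (auto simp: dist_real_def)
    then show False using s(2)[of h] h by simp
  qed
  have min_part: "\<exists>x3>X. u x3 < 0 \<and> {y. global_min_point_on u {X<..} y} = {x3} \<and> {y. local_min_point_on u {x1..} y} = {x3}"
  proof (intro exI[of _ x3] conjI x3X ux3 set_eqI iffI)
    fix y assume "y \<in> {y. global_min_point_on u {X<..} y}"
    then have y: "X < y" "\<And>x. X < x \<Longrightarrow> u y \<le> u x" by (auto simp: global_min_point_on_def)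
    have "y = x3" by (rule unique[OF y(1), of "y - X"]) (use y in auto)
    then show "y \<in> {x3}" by simp
  next
    fix y assume "y \<in> {x3}"
    then show "y \<in> {y. global_min_point_on u {X<..} y}" using x3 x3X by (auto simp: global_min_point_on_def)
  next
    fix y assume "y \<in> {y. local_min_point_on u {x1..} y}"
    then have y: "local_min_point_on u {x1..} y" "x1 \<le> y" by (auto simp: local_min_point_on_def)
    then have "X < y" using not_min[of y] by force
    then show "y \<in> {x3}" using loc_min[OF y(1)] X unique by auto
  next
    fix y assume "y \<in> {x3}"
    then have y: "y = x3" by simp
    have "\<forall>\<^sub>F x in at x3 within {x1..}. u x3 \<le> u x"
      unfolding eventually_at using x3_loc x3X by (intro exI[of _ "x3 - X"]) (auto simp: dist_real_def)
    then show "y \<in> {y. local_min_point_on u {x1..} y}" using y x3X X by (simp add: local_min_point_on_def)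
  qed
  show ?thesis
  proof (rule that[OF X(1,2) _ _ left mid right _ min_part])
    show "{x. 0 \<le> x \<and> u x = \<beta>} = {x1}"
    proof (intro set_eqI iffI)
      fix x assume "x \<in> {x. 0 \<le> x \<and> u x = \<beta>}"
      then have x: "0 \<le> x" "u x = \<beta>" by auto
      show "x \<in> {x1}" using x left[of x] mid[of x] right[of x] u2 \<beta>
        by (cases x x1 rule: linorder_cases; cases x X rule: linorder_cases) auto
    qed (use u1 X in auto)
    show "{x. 0 \<le> x \<and> u x = 0} = {X}"
    proof (intro set_eqI iffI)
      fix x assume "x \<in> {x. 0 \<le> x \<and> u x = 0}"
      then have x: "0 \<le> x" "u x = 0" by auto
      show "x \<in> {X}" using x left[of x] mid[of x] right[of x] u1 \<beta>
        by (cases x x1 rule: linorder_cases; cases x X rule: linorder_cases) auto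
    qed (use u2 X in auto)
    show "u differentiable at x \<and> deriv u x < 0" if "x \<in> {x1..X}" for x
      using that X dneg[of x] EL_deriv[OF E, of x] by (auto simp: real_differentiable_def)
  qed auto
qed

end

theorem theorem1p2:
  fixes \<beta> \<gamma> d M d0 :: real and u0 v0 :: "real \<Rightarrow> real"
  assumes "1/3 < \<beta>" "\<beta> < 1/2"
    and "0 < \<gamma>" "\<gamma> < \<gamma>1 \<beta>"
    and "M_const \<beta> \<gamma> M"
    and "d0_const \<beta> \<gamma> M d0"
    and "0 < d" "d < d1 \<beta> \<gamma> d0"
    and "u0 \<in> admissible \<beta> M"
    and "ereal (J \<beta> \<gamma> d u0) = (INF w\<in>admissible \<beta> M. ereal (J \<beta> \<gamma> d w))"
    and "v0 = N \<gamma> u0"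
  shows "\<exists>x1 x2. 0 < x1 \<and> x1 < x2 \<and>
      \<comment> \<open>(i)\<close>
      {x. 0 \<le> x \<and> u0 x = \<beta>} = {x1} \<and> {x. 0 \<le> x \<and> u0 x = 0} = {x2} \<and>
      u0 differentiable at x1 \<and> deriv u0 x1 < 0 \<and>
      u0 differentiable at x2 \<and> deriv u0 x2 < 0 \<and>
      \<comment> \<open>(ii)\<close>
      (\<forall>x. 0 \<le> x \<and> x < x1 \<longrightarrow> u0 x > \<beta>) \<and>
      (\<forall>x. x1 < x \<and> x < x2 \<longrightarrow> 0 < u0 x \<and> u0 x < \<beta>) \<and>
      (\<forall>x>x2. u0 x < 0) \<and>
      \<comment> \<open>(iii)\<close>
      (\<forall>x\<in>{x1..x2}. u0 differentiable at x \<and> deriv u0 x < 0) \<and>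
      \<comment> \<open>(iv)\<close>
      (\<exists>x3>x2. u0 x3 < 0 \<and>
         {y. global_min_point_on u0 {x2<..} y} = {x3} \<and>
         {y. local_min_point_on u0 {x1..} y} = {x3}) \<and>
      \<comment> \<open>(v)\<close>
      (\<forall>x\<ge>0. v0 x > 0)"
proof -
  have u0: "u0 \<in> H1" using assms(9) by (simp add: admissible_def)
  have min: "J \<beta> \<gamma> d u0 \<le> J \<beta> \<gamma> d w" if "w \<in> admissible \<beta> M" for w
  proof -
    have "ereal (J \<beta> \<gamma> d u0) \<le> ereal (J \<beta> \<gamma> d w)" unfolding assms(10) using that by (rule INF_lower)
    then show ?thesis by simp
  qed
  have d: "d \<le> d0" "d < \<beta>\<^sup>2 / (4 * (1 + \<beta> * \<gamma>))" using assms(8) by (auto simp: d1_def)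
  obtain M0 where "M0 > 0" "\<exists>q0\<in>admissible \<beta> M. J \<beta> \<gamma> d q0 \<le> - M0"
    using assms(6,7) d(1) by (auto simp: d0_const_def)
  then have neg: "J \<beta> \<gamma> d u0 < 0" using min by force
  obtain v v1 B where v: "\<And>x. 0 \<le> x \<Longrightarrow> N \<gamma> u0 x = v x"
    "\<And>x. (v has_real_derivative v1 x) (at x)"
    "\<And>x. (v1 has_real_derivative \<gamma> * v x + v x ^ 3 - u0 \<bar>x\<bar>) (at x)"
    "\<And>x. v (- x) = v x" "v1 0 = 0"
    by (rule N_classical[OF assms(3) u0]) blast
  interpret pulse \<beta> \<gamma> d M u0 v v1
    by unfold_locales (use assms v min neg d in \<open>auto simp: \<gamma>1_def M_const_def\<close>)
  obtain x1 x2 where x: "0 < x1" "x1 < x2" "{x. 0 \<le> x \<and> u0 x = \<beta>} = {x1}" "{x. 0 \<le> x \<and> u0 x = 0} = {x2}"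
    "\<And>x. 0 \<le> x \<Longrightarrow> x < x1 \<Longrightarrow> \<beta> < u0 x" "\<And>x. x1 < x \<Longrightarrow> x < x2 \<Longrightarrow> 0 < u0 x \<and> u0 x < \<beta>" "\<And>x. x2 < x \<Longrightarrow> u0 x < 0"
    "\<And>x. x \<in> {x1..x2} \<Longrightarrow> u0 differentiable at x \<and> deriv u0 x < 0"
    "\<exists>x3>x2. u0 x3 < 0 \<and> {y. global_min_point_on u0 {x2<..} y} = {x3} \<and> {y. local_min_point_on u0 {x1..} y} = {x3}"
    by (rule pulse_profile) blast
  have "0 < v0 t" if "0 \<le> t" for t using v_pos[OF that] v(1)[OF that] assms(11) by simp
  then show ?thesis
    using x(1-4) x(5) x(6) x(7) x(8) x(8)[of x1] x(8)[of x2] x(9)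
    by (intro exI[of _ x1] exI[of _ x2]) auto
qed

end
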